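(* Let $N\ge 1$. A two-qubit unitary operation $U$ is deterministically implementable over the $N$-bridge ladder network (the $(2,N)$-cluster network) if and only if $\mathrm{KC}\#(U)\le N$.
   Context: The $(k,N)$-cluster network has nodes $v_{i,j}$ ($1\le i\le k$, $1\le j\le N$), input nodes $v_{i,1}$, output nodes $v_{i,N}$, vertical edges $\{v_{i,j},v_{i+1,j}\}$ and horizontal edges $\{v_{i,j},v_{i,j+1}\}$. Its resource state is the tensor product over all edges of an EPR pair $(|00\rangle+|11\rangle)/\sqrt2$ with one qubit at each endpoint. Each input node holds one input qubit and each output node one output qubit. A $k$-qubit unitary $U$ is deterministically implementable over the network if some LOCC map $\Gamma$ (local operations at single nodes with unrestricted classical communication between nodes) satisfies $\Gamma(|\psi\rangle\langle\psi|\otimes|\Phi\rangle\langle\Phi|_{\mathcal R})=U|\psi\rangle\langle\psi|U^\dagger$ on the output qubits for every pure input state $|\psi\rangle$. Every two-qubit unitary can be written $U=(u\otimes u')\,e^{i(xX\otimes X+yY\otimes Y+zZ\otimes Z)}\,(w\otimes w')$ with single-qubit unitaries $u,u',w,w'$, Pauli matrices $X,Y,Z$, and $(x,y,z)$ in the Weyl chamber $0\le x<\pi/2$ (or $0\le x\le\pi/4$ if $z=0$), $0\le y\le\min\{x,\pi/2-x\}$, $0\le z\le y$, which determines $(x,y,z)$ uniquely; the Kraus–Cirac number $\mathrm{KC}\#(U)$ is the number of nonzero entries among $x,y,z$. *)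

theory Defs
  imports Complex_Main "Jordan_Normal_Form.Matrix"
begin

definition adjm :: "complex mat \<Rightarrow> complex mat" where
  "adjm A = mat (dim_col A) (dim_row A) (\<lambda>(i,j). cnj (A $$ (j,i)))"

definition is_unitary :: "nat \<Rightarrow> complex mat \<Rightarrow> bool" where
  "is_unitary n A \<longleftrightarrow> A \<in> carrier_mat n n \<and> A * adjm A = 1\<^sub>m n"

definition kron2 :: "complex mat \<Rightarrow> complex mat \<Rightarrow> complex mat" where
  "kron2 A B = mat 4 4 (\<lambda>(i,j). A $$ (i div 2, j div 2) * B $$ (i mod 2, j mod 2))"

definition pauliX :: "complex mat" where
  "pauliX = mat_of_rows_list 2 [[0, 1], [1, 0]]"
definition pauliY :: "complex mat" where
  "pauliY = mat_of_rows_list 2 [[0, -\<i>], [\<i>, 0]]"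
definition pauliZ :: "complex mat" where
  "pauliZ = mat_of_rows_list 2 [[1, 0], [0, -1]]"

text \<open>exp(i t P) for an involution P (P*P = 1), i.e. cos t I + i sin t P.\<close>
definition expi_inv :: "real \<Rightarrow> complex mat \<Rightarrow> complex mat" where
  "expi_inv t P = complex_of_real (cos t) \<cdot>\<^sub>m 1\<^sub>m 4 + (\<i> * complex_of_real (sin t)) \<cdot>\<^sub>m P"

text \<open>exp(i(x XX + y YY + z ZZ)); XX, YY, ZZ pairwise commute and square to 1,
  so the exponential factors as the product below.\<close>
definition canon_gate :: "real \<Rightarrow> real \<Rightarrow> real \<Rightarrow> complex mat" where
  "canon_gate x y z =
     expi_inv x (kron2 pauliX pauliX) * expi_inv y (kron2 pauliY pauliY) *
     expi_inv z (kron2 pauliZ pauliZ)"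

definition weyl_chamber :: "real \<times> real \<times> real \<Rightarrow> bool" where
  "weyl_chamber c \<longleftrightarrow> (case c of (x, y, z) \<Rightarrow>
      0 \<le> x \<and> (if z = 0 then x \<le> pi / 4 else x < pi / 2) \<and>
      0 \<le> y \<and> y \<le> min x (pi / 2 - x) \<and> 0 \<le> z \<and> z \<le> y)"

definition weyl_coords :: "complex mat \<Rightarrow> real \<times> real \<times> real" where
  "weyl_coords U = (THE c. weyl_chamber c \<and>
     (\<exists>u u' w w'. is_unitary 2 u \<and> is_unitary 2 u' \<and> is_unitary 2 w \<and> is_unitary 2 w' \<and>
        U = kron2 u u' * (case c of (x, y, z) \<Rightarrow> canon_gate x y z) * kron2 w w'))"

definition KC_num :: "complex mat \<Rightarrow> nat" where
  "KC_num U = (case weyl_coords U of (x, y, z) \<Rightarrow> length (filter (\<lambda>t. t \<noteq> 0) [x, y, z]))"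

definition cl_nodes :: "nat \<Rightarrow> nat \<Rightarrow> (nat \<times> nat) set" where
  "cl_nodes k N = {(i, j). 1 \<le> i \<and> i \<le> k \<and> 1 \<le> j \<and> j \<le> N}"

definition cl_adj :: "nat \<Rightarrow> nat \<Rightarrow> nat \<times> nat \<Rightarrow> nat \<times> nat \<Rightarrow> bool" where
  "cl_adj k N v w \<longleftrightarrow> v \<in> cl_nodes k N \<and> w \<in> cl_nodes k N \<and>
     ((fst v = fst w \<and> (snd w = snd v + 1 \<or> snd v = snd w + 1)) \<or>
      (snd v = snd w \<and> (fst w = fst v + 1 \<or> fst v = fst w + 1)))"

definition cl_edges :: "nat \<Rightarrow> nat \<Rightarrow> (nat \<times> nat) set set" where
  "cl_edges k N = {{v, w} | v w. cl_adj k N v w}"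

text \<open>Qubit labels: input qubit of row i, output qubit of row i, and
  \<open>Half v w\<close> = the qubit at node v of the EPR pair on edge {v,w}.\<close>
datatype qlab = Inp nat | Outp nat | Half "nat \<times> nat" "nat \<times> nat"

definition qubits :: "nat \<Rightarrow> nat \<Rightarrow> qlab set" where
  "qubits k N = {Inp i | i. 1 \<le> i \<and> i \<le> k} \<union> {Outp i | i. 1 \<le> i \<and> i \<le> k}
      \<union> {Half v w | v w. cl_adj k N v w}"

definition out_qubits :: "nat \<Rightarrow> qlab set" where
  "out_qubits k = {Outp i | i. 1 \<le> i \<and> i \<le> k}"

fun qloc :: "nat \<Rightarrow> qlab \<Rightarrow> nat \<times> nat" where
  "qloc N (Inp i) = (i, 1)"
| "qloc N (Outp i) = (i, N)"
| "qloc N (Half v w) = v"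

definition node_qubits :: "nat \<Rightarrow> nat \<Rightarrow> nat \<times> nat \<Rightarrow> qlab set" where
  "node_qubits k N v = {q \<in> qubits k N. qloc N q = v}"

section \<open>Operators on a finite set of qubits (computational basis = assignments)\<close>

type_synonym op = "(qlab \<Rightarrow> bool) \<Rightarrow> (qlab \<Rightarrow> bool) \<Rightarrow> complex"

definition bst :: "qlab set \<Rightarrow> (qlab \<Rightarrow> bool) set" where
  "bst S = {f. \<forall>q. q \<notin> S \<longrightarrow> \<not> f q}"

definition restr :: "(qlab \<Rightarrow> bool) \<Rightarrow> qlab set \<Rightarrow> qlab \<Rightarrow> bool" where
  "restr x T = (\<lambda>q. q \<in> T \<and> x q)"

definition mmul :: "qlab set \<Rightarrow> op \<Rightarrow> op \<Rightarrow> op" where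
  "mmul S A B = (\<lambda>x y. \<Sum>z\<in>bst S. A x z * B z y)"

definition adj_op :: "op \<Rightarrow> op" where
  "adj_op A = (\<lambda>x y. cnj (A y x))"

definition id_op :: op where
  "id_op = (\<lambda>x y. if x = y then 1 else 0)"

text \<open>A acts on S as B \<otimes> identity, with B acting on the subsystem T.\<close>
definition local_on :: "qlab set \<Rightarrow> qlab set \<Rightarrow> op \<Rightarrow> bool" where
  "local_on S T A \<longleftrightarrow> (\<exists>B :: op. \<forall>x\<in>bst S. \<forall>y\<in>bst S.
      A x y = (if \<forall>q\<in>S - T. x q = y q then B (restr x T) (restr y T) else 0))"

definition kraus_complete :: "qlab set \<Rightarrow> op list \<Rightarrow> bool" where
  "kraus_complete S Ks \<longleftrightarrow> (\<forall>x\<in>bst S. \<forall>y\<in>bst S.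
      (\<Sum>K\<leftarrow>Ks. mmul S (adj_op K) K x y) = id_op x y)"

definition apply_kraus :: "qlab set \<Rightarrow> op list \<Rightarrow> op \<Rightarrow> op" where
  "apply_kraus S Ks \<rho> = (\<lambda>x y. \<Sum>K\<leftarrow>Ks. \<Sum>a\<in>bst S. \<Sum>b\<in>bst S. K x a * \<rho> a b * cnj (K y b))"

text \<open>A protocol: some node applies a local instrument (Kraus operators acting only on
  its qubits, one outcome per Kraus operator); the outcome is broadcast and the rest of
  the protocol may depend on it.  The list collects the Kraus operators of all branches.\<close>
inductive locc :: "nat \<Rightarrow> nat \<Rightarrow> op list \<Rightarrow> bool" for k N where
  locc_id: "locc k N [id_op]"
| locc_step: "\<lbrakk> v \<in> cl_nodes k N;
     \<forall>K\<in>set Ks. local_on (qubits k N) (node_qubits k N v) K;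
     kraus_complete (qubits k N) Ks;
     length Ps = length Ks;
     \<forall>i<length Ks. locc k N (Ps ! i) \<rbrakk> \<Longrightarrow>
     locc k N (concat (map (\<lambda>i. map (\<lambda>L. mmul (qubits k N) L (Ks ! i)) (Ps ! i)) [0..<length Ks]))"

text \<open>Row i is the i-th tensor factor, most significant bit first.\<close>
definition in_index :: "nat \<Rightarrow> (qlab \<Rightarrow> bool) \<Rightarrow> nat" where
  "in_index k x = (\<Sum>i\<in>{1..k}. if x (Inp i) then 2 ^ (k - i) else 0)"

definition out_index :: "nat \<Rightarrow> (qlab \<Rightarrow> bool) \<Rightarrow> nat" where
  "out_index k x = (\<Sum>i\<in>{1..k}. if x (Outp i) then 2 ^ (k - i) else 0)"

text \<open>Amplitudes of the resource state: tensor product of (|00>+|11>)/sqrt 2 over all edges.\<close>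
definition epr_amp :: "nat \<Rightarrow> nat \<Rightarrow> (qlab \<Rightarrow> bool) \<Rightarrow> complex" where
  "epr_amp k N x = (if \<forall>v w. cl_adj k N v w \<longrightarrow> x (Half v w) = x (Half w v)
      then complex_of_real ((1 / sqrt 2) ^ card (cl_edges k N)) else 0)"

definition init_amp :: "nat \<Rightarrow> nat \<Rightarrow> complex vec \<Rightarrow> (qlab \<Rightarrow> bool) \<Rightarrow> complex" where
  "init_amp k N \<psi> x = \<psi> $ in_index k x * epr_amp k N x *
      (if \<forall>i. \<not> x (Outp i) then 1 else 0)"

definition init_state :: "nat \<Rightarrow> nat \<Rightarrow> complex vec \<Rightarrow> op" where
  "init_state k N \<psi> = (\<lambda>x y. init_amp k N \<psi> x * cnj (init_amp k N \<psi> y))"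

definition ptrace_out :: "nat \<Rightarrow> nat \<Rightarrow> op \<Rightarrow> op" where
  "ptrace_out k N \<rho> = (\<lambda>a b. \<Sum>c\<in>bst (qubits k N - out_qubits k).
      \<rho> (\<lambda>q. if q \<in> out_qubits k then a q else c q) (\<lambda>q. if q \<in> out_qubits k then b q else c q))"

definition det_implementable :: "nat \<Rightarrow> nat \<Rightarrow> complex mat \<Rightarrow> bool" where
  "det_implementable k N U \<longleftrightarrow> (\<exists>Ks. locc k N Ks \<and>
     (\<forall>\<psi> \<in> carrier_vec (2 ^ k). (\<Sum>j<2 ^ k. (cmod (\<psi> $ j))\<^sup>2) = 1 \<longrightarrow>
        (\<forall>a\<in>bst (out_qubits k). \<forall>b\<in>bst (out_qubits k).
           ptrace_out k N (apply_kraus (qubits k N) Ks (init_state k N \<psi>)) a b =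
           (U *\<^sub>v \<psi>) $ out_index k a * cnj ((U *\<^sub>v \<psi>) $ out_index k b))))"

end

theory Submission
  imports Defs "Jordan_Normal_Form.Determinant" "Jordan_Normal_Form.Spectral_Radius"
begin

text \<open>
  Necessity. Every Kraus operator of a protocol is a product over the nodes, so a branch that succeeds
  writes \<open>U\<close>, up to a scalar, as a tensor network on the ladder: for one bridge \<open>U\<close> has operator Schmidt
  rank at most 2, for two bridges \<open>U = V W\<close> with \<open>V\<close>, \<open>W\<close> of operator Schmidt rank at most 2.
  Let \<open>X = U~ U\<close>, where \<open>U~ = (Y \<otimes> Y) U\<^sup>T (Y \<otimes> Y)\<close>; for \<open>U\<close> locally equivalent to
  \<open>e\<^bsup>i(x XX + y YY + z ZZ)\<^esup>\<close> its trace is, up to a square root of \<open>det U\<close>,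
  \<open>4 (cos 2x cos 2y cos 2z + i sin 2x sin 2y sin 2z)\<close>.
  If \<open>V\<close> has rank at most 2 then \<open>V~ V = a + M\<close> with \<open>M\<close> traceless and \<open>(a - M) (a + M) = det V\<close>. Hence
  \<open>U = V W\<close> forces \<open>tr X = det U * tr (X\<^sup>-\<^sup>1)\<close>, the sine product vanishes, and \<open>z = 0\<close> in the Weyl chamber.

  Sufficiency. One EPR pair across a bridge implements \<open>e\<^bsup>i t ZZ\<^esup>\<close>: copy one data qubit to the other side
  by a parity measurement, apply the gate there, erase the copy by an X measurement and correct by a
  Z. The data is then teleported to the next column. Three bridges suffice for every gate by the Cartan
  decomposition, which is obtained from real eigenvectors of the symmetric unitary \<open>X\<close> in the magic basis.
\<close>

section \<open>Two-qubit gates, spin flip and local invariants\<close>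

text \<open>The passage from protocols to tensor networks rests on purity: a sum of branches that
  sends every pure input to the pure output \<open>U \<psi>\<close> consists of multiples of
  \<open>U\<close>, so one Kraus operator together with one final configuration of the discarded
  qubits already yields the factorisation of \<open>U\<close>. The square root of
  \<open>det U\<close> is known only up to sign. Hence uniqueness of the Weyl coordinates cannot
  compare the traces themselves and uses the squares of their real and imaginary parts and the
  product of the two. Protocols are constructed from their end. All instruments have equally likely
  outcomes, so after rescaling every outcome can be required to lead to one and the same target, and
  a Pauli correction is just one more step. Each measured qubit is reset to 0 within its Kraus
  operator; the global state thus remains a single explicit amplitude function, and the final
  partial trace has a single term.\<close>

lemmas assoc_mat4 = assoc_mult_mat[of _ 4 4 _ 4 _ 4]
lemmas smult_mat4 = mult_smult_assoc_mat[of _ 4 4 _ 4] mult_smult_distrib[of _ 4 4 _ 4]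
lemmas distrib_mat4 = add_mult_distrib_mat[of _ 4 4 _ _ 4] mult_add_distrib_mat[of _ 4 4 _ 4]
lemmas right_one_mat4 = right_mult_one_mat[of _ 4 4]

lemma sum_upto_4: "(\<Sum>k = 0..<4. f k) = f 0 + f (1::nat) + f 2 + (f 3 :: 'a :: comm_monoid_add)"
  by (simp add: numeral_eq_Suc add.assoc)

lemma sum_upto_2: "(\<Sum>k = 0..<2. f k) = f 0 + (f (1::nat) :: 'a :: comm_monoid_add)"
  by (simp add: numeral_eq_Suc)

lemma less_4_cases: "(i::nat) < 4 \<longleftrightarrow> i = 0 \<or> i = 1 \<or> i = 2 \<or> i = 3"
  by auto

lemma eq_mat4I:
  assumes "A \<in> carrier_mat 4 4" "B \<in> carrier_mat 4 4"
    and "\<And>i j. i < 4 \<Longrightarrow> j < 4 \<Longrightarrow> A $$ (i,j) = B $$ (i,j)"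
  shows "A = B"
  using assms by (intro eq_matI) auto

lemma eq_mat4_casesI:
  assumes "A \<in> carrier_mat 4 4" "B \<in> carrier_mat 4 4"
    and "A $$ (0,0) = B $$ (0,0)" "A $$ (0,1) = B $$ (0,1)" "A $$ (0,2) = B $$ (0,2)" "A $$ (0,3) = B $$ (0,3)"
    and "A $$ (1,0) = B $$ (1,0)" "A $$ (1,1) = B $$ (1,1)" "A $$ (1,2) = B $$ (1,2)" "A $$ (1,3) = B $$ (1,3)"
    and "A $$ (2,0) = B $$ (2,0)" "A $$ (2,1) = B $$ (2,1)" "A $$ (2,2) = B $$ (2,2)" "A $$ (2,3) = B $$ (2,3)"
    and "A $$ (3,0) = B $$ (3,0)" "A $$ (3,1) = B $$ (3,1)" "A $$ (3,2) = B $$ (3,2)" "A $$ (3,3) = B $$ (3,3)"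
  shows "A = B"
proof (rule eq_mat4I[OF assms(1,2)])
  fix i j :: nat assume "i < 4" "j < 4"
  then show "A $$ (i,j) = B $$ (i,j)"
    using assms(3-) unfolding less_4_cases by (elim disjE) simp_all
qed

lemma eq_mat2I:
  assumes "A \<in> carrier_mat 2 2" "B \<in> carrier_mat 2 2"
    and "A $$ (0,0) = B $$ (0,0)" "A $$ (0,1) = B $$ (0,1)"
    and "A $$ (1,0) = B $$ (1,0)" "A $$ (1,1) = B $$ (1,1)"
  shows "A = B"
  using assms by (intro eq_matI) (auto simp: less_2_cases_iff)

lemma mult_index4:
  assumes "A \<in> carrier_mat 4 4" "B \<in> carrier_mat 4 4" "i < 4" "j < 4"
  shows "(A * B) $$ (i,j) = A $$ (i,0) * B $$ (0,j) + A $$ (i,1) * B $$ (1,j)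
     + A $$ (i,2) * B $$ (2,j) + A $$ (i,3) * B $$ (3,j)"
  using assms by (auto simp: scalar_prod_def sum_upto_4)

lemma mult_index2:
  assumes "A \<in> carrier_mat 2 2" "B \<in> carrier_mat 2 2" "i < 2" "j < 2"
  shows "(A * B) $$ (i,j) = A $$ (i,0) * B $$ (0,j) + A $$ (i,1) * B $$ (1,j)"
  using assms by (auto simp: scalar_prod_def sum_upto_2)

lemma kron2_carrier [simp]: "kron2 A B \<in> carrier_mat 4 4"
  by (simp add: kron2_def)

lemma kron2_dim [simp]: "dim_row (kron2 A B) = 4" "dim_col (kron2 A B) = 4"
  by (simp_all add: kron2_def)

lemma mult_carrier_4 [simp]: "A \<in> carrier_mat 4 4 \<Longrightarrow> B \<in> carrier_mat 4 4 \<Longrightarrow> A * B \<in> carrier_mat 4 4"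
  by auto

lemma mult_carrier_2 [simp]: "A \<in> carrier_mat 2 2 \<Longrightarrow> B \<in> carrier_mat 2 2 \<Longrightarrow> A * B \<in> carrier_mat 2 2"
  by auto

lemma smult_smult_mat: "a \<cdot>\<^sub>m (b \<cdot>\<^sub>m A) = (a * b :: 'a :: comm_ring_1) \<cdot>\<^sub>m A"
  by (intro eq_matI) (auto simp: mult.assoc)

lemma kron2_index: "i < 4 \<Longrightarrow> j < 4 \<Longrightarrow>
    kron2 A B $$ (i,j) = A $$ (i div 2, j div 2) * B $$ (i mod 2, j mod 2)"
  by (simp add: kron2_def)

lemma kron2_mult:
  assumes "A \<in> carrier_mat 2 2" "B \<in> carrier_mat 2 2" "C \<in> carrier_mat 2 2" "D \<in> carrier_mat 2 2"
  shows "kron2 A B * kron2 C D = kron2 (A * C) (B * D)"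
proof (rule eq_mat4I)
  fix i j :: nat assume ij: "i < 4" "j < 4"
  then have d: "i div 2 < 2" "i mod 2 < 2" "j div 2 < 2" "j mod 2 < 2" by auto
  show "(kron2 A B * kron2 C D) $$ (i,j) = kron2 (A * C) (B * D) $$ (i,j)"
    unfolding mult_index4[OF kron2_carrier kron2_carrier ij]
    by (simp add: ij d kron2_index mult_index2[OF assms(1,3)] mult_index2[OF assms(2,4)]
        algebra_simps del: index_mult_mat)
qed auto

lemma kron2_one: "kron2 (1\<^sub>m 2) (1\<^sub>m 2) = 1\<^sub>m 4"
  by (rule eq_mat4_casesI) (simp_all add: kron2_index)

lemma kron2_smult_left: "A \<in> carrier_mat 2 2 \<Longrightarrow> kron2 (c \<cdot>\<^sub>m A) B = c \<cdot>\<^sub>m kron2 A B"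
  by (rule eq_mat4I) (auto simp: kron2_index)

lemma kron2_smult_right: "B \<in> carrier_mat 2 2 \<Longrightarrow> kron2 A (c \<cdot>\<^sub>m B) = c \<cdot>\<^sub>m kron2 A B"
  by (rule eq_mat4I) (auto simp: kron2_index)

section \<open>Adjoints and unitary matrices\<close>

lemma adjm_carrier [simp]: "A \<in> carrier_mat n m \<Longrightarrow> adjm A \<in> carrier_mat m n"
  by (auto simp: adjm_def)

lemma adjm_dim [simp]: "dim_row (adjm A) = dim_col A" "dim_col (adjm A) = dim_row A"
  by (simp_all add: adjm_def)

lemma adjm_index [simp]: "i < dim_col A \<Longrightarrow> j < dim_row A \<Longrightarrow> adjm A $$ (i,j) = cnj (A $$ (j,i))"
  by (simp add: adjm_def)

lemma adjm_mult:
  assumes "A \<in> carrier_mat n m" "B \<in> carrier_mat m k"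
  shows "adjm (A * B) = adjm B * adjm A"
  using assms by (intro eq_matI) (auto simp: adjm_def scalar_prod_def intro!: sum.cong)

lemma adjm_adjm [simp]: "adjm (adjm A) = A"
  by (intro eq_matI) (auto simp: adjm_def)

lemma adjm_smult: "adjm (c \<cdot>\<^sub>m A) = cnj c \<cdot>\<^sub>m adjm A"
  by (intro eq_matI) (auto simp: adjm_def)

lemma adjm_one [simp]: "adjm (1\<^sub>m n) = 1\<^sub>m n"
  by (intro eq_matI) (auto simp: adjm_def)

lemma adjm_kron2: "A \<in> carrier_mat 2 2 \<Longrightarrow> B \<in> carrier_mat 2 2 \<Longrightarrow>
    adjm (kron2 A B) = kron2 (adjm A) (adjm B)"
  by (rule eq_mat4I) (auto simp: kron2_index adjm_def kron2_def)

lemma unitary_carrier: "is_unitary n A \<Longrightarrow> A \<in> carrier_mat n n"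
  by (simp add: is_unitary_def)

lemma unitary_right: "is_unitary n A \<Longrightarrow> A * adjm A = 1\<^sub>m n"
  by (simp add: is_unitary_def)

lemma unitary_left: "is_unitary n A \<Longrightarrow> adjm A * A = 1\<^sub>m n"
  by (auto simp: is_unitary_def intro: mat_mult_left_right_inverse)

lemma unitary_adjm: "is_unitary n A \<Longrightarrow> is_unitary n (adjm A)"
  using unitary_left[of n A] by (auto simp: is_unitary_def)

lemma unitary_one [simp]: "is_unitary n (1\<^sub>m n)"
  by (simp add: is_unitary_def)

text \<open>A scalar stands in place of the identity for two uses: unitarity of products, with
  scalar 1, and the cancellation of local gates against their spin flips, which leaves a
  determinant.\<close>

lemma mat_cancel_mid:
  assumes "A \<in> carrier_mat n n" "B \<in> carrier_mat n n" "C \<in> carrier_mat n n" "D \<in> carrier_mat n n"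
    "B * C = c \<cdot>\<^sub>m 1\<^sub>m n"
  shows "(A * B) * (C * D) = c \<cdot>\<^sub>m (A * D :: 'a :: comm_ring_1 mat)"
proof -
  have "(A * B) * (C * D) = A * ((B * C) * D)"
    using assms(1-4) assoc_mult_mat[of B n n C n D n] assoc_mult_mat[of A n n B n "C * D" n] by simp
  also have "\<dots> = c \<cdot>\<^sub>m (A * D)"
    unfolding assms(5) using assms(1-4) by (simp add: mult_smult_assoc_mat[of _ n n _ n]
        mult_smult_distrib[of _ n n _ n])
  finally show ?thesis .
qed

lemma unitary_mult:
  assumes "is_unitary n A" "is_unitary n B"
  shows "is_unitary n (A * B)"
proof -
  have c: "A \<in> carrier_mat n n" "B \<in> carrier_mat n n" using assms by (auto simp: is_unitary_def)
  have "(A * B) * adjm (A * B) = (A * B) * (adjm B * adjm A)"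
    using adjm_mult[OF c] by simp
  also have "\<dots> = 1 \<cdot>\<^sub>m (A * adjm A)"
    by (rule mat_cancel_mid) (use c unitary_right[OF assms(2)] in auto)
  finally show ?thesis using c unitary_right[OF assms(1)] by (auto simp: is_unitary_def)
qed

lemma unitary_kron2:
  assumes "is_unitary 2 A" "is_unitary 2 B"
  shows "is_unitary 4 (kron2 A B)"
proof -
  have c: "A \<in> carrier_mat 2 2" "B \<in> carrier_mat 2 2" using assms by (auto simp: is_unitary_def)
  then show ?thesis using assms
    by (simp add: is_unitary_def adjm_kron2 kron2_mult kron2_one)
qed

lemma unitary_smult: "is_unitary n A \<Longrightarrow> cmod c = 1 \<Longrightarrow> is_unitary n (c \<cdot>\<^sub>m A)"
  using complex_norm_square[of c]
  by (auto simp: is_unitary_def adjm_smult mult_smult_assoc_mat[of _ n n _ n]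
      mult_smult_distrib[of _ n n _ n] smult_smult_mat mult.commute)

definition tr4 :: "complex mat \<Rightarrow> complex" where
  "tr4 A = A $$ (0,0) + A $$ (1,1) + A $$ (2,2) + A $$ (3,3)"

lemma tr4_comm: "A \<in> carrier_mat 4 4 \<Longrightarrow> B \<in> carrier_mat 4 4 \<Longrightarrow> tr4 (A * B) = tr4 (B * A)"
  by (simp add: tr4_def mult_index4 del: index_mult_mat)

lemma tr4_smult: "A \<in> carrier_mat 4 4 \<Longrightarrow> tr4 (c \<cdot>\<^sub>m A) = c * tr4 A"
  by (simp add: tr4_def algebra_simps)

lemma tr4_add: "A \<in> carrier_mat 4 4 \<Longrightarrow> B \<in> carrier_mat 4 4 \<Longrightarrow> tr4 (A + B) = tr4 A + tr4 B"
  by (simp add: tr4_def algebra_simps)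

lemma tr4_adjm: "A \<in> carrier_mat 4 4 \<Longrightarrow> tr4 (adjm A) = cnj (tr4 A)"
  by (simp add: tr4_def)

section \<open>Adjugates and the spin flip\<close>

definition adjugate2 :: "complex mat \<Rightarrow> complex mat" where
  "adjugate2 A = mat 2 2 (\<lambda>(i,j). if i = j then A $$ (1-i,1-j) else - A $$ (i,j))"

definition det2 :: "complex mat \<Rightarrow> complex" where
  "det2 A = A $$ (0,0) * A $$ (1,1) - A $$ (0,1) * A $$ (1,0)"

lemma adjugate2_carrier [simp]: "adjugate2 A \<in> carrier_mat 2 2" by (simp add: adjugate2_def)

lemma adjugate2_index: "adjugate2 A $$ (0,0) = A $$ (1,1)" "adjugate2 A $$ (0,1) = - A $$ (0,1)"
   "adjugate2 A $$ (1,0) = - A $$ (1,0)" "adjugate2 A $$ (1,1) = A $$ (0,0)"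
   "adjugate2 A $$ (0,Suc 0) = - A $$ (0,1)"
   "adjugate2 A $$ (Suc 0,0) = - A $$ (1,0)" "adjugate2 A $$ (Suc 0,Suc 0) = A $$ (0,0)"
  by (simp_all add: adjugate2_def)

lemma adjugate2_mult_left: "A \<in> carrier_mat 2 2 \<Longrightarrow> adjugate2 A * A = det2 A \<cdot>\<^sub>m 1\<^sub>m 2"
  by (rule eq_mat2I) (simp_all add: mult_index2[OF adjugate2_carrier] adjugate2_index det2_def algebra_simps
    del: index_mult_mat(1))

lemma adjugate2_mult_right: "A \<in> carrier_mat 2 2 \<Longrightarrow> A * adjugate2 A = det2 A \<cdot>\<^sub>m 1\<^sub>m 2"
  by (rule eq_mat2I) (simp_all add: mult_index2[OF _ adjugate2_carrier] adjugate2_index det2_def algebra_simps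
    del: index_mult_mat(1))

text \<open>Conjugation by \<open>Y \<otimes> Y\<close> of the transpose: entrywise it is a signed reflection of the index square.\<close>
definition spin_flip :: "complex mat \<Rightarrow> complex mat" where
  "spin_flip A = mat 4 4 (\<lambda>(i,j). (if (i = 0 \<or> i = 3) = (j = 0 \<or> j = 3) then 1 else -1) * A $$ (3 - j, 3 - i))"

lemma spin_flip_carrier [simp]: "spin_flip A \<in> carrier_mat 4 4" by (simp add: spin_flip_def)

lemma spin_flip_dim [simp]: "dim_row (spin_flip A) = 4" "dim_col (spin_flip A) = 4"
  by (simp_all add: spin_flip_def)

lemma spin_flip_index: "i < 4 \<Longrightarrow> j < 4 \<Longrightarrow>
   spin_flip A $$ (i,j) = (if (i = 0 \<or> i = 3) = (j = 0 \<or> j = 3) then 1 else -1) * A $$ (3 - j, 3 - i)"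
  by (simp add: spin_flip_def)

lemma spin_flip_mult:
  assumes "A \<in> carrier_mat 4 4" "B \<in> carrier_mat 4 4"
  shows "spin_flip (A * B) = spin_flip B * spin_flip A"
  using assms by (intro eq_mat4_casesI)
    (simp_all add: spin_flip_index mult_index4 algebra_simps del: index_mult_mat(1))

lemma spin_flip_add: "A \<in> carrier_mat 4 4 \<Longrightarrow> B \<in> carrier_mat 4 4 \<Longrightarrow> spin_flip (A + B) = spin_flip A + spin_flip B"
  by (rule eq_mat4I) (auto simp: spin_flip_index)

lemma spin_flip_spin_flip: "A \<in> carrier_mat 4 4 \<Longrightarrow> spin_flip (spin_flip A) = A"
  by (rule eq_mat4_casesI) (simp_all add: spin_flip_index)

text \<open>For a 2x2 matrix, \<open>Y A^T Y\<close> is the adjugate. Adjugation is linear in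
  dimension two, so the flip of a sum of tensor products can be computed factor by factor.\<close>

lemma spin_flip_kron2: "spin_flip (kron2 A B) = kron2 (adjugate2 A) (adjugate2 B)"
  by (rule eq_mat4_casesI) (simp_all add: spin_flip_index kron2_index adjugate2_index)

lemma spin_flip_one: "spin_flip (1\<^sub>m 4) = 1\<^sub>m 4"
  by (rule eq_mat4_casesI) (simp_all add: spin_flip_index)

lemma spin_flip_adjm: "A \<in> carrier_mat 4 4 \<Longrightarrow> spin_flip (adjm A) = adjm (spin_flip A)"
  by (rule eq_mat4_casesI) (simp_all add: spin_flip_index)

lemma spin_flip_unitary: "is_unitary 4 A \<Longrightarrow> is_unitary 4 (spin_flip A)"
  using unitary_left[of 4 A] spin_flip_mult[of "adjm A" A]
  by (auto simp: is_unitary_def spin_flip_adjm spin_flip_one)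

text \<open>Up to determinants the flip inverts a local gate. Under local equivalence
  \<open>spin_flip U * U\<close> therefore changes only by conjugation and a scalar.\<close>

lemma spin_flip_kron2_mult:
  assumes "A \<in> carrier_mat 2 2" "B \<in> carrier_mat 2 2"
  shows "spin_flip (kron2 A B) * kron2 A B = (det2 A * det2 B) \<cdot>\<^sub>m 1\<^sub>m 4"
    and "kron2 A B * spin_flip (kron2 A B) = (det2 A * det2 B) \<cdot>\<^sub>m 1\<^sub>m 4"
  using assms
  by (simp_all add: spin_flip_kron2 kron2_mult adjugate2_mult_left adjugate2_mult_right kron2_smult_left
      kron2_smult_right kron2_one smult_smult_mat mult.commute)

text \<open>XX, YY and ZZ preserve the parity of the two bits, so the gate splits into two blocks.
  On indices 0, 3 the matrices XX and YY act as a swap with opposite signs, whence the angle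
  \<open>x - y\<close>; on indices 1, 2 they agree, whence \<open>x + y\<close>. ZZ is 1 on the
  former block and -1 on the latter.\<close>

definition canon_entry :: "real \<Rightarrow> real \<Rightarrow> real \<Rightarrow> nat \<Rightarrow> nat \<Rightarrow> complex" where
  "canon_entry x y z i j =
    (if i = j then if i = 0 \<or> i = 3 then cis z * cos (x - y) else cis (-z) * cos (x + y)
     else if i + j \<noteq> 3 then 0
     else if i = 0 \<or> i = 3 then \<i> * cis z * sin (x - y) else \<i> * cis (-z) * sin (x + y))"

lemma pauli_carrier [simp]: "pauliX \<in> carrier_mat 2 2" "pauliY \<in> carrier_mat 2 2" "pauliZ \<in> carrier_mat 2 2"
  by (auto simp: pauliX_def pauliY_def pauliZ_def mat_of_rows_list_def)

lemma pauli_index: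
  "pauliX $$ (0,0) = 0" "pauliX $$ (0,Suc 0) = 1" "pauliX $$ (Suc 0,0) = 1" "pauliX $$ (Suc 0,Suc 0) = 0"
  "pauliY $$ (0,0) = 0" "pauliY $$ (0,Suc 0) = -\<i>" "pauliY $$ (Suc 0,0) = \<i>" "pauliY $$ (Suc 0,Suc 0) = 0"
  "pauliZ $$ (0,0) = 1" "pauliZ $$ (0,Suc 0) = 0" "pauliZ $$ (Suc 0,0) = 0" "pauliZ $$ (Suc 0,Suc 0) = -1"
  by (simp_all add: pauliX_def pauliY_def pauliZ_def mat_of_rows_list_def)

lemma expi_carrier [simp]: "P \<in> carrier_mat 4 4 \<Longrightarrow> expi_inv t P \<in> carrier_mat 4 4"
  by (simp add: expi_inv_def)

lemma canon_carrier [simp]: "canon_gate x y z \<in> carrier_mat 4 4"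
  unfolding canon_gate_def by (intro mult_carrier_mat[of _ 4 4]) auto

lemma expi_index: "P \<in> carrier_mat 4 4 \<Longrightarrow> i < 4 \<Longrightarrow> j < 4 \<Longrightarrow>
   expi_inv t P $$ (i,j) = (if i = j then complex_of_real (cos t) else 0) + \<i> * sin t * P $$ (i,j)"
  by (simp add: expi_inv_def)

lemma all_less_4: "(\<forall>i<4. P i) \<longleftrightarrow> P 0 \<and> P (1::nat) \<and> P 2 \<and> P 3"
  by (auto simp: less_4_cases)

lemma canon_index:
  assumes "i < 4" "j < 4"
  shows "canon_gate x y z $$ (i,j) = canon_entry x y z i j"
proof -
  have c: "cis z = cos z + \<i> * sin z" "cis (-z) = cos z - \<i> * sin z"
    by (simp_all add: complex_eq_iff)
  have k: "kron2 A B \<in> carrier_mat 4 4" for A B by simp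
  have "\<forall>i<4. \<forall>j<4. canon_gate x y z $$ (i,j) = canon_entry x y z i j"
    unfolding canon_gate_def all_less_4
    by (simp add: mult_index4 expi_index kron2_index pauli_index canon_entry_def c
         cos_add sin_add cos_diff sin_diff algebra_simps del: index_mult_mat(1))
  then show ?thesis using assms by blast
qed

lemma canon_dim [simp]: "dim_row (canon_gate x y z) = 4" "dim_col (canon_gate x y z) = 4"
  using canon_carrier[of x y z] by (auto simp del: canon_carrier)

lemma canon_mult: "canon_gate x y z * canon_gate x' y' z' = canon_gate (x + x') (y + y') (z + z')"
proof -
  have c: "cos (x + x' - (y + y')) = cos (x - y) * cos (x' - y') - sin (x - y) * sin (x' - y')"
    "sin (x + x' - (y + y')) = sin (x - y) * cos (x' - y') + cos (x - y) * sin (x' - y')"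
    "cos (x + x' + (y + y')) = cos (x + y) * cos (x' + y') - sin (x + y) * sin (x' + y')"
    "sin (x + x' + (y + y')) = sin (x + y) * cos (x' + y') + cos (x + y) * sin (x' + y')"
    using cos_add[of "x - y" "x' - y'"] sin_add[of "x - y" "x' - y'"]
      cos_add[of "x + y" "x' + y'"] sin_add[of "x + y" "x' + y'"] by (simp_all add: algebra_simps)
  have d: "cis (z + z') = cis z * cis z'" "cis (- z - z') = cis (- z) * cis (- z')"
    by (simp_all add: cis_mult)
  show ?thesis
    by (rule eq_mat4_casesI)
      (simp_all add: mult_index4 canon_index canon_entry_def c d del: index_mult_mat(1) cis_mult,
        simp_all add: algebra_simps del: cis_mult)
qed

lemma canon_zero: "canon_gate 0 0 0 = 1\<^sub>m 4"
  by (rule eq_mat4_casesI) (simp_all add: canon_index canon_entry_def)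

text \<open>The adjugate reverses the sign of every Pauli matrix, and in XX, YY, ZZ the two signs
  cancel.\<close>

lemma spin_flip_canon: "spin_flip (canon_gate x y z) = canon_gate x y z"
  by (rule eq_mat4_casesI) (simp_all add: spin_flip_index canon_index canon_entry_def)

lemma tr4_canon: "tr4 (canon_gate x y z) =
    4 * (complex_of_real (cos x * cos y * cos z) + \<i> * complex_of_real (sin x * sin y * sin z))"
proof -
  have c: "cis z = cos z + \<i> * sin z" "cis (-z) = cos z - \<i> * sin z"
    by (simp_all add: complex_eq_iff)
  show ?thesis
    by (simp add: tr4_def canon_index canon_entry_def c cos_add cos_diff algebra_simps)
qed

section \<open>Determinants of tensor products and canonical gates\<close>

lemma det_mat2:
  assumes "A \<in> carrier_mat 2 2"
  shows "det A = A $$ (0,0) * A $$ (1,1) - A $$ (0,1) * A $$ (1,0)"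
  using assms
  by (subst laplace_expansion_column[of A 2 0])
    (simp_all add: cofactor_def mat_delete_def det_single numeral_eq_Suc algebra_simps)

lemma det_mat3:
  assumes "A \<in> carrier_mat 3 3"
  shows "det A = A $$ (0,0) * (A $$ (1,1) * A $$ (2,2) - A $$ (1,2) * A $$ (2,1))
    - A $$ (1,0) * (A $$ (0,1) * A $$ (2,2) - A $$ (0,2) * A $$ (2,1))
    + A $$ (2,0) * (A $$ (0,1) * A $$ (1,2) - A $$ (0,2) * A $$ (1,1))"
  using assms
  by (subst laplace_expansion_column[of A 3 0])
    (auto simp add: cofactor_def mat_delete_def det_mat2 numeral_eq_Suc algebra_simps)

text \<open>Laplace expansion along the first two columns into complementary 2x2 minors.
  \<open>resultant_identity\<close> is stated in the same grouping.\<close>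

lemma det_mat4:
  assumes "A \<in> carrier_mat 4 4"
  shows "det A =
     (A $$ (0,0) * A $$ (1,1) - A $$ (0,1) * A $$ (1,0)) * (A $$ (2,2) * A $$ (3,3) - A $$ (2,3) * A $$ (3,2))
   - (A $$ (0,0) * A $$ (2,1) - A $$ (0,1) * A $$ (2,0)) * (A $$ (1,2) * A $$ (3,3) - A $$ (1,3) * A $$ (3,2))
   + (A $$ (0,0) * A $$ (3,1) - A $$ (0,1) * A $$ (3,0)) * (A $$ (1,2) * A $$ (2,3) - A $$ (1,3) * A $$ (2,2))
   + (A $$ (1,0) * A $$ (2,1) - A $$ (1,1) * A $$ (2,0)) * (A $$ (0,2) * A $$ (3,3) - A $$ (0,3) * A $$ (3,2))
   - (A $$ (1,0) * A $$ (3,1) - A $$ (1,1) * A $$ (3,0)) * (A $$ (0,2) * A $$ (2,3) - A $$ (0,3) * A $$ (2,2))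
   + (A $$ (2,0) * A $$ (3,1) - A $$ (2,1) * A $$ (3,0)) * (A $$ (0,2) * A $$ (1,3) - A $$ (0,3) * A $$ (1,2))"
  using assms
  by (subst laplace_expansion_column[of A 4 0])
    (auto simp add: cofactor_def mat_delete_def det_mat3 numeral_eq_Suc algebra_simps)

lemma det_kron2:
  assumes "A \<in> carrier_mat 2 2" "B \<in> carrier_mat 2 2"
  shows "det (kron2 A B) = (det2 A * det2 B)^2"
  by (subst det_mat4[OF kron2_carrier])
    (simp add: kron2_index det2_def power2_eq_square algebra_simps)

lemma det_canon: "det (canon_gate x y z) = 1"
proof -
  have a: "(complex_of_real (cos t))\<^sup>2 + (complex_of_real (sin t))\<^sup>2 = 1" for t
    by (simp flip: of_real_power of_real_add)
  have c: "cis z * cis (-z) = 1" by (simp add: cis_mult)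
  have "det (canon_gate x y z) = (cis z * cis (-z))\<^sup>2
     * ((complex_of_real (cos (x-y)))\<^sup>2 + (complex_of_real (sin (x-y)))\<^sup>2)
     * ((complex_of_real (cos (x+y)))\<^sup>2 + (complex_of_real (sin (x+y)))\<^sup>2)"
    by (subst det_mat4[OF canon_carrier])
      (simp add: canon_index canon_entry_def power2_eq_square algebra_simps del: cis_mult)
  then show ?thesis unfolding a c by simp
qed

lemma det2_mult: "A \<in> carrier_mat 2 2 \<Longrightarrow> B \<in> carrier_mat 2 2 \<Longrightarrow> det2 (A * B) = det2 A * det2 B"
  by (simp add: det2_def mult_index2 algebra_simps del: index_mult_mat(1))

lemma det2_unitary:
  assumes "is_unitary 2 A" shows "cmod (det2 A) = 1"
proof -
  have c: "A \<in> carrier_mat 2 2" using assms by (rule unitary_carrier)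
  have "det2 A * cnj (det2 A) = det2 (A * adjm A)"
    using c by (simp add: det2_mult) (simp add: det2_def mult.commute)
  also have "\<dots> = 1" using unitary_right[OF assms] by (simp add: det2_def)
  finally have "(cmod (det2 A))\<^sup>2 = 1"
    using complex_norm_square[of "det2 A"] by (metis of_real_eq_1_iff of_real_power)
  then show ?thesis using norm_ge_zero[of "det2 A"] by (auto simp: power2_eq_1_iff)
qed

text \<open>The spectrum of \<open>spin_flip U * U\<close> together with \<open>det U\<close> is a complete invariant of local
  equivalence; the first two power sums suffice here.\<close>
lemma local_invariants:
  assumes u: "is_unitary 2 u" "is_unitary 2 u'" "is_unitary 2 w" "is_unitary 2 w'"
    and U: "U = kron2 u u' * canon_gate x y z * kron2 w w'"
  obtains d where "cmod d = 1" "det U = d\<^sup>2"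
    "tr4 (spin_flip U * U) = d * tr4 (canon_gate (2*x) (2*y) (2*z))"
    "tr4 ((spin_flip U * U) * (spin_flip U * U)) = d\<^sup>2 * tr4 (canon_gate (4*x) (4*y) (4*z))"
proof -
  note c = u[THEN unitary_carrier]
  define K where "K = kron2 u u'" define L where "L = kron2 w w'"
  define A where "A = canon_gate x y z"
  define a where "a = det2 u * det2 u'" define b where "b = det2 w * det2 w'"
  have K: "K \<in> carrier_mat 4 4" "L \<in> carrier_mat 4 4" "A \<in> carrier_mat 4 4"
    by (simp_all add: K_def L_def A_def)
  have sK: "spin_flip K * K = a \<cdot>\<^sub>m 1\<^sub>m 4" "L * spin_flip L = b \<cdot>\<^sub>m 1\<^sub>m 4"
    using c by (simp_all add: K_def L_def a_def b_def spin_flip_kron2_mult)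
  have UK: "U = K * (A * L)"
    using K by (simp add: U K_def L_def A_def assoc_mat4)
  have sU: "spin_flip U = (spin_flip L * A) * spin_flip K"
    using K by (simp add: UK spin_flip_mult A_def spin_flip_canon)
  have X: "spin_flip U * U = a \<cdot>\<^sub>m (spin_flip L * A * (A * L))"
    unfolding UK using K sU[unfolded UK] mat_cancel_mid[of "spin_flip L * A" 4 "spin_flip K" K "A * L" a]
        sK(1) by simp
  have AA: "spin_flip L * A * (A * L) = spin_flip L * (canon_gate (2*x) (2*y) (2*z) * L)"
  proof -
    have "spin_flip L * A * (A * L) = spin_flip L * ((A * A) * L)"
      using K by (simp add: assoc_mat4)
    then show ?thesis by (simp add: A_def canon_mult)
  qed
  have t: "tr4 (spin_flip L * (C * L)) = b * tr4 C" if C: "C \<in> carrier_mat 4 4" for C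
  proof -
    have "tr4 (spin_flip L * (C * L)) = tr4 (C * L * spin_flip L)" using K C by (simp add: tr4_comm)
    also have "C * L * spin_flip L = b \<cdot>\<^sub>m C"
      using K C sK(2) by (simp add: assoc_mat4 smult_mat4)
    finally show ?thesis using C by (simp add: tr4_smult)
  qed
  have 1: "tr4 (spin_flip U * U) = a * b * tr4 (canon_gate (2*x) (2*y) (2*z))"
    unfolding X AA using K by (simp add: tr4_smult t)
  have Y: "(spin_flip L * (C * L)) * (spin_flip L * (C * L)) = b \<cdot>\<^sub>m (spin_flip L * ((C * C) * L))"
    if C: "C \<in> carrier_mat 4 4" for C
  proof -
    have "(spin_flip L * (C * L)) * (spin_flip L * (C * L)) = ((spin_flip L * C) * L) * (spin_flip L * (C * L))"
      using K C by (simp add: assoc_mat4)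
    also have "\<dots> = b \<cdot>\<^sub>m (spin_flip L * C * (C * L))"
      by (rule mat_cancel_mid) (use K C sK(2) in simp_all)
    also have "spin_flip L * C * (C * L) = spin_flip L * ((C * C) * L)"
      using K C by (simp add: assoc_mat4)
    finally show ?thesis .
  qed
  have "(spin_flip U * U) * (spin_flip U * U) = (a * a * b) \<cdot>\<^sub>m (spin_flip L * (canon_gate (4*x) (4*y) (4*z) * L))"
    unfolding X AA using K Y[of "canon_gate (2*x) (2*y) (2*z)"]
    by (simp add: smult_mat4 smult_smult_mat
      canon_mult mult.assoc)
  then have 2: "tr4 ((spin_flip U * U) * (spin_flip U * U)) = (a * b)\<^sup>2 * tr4 (canon_gate (4*x) (4*y) (4*z))"
    using K by (simp add: tr4_smult t power2_eq_square)
  have "det U = det K * (det A * det L)" unfolding UK using K by (simp add: det_mult[of _ 4])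
  then have 3: "det U = (a * b)\<^sup>2"
    using c by (simp add: K_def L_def A_def det_canon det_kron2 a_def b_def power_mult_distrib)
  have "cmod (a * b) = 1" using u by (simp add: a_def b_def norm_mult det2_unitary)
  then show ?thesis using that[of "a * b"] 1 2 3 by blast
qed

section \<open>Diagonalisation in the magic basis\<close>

lemma unitary_rows:
  assumes "is_unitary n A" "i < n" "k < n"
  shows "(\<Sum>j = 0..<n. A $$ (i,j) * cnj (A $$ (k,j))) = (if i = k then 1 else 0)"
proof -
  have c: "A \<in> carrier_mat n n" using assms unitary_carrier by blast
  have "(A * adjm A) $$ (i,k) = (\<Sum>j = 0..<n. A $$ (i,j) * cnj (A $$ (k,j)))"
    using carrier_matD[OF c] assms by (simp add: scalar_prod_def)
  then show ?thesis using unitary_right[OF assms(1)] assms by simp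
qed

lemma unitary_cols:
  assumes "is_unitary n A" "i < n" "k < n"
  shows "(\<Sum>j = 0..<n. cnj (A $$ (j,i)) * A $$ (j,k)) = (if i = k then 1 else 0)"
proof -
  have c: "A \<in> carrier_mat n n" using assms unitary_carrier by blast
  have "(adjm A * A) $$ (i,k) = (\<Sum>j = 0..<n. cnj (A $$ (j,i)) * A $$ (j,k))"
    using carrier_matD[OF c] assms by (simp add: scalar_prod_def)
  then show ?thesis using unitary_left[OF assms(1)] assms by simp
qed

lemma unitary_isometry:
  assumes "is_unitary n A"
  shows "(\<Sum>i = 0..<n. (cmod (\<Sum>j = 0..<n. A $$ (i,j) * v j))\<^sup>2) = (\<Sum>j = 0..<n. (cmod (v j))\<^sup>2)"
proof -
  have "complex_of_real (\<Sum>i = 0..<n. (cmod (\<Sum>j = 0..<n. A $$ (i,j) * v j))\<^sup>2)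
      = (\<Sum>i = 0..<n. (\<Sum>j = 0..<n. A $$ (i,j) * v j) * (\<Sum>k = 0..<n. cnj (A $$ (i,k)) * cnj (v k)))"
    by (simp only: of_real_sum complex_norm_square cnj_sum complex_cnj_mult)
  also have "\<dots> = (\<Sum>i = 0..<n. \<Sum>j = 0..<n. \<Sum>k = 0..<n. v j * cnj (v k) * (cnj (A $$ (i,k)) * A $$ (i,j)))"
    unfolding sum_product by (intro sum.cong refl) simp
  also have "\<dots> = (\<Sum>j = 0..<n. \<Sum>i = 0..<n. \<Sum>k = 0..<n. v j * cnj (v k) * (cnj (A $$ (i,k)) * A $$ (i,j)))"
    by (rule sum.swap)
  also have "\<dots> = (\<Sum>j = 0..<n. \<Sum>k = 0..<n. \<Sum>i = 0..<n. v j * cnj (v k) * (cnj (A $$ (i,k)) * A $$ (i,j)))"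
    by (intro sum.cong refl sum.swap)
  also have "\<dots> = (\<Sum>j = 0..<n. \<Sum>k = 0..<n. v j * cnj (v k) * (if k = j then 1 else 0))"
    by (intro sum.cong refl) (simp add: unitary_cols[OF assms] flip: sum_distrib_left)
  also have "\<dots> = (\<Sum>j = 0..<n. v j * cnj (v j))"
    by (intro sum.cong refl) (simp add: if_distrib sum.delta cong: if_cong)
  also have "\<dots> = complex_of_real (\<Sum>j = 0..<n. (cmod (v j))\<^sup>2)"
    by (simp only: of_real_sum complex_norm_square)
  finally show ?thesis by (simp only: of_real_eq_iff)
qed

text \<open>The symmetric unitary matrix \<open>A\<^sup>T A\<close> has inverse equal to its conjugate, so the real and imaginary
  parts of an eigenvector are eigenvectors as well.\<close>
lemma unitary_real_direction:
  assumes A: "is_unitary n A" and n: "n > 0"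
  obtains v w :: "nat \<Rightarrow> real" and l :: complex
  where "(\<Sum>j = 0..<n. (v j)\<^sup>2) = 1" "(\<Sum>j = 0..<n. (w j)\<^sup>2) = 1"
    "\<And>i. i < n \<Longrightarrow> (\<Sum>j = 0..<n. A $$ (i,j) * of_real (v j)) = l * of_real (w i)"
proof -
  have cA: "A \<in> carrier_mat n n" using A by (rule unitary_carrier)
  define m where "m = transpose_mat A * A"
  have cm: "m \<in> carrier_mat n n" using cA by (simp add: m_def)
  obtain \<mu> where "eigenvalue m \<mu>" using spectrum_non_empty[OF cm n] by (auto simp: spectrum_def)
  then obtain x where x: "x \<in> carrier_vec n" "x \<noteq> 0\<^sub>v n" "m *\<^sub>v x = \<mu> \<cdot>\<^sub>v x"
    using cm by (auto simp: eigenvalue_def eigenvector_def)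
  have mx: "(\<Sum>i = 0..<n. A $$ (i,k) * (\<Sum>j = 0..<n. A $$ (i,j) * x $ j)) = \<mu> * x $ k" if "k < n" for k
  proof -
    have "m *\<^sub>v x = transpose_mat A *\<^sub>v (A *\<^sub>v x)"
      unfolding m_def using cA x by (intro assoc_mult_mat_vec) auto
    moreover have "(\<mu> \<cdot>\<^sub>v x) $ k = \<mu> * x $ k" using carrier_vecD[OF x(1)] that by simp
    ultimately have "(transpose_mat A *\<^sub>v (A *\<^sub>v x)) $ k = \<mu> * x $ k" using x(3) by metis
    then show ?thesis using carrier_matD[OF cA] carrier_vecD[OF x(1)] that by (simp add: scalar_prod_def)
  qed
  \<comment> \<open>Multiplying the eigenvalue equation by the entrywise conjugate of
    \<open>A\<close> cancels the transpose and leaves \<open>A x = \<mu> conj(A) x\<close>. In this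
    form the conjugate of \<open>x\<close> can be treated on the same footing.\<close>
  have E1: "(\<Sum>j = 0..<n. A $$ (l,j) * x $ j) = \<mu> * (\<Sum>k = 0..<n. cnj (A $$ (l,k)) * x $ k)" if l: "l < n" for l
  proof -
    have "\<mu> * (\<Sum>k = 0..<n. cnj (A $$ (l,k)) * x $ k) = (\<Sum>k = 0..<n. cnj (A $$ (l,k)) * (\<mu> * x $ k))"
      by (simp add: sum_distrib_left mult.left_commute)
    also have "\<dots> = (\<Sum>k = 0..<n. cnj (A $$ (l,k)) * (\<Sum>i = 0..<n. A $$ (i,k) * (\<Sum>j = 0..<n. A $$ (i,j) * x $ j)))"
      by (intro sum.cong refl) (simp add: mx)
    also have "\<dots> = (\<Sum>k = 0..<n. \<Sum>i = 0..<n. (A $$ (i,k) * cnj (A $$ (l,k))) * (\<Sum>j = 0..<n. A $$ (i,j) * x $ j))"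
      unfolding sum_distrib_left[of "cnj _"] by (intro sum.cong refl) (simp add: mult_ac)
    also have "\<dots> = (\<Sum>i = 0..<n. \<Sum>k = 0..<n. (A $$ (i,k) * cnj (A $$ (l,k))) * (\<Sum>j = 0..<n. A $$ (i,j) * x $ j))"
      by (rule sum.swap)
    also have "\<dots> = (\<Sum>i = 0..<n. (if i = l then 1 else 0) * (\<Sum>j = 0..<n. A $$ (i,j) * x $ j))"
      by (intro sum.cong refl) (simp add: unitary_rows[OF A _ l] flip: sum_distrib_right)
    also have "\<dots> = (\<Sum>j = 0..<n. A $$ (l,j) * x $ j)"
      using l by (simp add: if_distrib[of "\<lambda>c. c * _"] sum.delta cong: if_cong)
    finally show ?thesis by simp
  qed
  obtain k0 where k0: "k0 < n" "x $ k0 \<noteq> 0" using x(1,2) by (metis eq_vecI carrier_vecD index_zero_vec)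
  have pos: "0 < (\<Sum>j = 0..<n. (cmod (x $ j))\<^sup>2)"
    using k0 by (intro sum_pos2[of _ k0]) auto
  have "(\<Sum>j = 0..<n. (cmod (x $ j))\<^sup>2) = (\<Sum>i = 0..<n. (cmod (\<Sum>j = 0..<n. A $$ (i,j) * x $ j))\<^sup>2)"
    by (simp add: unitary_isometry[OF A])
  also have "\<dots> = (cmod \<mu>)\<^sup>2 * (\<Sum>i = 0..<n. (cmod (\<Sum>j = 0..<n. A $$ (i,j) * cnj (x $ j)))\<^sup>2)"
  proof -
    have "cmod (\<Sum>k = 0..<n. cnj (A $$ (i,k)) * x $ k) = cmod (\<Sum>j = 0..<n. A $$ (i,j) * cnj (x $ j))" for i
    proof -
      have "(\<Sum>k = 0..<n. cnj (A $$ (i,k)) * x $ k) = cnj (\<Sum>j = 0..<n. A $$ (i,j) * cnj (x $ j))" by simp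
      then show ?thesis by (simp only: complex_mod_cnj)
    qed
    then show ?thesis unfolding sum_distrib_left[of "(cmod \<mu>)\<^sup>2"]
      by (intro sum.cong refl) (simp add: E1 norm_mult power_mult_distrib)
  qed
  also have "\<dots> = (cmod \<mu>)\<^sup>2 * (\<Sum>j = 0..<n. (cmod (x $ j))\<^sup>2)"
    by (simp add: unitary_isometry[OF A])
  finally have mu1: "(cmod \<mu>)\<^sup>2 = 1" using pos by simp
  then have mucn: "\<mu> * cnj \<mu> = 1" using complex_norm_square[of \<mu>] by simp
  \<comment> \<open>Conjugating \<open>E1\<close>, with \<open>\<mu>\<close> of modulus one, shows
    that the conjugate of \<open>x\<close> solves the same equation. Its real and imaginary parts
    then do so too, and one of them is nonzero at \<open>k0\<close>.\<close>
  have E2: "(\<Sum>j = 0..<n. A $$ (l,j) * cnj (x $ j)) = \<mu> * (\<Sum>k = 0..<n. cnj (A $$ (l,k)) * cnj (x $ k))" if l: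
      "l < n" for l
  proof -
    have "(\<Sum>k = 0..<n. cnj (A $$ (l,k)) * cnj (x $ k)) = cnj \<mu> * (\<Sum>j = 0..<n. A $$ (l,j) * cnj (x $ j))"
      using arg_cong[OF E1[OF l], of cnj] by simp
    then show ?thesis using mucn by (simp add: mult.assoc[symmetric])
  qed
  have "\<exists>r :: nat \<Rightarrow> real. (\<exists>k<n. r k \<noteq> 0) \<and>
     (\<forall>l<n. (\<Sum>j = 0..<n. A $$ (l,j) * of_real (r j)) = \<mu> * (\<Sum>k = 0..<n. cnj (A $$ (l,k)) * of_real (r k)))"
  proof (cases "Re (x $ k0) = 0")
    case False
    have re: "of_real (Re z) = (z + cnj z) / 2" for z by (simp add: complex_eq_iff)
    show ?thesis
      by (rule exI[of _ "\<lambda>j. Re (x $ j)"])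
        (use False k0 E1 E2 in \<open>auto simp: re sum_divide_distrib[symmetric] sum.distrib distrib_left
            add_divide_distrib[symmetric]\<close>)
  next
    case True
    have im: "of_real (Im z) = (z - cnj z) * (-\<i> / 2)" for z by (simp add: complex_eq_iff)
    have "Im (x $ k0) \<noteq> 0" using True k0 by (simp add: complex_eq_iff)
    moreover have "(\<Sum>j = 0..<n. A $$ (l,j) * of_real (Im (x $ j))) = \<mu> * (\<Sum>k = 0..<n. cnj (A $$ (l,k)) *
        of_real (Im (x $ k)))"
      if l: "l < n" for l
    proof -
      have d: "(\<Sum>j = 0..<n. f j * of_real (Im (x $ j))) = ((\<Sum>j = 0..<n. f j * x $ j) - (\<Sum>j = 0..<n. f j *
          cnj (x $ j))) * (-\<i>/2)"
        for f
        unfolding im sum_subtractf[symmetric] sum_distrib_right by (intro sum.cong refl) (simp add: algebra_simps)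
      show ?thesis unfolding d using E1[OF l] E2[OF l] by (simp add: algebra_simps)
    qed
    ultimately show ?thesis using k0(1) by (intro exI[of _ "\<lambda>j. Im (x $ j)"]) auto
  qed
  then obtain r :: "nat \<Rightarrow> real" and k1 where k1: "k1 < n" "r k1 \<noteq> 0"
    and r: "\<And>l. l < n \<Longrightarrow> (\<Sum>j = 0..<n. A $$ (l,j) * of_real (r j)) = \<mu> * (\<Sum>k = 0..<n. cnj (A $$ (l,k)) *
        of_real (r k))"
    by blast
  define N where "N = sqrt (\<Sum>j = 0..<n. (r j)\<^sup>2)"
  have "0 < (\<Sum>j = 0..<n. (r j)\<^sup>2)" using k1 by (intro sum_pos2[of _ k1]) auto
  then have N: "N > 0" "N\<^sup>2 = (\<Sum>j = 0..<n. (r j)\<^sup>2)" by (simp_all add: N_def)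
  define v where "v j = r j / N" for j
  have v1: "(\<Sum>j = 0..<n. (v j)\<^sup>2) = 1"
    using N(1) by (simp add: v_def power_divide N(2)[symmetric] flip: sum_divide_distrib)
  \<comment> \<open>For real \<open>v\<close> the equation reads
    \<open>A v = \<mu> conj(A v)\<close>. With a square root \<open>l\<close> of
    \<open>\<mu>\<close> this says exactly that \<open>cnj l * (A v)\<close> is real.\<close>
  define l where "l = csqrt \<mu>"
  have l2: "l * l = \<mu>" by (simp add: l_def power2_eq_square[symmetric])
  have "(cmod l)\<^sup>2 = cmod \<mu>" using l2 by (metis norm_mult power2_eq_square)
  moreover have "cmod \<mu> = 1" using mu1 norm_ge_zero[of \<mu>] by (auto simp: power2_eq_1_iff)
  ultimately have "(cmod l)\<^sup>2 = 1" by simp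
  then have lc: "l * cnj l = 1" using complex_norm_square[of l] by simp
  have rv: "(\<Sum>j = 0..<n. A $$ (i,j) * of_real (v j)) = \<mu> * (\<Sum>k = 0..<n. cnj (A $$ (i,k)) * of_real (v k))"
      if "i < n" for i
  proof -
    have "(\<Sum>j = 0..<n. f j * of_real (v j)) = (\<Sum>j = 0..<n. f j * of_real (r j)) / of_real N" for f :: "nat \<Rightarrow>
        complex"
      by (simp add: v_def sum_divide_distrib)
    then show ?thesis using r[OF that] by simp
  qed
  define w where "w i = Re (cnj l * (\<Sum>j = 0..<n. A $$ (i,j) * of_real (v j)))" for i
  have w: "of_real (w i) = cnj l * (\<Sum>j = 0..<n. A $$ (i,j) * of_real (v j))" if i: "i < n" for i
  proof -
    define s where "s = (\<Sum>j = 0..<n. A $$ (i,j) * of_real (v j))"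
    have cs: "(\<Sum>k = 0..<n. cnj (A $$ (i,k)) * of_real (v k)) = cnj s" by (simp add: s_def)
    have eq: "s = l * l * cnj s" using rv[OF i] unfolding cs s_def[symmetric] l2 .
    have "cnj l * s = cnj l * (l * l * cnj s)" by (rule arg_cong[OF eq])
    also have "\<dots> = (l * cnj l) * (l * cnj s)" by (simp add: mult_ac)
    also have "\<dots> = l * cnj s" by (simp add: lc)
    finally have "cnj (cnj l * s) = cnj l * s" by simp
    then have "cnj l * s \<in> \<real>" by (simp add: Reals_cnj_iff)
    then show ?thesis unfolding w_def s_def[symmetric] by (rule of_real_Re)
  qed
  have aw: "(\<Sum>j = 0..<n. A $$ (i,j) * of_real (v j)) = l * of_real (w i)" if "i < n" for i
    unfolding w[OF that] mult.assoc[symmetric] lc by simp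
  have "(\<Sum>j = 0..<n. (w j)\<^sup>2) = (\<Sum>i = 0..<n. (cmod (\<Sum>j = 0..<n. A $$ (i,j) * of_real (v j)))\<^sup>2)"
    by (intro sum.cong refl) (simp add: aw norm_mult power_mult_distrib \<open>(cmod l)\<^sup>2 = 1\<close>)
  also have "\<dots> = 1" unfolding unitary_isometry[OF A] using v1 by simp
  finally show ?thesis using that[of v w l] v1 aw by blast
qed

section \<open>Unitary matrices whose leading columns are diagonal\<close>

definition fixes_below :: "nat \<Rightarrow> complex mat \<Rightarrow> bool" where
  "fixes_below k W \<longleftrightarrow> (\<forall>i<k. \<forall>j<4. j \<noteq> i \<longrightarrow> W $$ (j,i) = 0)"

text \<open>The diagonal entry has modulus one because it carries the whole norm of its column; it
  then carries the whole norm of its row as well.\<close>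

lemma fixes_below_rows:
  assumes W: "is_unitary 4 W" "fixes_below k W" and "i < k" "i < 4" "j < 4" "j \<noteq> i"
  shows "W $$ (i,j) = 0" "cmod (W $$ (i,i)) = 1"
proof -
  have z: "W $$ (j',i) = 0" if "j' < 4" "j' \<noteq> i" for j' using W(2) assms that by (auto simp: fixes_below_def)
  have "(\<Sum>j = 0..<4. cnj (W $$ (j,i)) * W $$ (j,i)) = 1" using unitary_cols[OF W(1) \<open>i < 4\<close> \<open>i < 4\<close>] by simp
  also have "(\<Sum>j = 0..<4. cnj (W $$ (j,i)) * W $$ (j,i)) = (\<Sum>j = 0..<4. if j = i then cnj (W $$ (i,i)) * W
      $$ (i,i) else 0)"
    by (intro sum.cong refl) (simp add: z)
  also have "\<dots> = cnj (W $$ (i,i)) * W $$ (i,i)" using \<open>i < 4\<close> by (simp add: sum.delta)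
  finally have n: "W $$ (i,i) * cnj (W $$ (i,i)) = 1" by (simp add: mult.commute)
  then have n': "(cmod (W $$ (i,i)))\<^sup>2 = 1" using complex_norm_square[of "W $$ (i,i)"] by (metis
      of_real_eq_1_iff of_real_power)
  then show "cmod (W $$ (i,i)) = 1" using norm_ge_zero[of "W $$ (i,i)"] by (auto simp: power2_eq_1_iff)
  have "complex_of_real (\<Sum>j = 0..<4. (cmod (W $$ (i,j)))\<^sup>2) = 1"
    using unitary_rows[OF W(1) \<open>i < 4\<close> \<open>i < 4\<close>] by (simp only: of_real_sum complex_norm_square) simp
  then have s: "(\<Sum>j = 0..<4. (cmod (W $$ (i,j)))\<^sup>2) = 1" by (simp only: of_real_eq_1_iff)
  have "(\<Sum>j\<in>{0..<4}. (cmod (W $$ (i,j)))\<^sup>2) = (cmod (W $$ (i,i)))\<^sup>2 + (\<Sum>j\<in>{0..<4}-{i}. (cmod (W $$ (i,j)))\<^sup>2)"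
    using \<open>i < 4\<close> by (intro sum.remove) auto
  then have "(\<Sum>j\<in>{0..<4}-{i}. (cmod (W $$ (i,j)))\<^sup>2) = 0" using s n' by simp
  then have "\<forall>j\<in>{0..<4}-{i}. (cmod (W $$ (i,j)))\<^sup>2 = 0" by (subst (asm) sum_nonneg_eq_0_iff) auto
  then show "W $$ (i,j) = 0" using assms by auto
qed

text \<open>The block on the indices from \<open>k\<close> on is itself unitary, so a real direction
  is found there and padded with zeros. The zeros keep the new direction orthogonal to the axes
  already treated.\<close>

lemma unitary_real_direction_above:
  assumes W: "is_unitary 4 W" "fixes_below k W" and k: "k < 4"
  obtains v w :: "nat \<Rightarrow> real" and l :: complex
  where "(\<Sum>j = 0..<4. (v j)\<^sup>2) = 1" "(\<Sum>j = 0..<4. (w j)\<^sup>2) = 1"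
    "\<And>i. i < k \<Longrightarrow> v i = 0" "\<And>i. i < k \<Longrightarrow> w i = 0"
    "\<And>i. i < 4 \<Longrightarrow> (\<Sum>j = 0..<4. W $$ (i,j) * of_real (v j)) = l * of_real (w i)"
proof -
  have cW: "W \<in> carrier_mat 4 4" using W(1) by (rule unitary_carrier)
  define n where "n = 4 - k"
  define A where "A = mat n n (\<lambda>(i,j). W $$ (i + k, j + k))"
  have shift: "(\<Sum>j = 0..<4. f j) = (\<Sum>j = 0..<n. f (j + k))" if "\<And>j. j < k \<Longrightarrow> f j = 0" for f :: "nat \<Rightarrow> 'b ::
      comm_monoid_add"
  proof -
    have "(\<Sum>j = 0..<4. f j) = (\<Sum>j = k..<4. f j)"
      using that k by (intro sum.mono_neutral_right) auto
    also have "\<dots> = (\<Sum>j = 0+k..<n+k. f j)" using k by (simp add: n_def)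
    also have "\<dots> = (\<Sum>j = 0..<n. f (j + k))" by (rule sum.shift_bounds_nat_ivl)
    finally show ?thesis .
  qed
  have above: "W $$ (i + k, j) = 0" if "i < n" "j < k" for i j
    using W(2) that by (auto simp: fixes_below_def n_def)
  have rows: "W $$ (i, j) = 0" if "i < k" "j < 4" "j \<noteq> i" for i j
    using fixes_below_rows[OF W that(1) _ that(2,3)] that k by auto
  have "(A * adjm A) $$ (i, j) = 1\<^sub>m n $$ (i, j)" if ij: "i < n" "j < n" for i j
  proof -
    have "(A * adjm A) $$ (i, j) = (\<Sum>l = 0..<n. W $$ (i + k, l + k) * cnj (W $$ (j + k, l + k)))"
      using ij by (simp add: A_def scalar_prod_def)
    also have "\<dots> = (\<Sum>l = 0..<4. W $$ (i + k, l) * cnj (W $$ (j + k, l)))"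
      by (rule shift[symmetric]) (simp add: above ij)
    also have "\<dots> = (if i + k = j + k then 1 else 0)" by (rule unitary_rows[OF W(1)]) (use ij in \<open>auto simp: n_def\<close>)
    finally show ?thesis using ij by simp
  qed
  then have uA: "is_unitary n A" unfolding is_unitary_def
    by (auto simp: A_def intro!: eq_matI)
  obtain v w :: "nat \<Rightarrow> real" and l where vw: "(\<Sum>j = 0..<n. (v j)\<^sup>2) = 1" "(\<Sum>j = 0..<n. (w j)\<^sup>2) = 1"
    "\<And>i. i < n \<Longrightarrow> (\<Sum>j = 0..<n. A $$ (i,j) * of_real (v j)) = l * of_real (w i)"
    using unitary_real_direction[OF uA] k by (auto simp: n_def)
  define v' w' where "v' j = (if j < k then 0 else v (j - k))" and "w' j = (if j < k then 0 else w (j - k))" for j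
  have 1: "(\<Sum>j = 0..<4. (v' j)\<^sup>2) = 1" "(\<Sum>j = 0..<4. (w' j)\<^sup>2) = 1"
    using vw(1,2) by (subst shift; simp add: v'_def w'_def)+
  have 2: "(\<Sum>j = 0..<4. W $$ (i,j) * of_real (v' j)) = l * of_real (w' i)" if i: "i < 4" for i
  proof (cases "i < k")
    case True
    have "(\<Sum>j = 0..<4. W $$ (i,j) * of_real (v' j)) = 0"
      by (intro sum.neutral ballI) (use rows True in \<open>auto simp: v'_def\<close>)
    then show ?thesis using True by (simp add: w'_def)
  next
    case False
    have "(\<Sum>j = 0..<4. W $$ (i,j) * of_real (v' j)) = (\<Sum>j = 0..<n. W $$ (i,j + k) * of_real (v' (j + k)))"
      by (rule shift) (simp add: v'_def)
    also have "\<dots> = (\<Sum>j = 0..<n. A $$ (i - k,j) * of_real (v j))"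
      using False i by (intro sum.cong) (auto simp: A_def v'_def n_def)
    also have "\<dots> = l * of_real (w (i - k))" by (rule vw) (use i False in \<open>auto simp: n_def\<close>)
    finally show ?thesis using False by (simp add: w'_def)
  qed
  show ?thesis by (rule that[of v' w' l]) (use 1 2 in \<open>auto simp: v'_def w'_def\<close>)
qed

text \<open>Up to normalisation the columns are the Bell states \<open>I\<close>, \<open>\<i>X\<close>, \<open>\<i>Y\<close>, \<open>\<i>Z\<close> (read as 2x2 matrices), so
  that local special unitaries become left and right multiplications by unit quaternions.\<close>
definition bell :: "complex mat" where
  "bell = mat_of_rows_list 4 [[1,0,0,\<i>],[0,\<i>,1,0],[0,\<i>,-1,0],[1,0,0,-\<i>]]"

definition magic :: "complex mat" where
  "magic = complex_of_real (1 / sqrt 2) \<cdot>\<^sub>m bell"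

lemma bell_carrier [simp]: "bell \<in> carrier_mat 4 4" by (auto simp: bell_def mat_of_rows_list_def)

lemma magic_carrier [simp]: "magic \<in> carrier_mat 4 4" by (simp add: magic_def)

lemma bell_index:
  "bell $$ (0,0) = 1" "bell $$ (0,Suc 0) = 0" "bell $$ (0,2) = 0" "bell $$ (0,3) = \<i>"
  "bell $$ (Suc 0,0) = 0" "bell $$ (Suc 0,Suc 0) = \<i>" "bell $$ (Suc 0,2) = 1" "bell $$ (Suc 0,3) = 0"
  "bell $$ (2,0) = 0" "bell $$ (2,Suc 0) = \<i>" "bell $$ (2,2) = -1" "bell $$ (2,3) = 0"
  "bell $$ (3,0) = 1" "bell $$ (3,Suc 0) = 0" "bell $$ (3,2) = 0" "bell $$ (3,3) = -\<i>"
  by (simp_all add: bell_def mat_of_rows_list_def numeral_eq_Suc)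

lemma bell_dim [simp]: "dim_row bell = 4" "dim_col bell = 4"
  by (simp_all add: bell_def mat_of_rows_list_def)

text \<open>Removes the normalisation: entries are computed with \<open>bell\<close>, whose entries
  are Gaussian integers, at the price of a factor 1/2.\<close>

lemma magic_conj:
  assumes "K \<in> carrier_mat 4 4"
  shows "adjm magic * K * magic = (1/2) \<cdot>\<^sub>m (adjm bell * K * bell)"
proof -
  define s where "s = complex_of_real (1 / sqrt 2)"
  have "adjm magic * K * magic = (s * cnj s) \<cdot>\<^sub>m (adjm bell * K * bell)"
    using assms unfolding magic_def s_def[symmetric]
    by (simp add: adjm_smult smult_mat4
       smult_smult_mat)
  also have "s * cnj s = 1/2" by (simp add: s_def flip: of_real_mult)
  finally show ?thesis .
qed

lemma magic_unitary: "is_unitary 4 magic"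
proof -
  have "adjm magic * (1\<^sub>m 4) * magic = (1/2) \<cdot>\<^sub>m (adjm bell * (1\<^sub>m 4) * bell)"
    by (rule magic_conj) simp
  also have "adjm bell * (1\<^sub>m 4) * bell = adjm bell * bell" by (simp add: right_one_mat4)
  also have "(1/2) \<cdot>\<^sub>m (adjm bell * bell) = 1\<^sub>m 4"
    by (rule eq_mat4_casesI) (simp_all add: mult_index4 bell_index adjm_index del: index_mult_mat(1))
  finally have "adjm magic * magic = 1\<^sub>m 4" by (simp add: right_one_mat4)
  then show ?thesis unfolding is_unitary_def by (simp add: mat_mult_left_right_inverse[of _ 4])
qed

text \<open>The matrix \<open>a + \<i> (b X + c Y + d Z)\<close>, whose coordinates follow the order
  of the columns of \<open>bell\<close>.\<close>

definition quat :: "real \<Rightarrow> real \<Rightarrow> real \<Rightarrow> real \<Rightarrow> complex mat" where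
  "quat a b c d = mat_of_rows_list 2 [[Complex a d, Complex c b], [Complex (-c) b, Complex a (-d)]]"

lemma quat_carrier [simp]: "quat a b c d \<in> carrier_mat 2 2"
  by (auto simp: quat_def mat_of_rows_list_def)

lemma quat_index: "quat a b c d $$ (0,0) = Complex a d" "quat a b c d $$ (0,Suc 0) = Complex c b"
  "quat a b c d $$ (Suc 0,0) = Complex (-c) b" "quat a b c d $$ (Suc 0,Suc 0) = Complex a (-d)"
  "dim_row (quat a b c d) = 2" "dim_col (quat a b c d) = 2"
  by (simp_all add: quat_def mat_of_rows_list_def)

lemma quat_unitary: "a\<^sup>2 + b\<^sup>2 + c\<^sup>2 + d\<^sup>2 = 1 \<Longrightarrow> is_unitary 2 (quat a b c d)"
  unfolding is_unitary_def
  by (auto intro!: eq_mat2I simp: mult_index2 quat_index adjm_index complex_eq_iff power2_eq_square algebra_simps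
     simp del: index_mult_mat(1))

definition local_col :: "nat \<Rightarrow> (nat \<Rightarrow> real) \<Rightarrow> bool" where
  "local_col k v \<longleftrightarrow> (\<exists>u u'. is_unitary 2 u \<and> is_unitary 2 u' \<and>
     (\<forall>i<4. \<forall>j\<le>k. (adjm magic * kron2 u u' * magic) $$ (i,j) =
         (if j < k then if i = j then 1 else 0 else of_real (v i))))"

text \<open>Finds the rotation that carries the first imaginary axis to the unit vector
  \<open>(p, q, r)\<close>. Its axis is taken orthogonal to the start, so only \<open>a\<close>,
  \<open>c\<close>, \<open>d\<close> occur, and \<open>a\<close> is the cosine of half the angle,
  \<open>sqrt ((1 + p) / 2)\<close>. The antipodal vector has no preferred axis and receives a half
  turn.\<close>

lemma half_angle:
  assumes "p\<^sup>2 + q\<^sup>2 + r\<^sup>2 = (1::real)"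
  obtains a c d where "a\<^sup>2 + c\<^sup>2 + d\<^sup>2 = 1" "a*a - c*c - d*d = p" "2*a*d = -q" "2*a*c = r"
proof (cases "p = -1")
  case True
  then have "q\<^sup>2 + r\<^sup>2 = 0" using assms by simp
  then have "q = 0" "r = 0" by (auto simp: sum_power2_eq_zero_iff)
  then show ?thesis using that[of 0 1 0] True by simp
next
  case False
  have "p\<^sup>2 \<le> 1" using assms zero_le_power2[of q] zero_le_power2[of r] by linarith
  then have p: "1 + p > 0" using False by (auto simp: abs_square_le_1)
  define s where "s = 1 / sqrt (2 * (1 + p))"
  have s2: "s * s * (2 * (1 + p)) = 1" using p by (simp add: s_def field_simps)
  have qr: "q*q + r*r = (1 - p) * (1 + p)" using assms by (simp add: power2_eq_square algebra_simps)
  have 1: "(s*(1+p))\<^sup>2 + (s*r)\<^sup>2 + (-s*q)\<^sup>2 = 1"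
  proof -
    have "(s*(1+p))\<^sup>2 + (s*r)\<^sup>2 + (-s*q)\<^sup>2 = s*s*((1+p)*(1+p) + (q*q + r*r))"
      by (simp add: power2_eq_square algebra_simps)
    also have "\<dots> = s*s*(2*(1+p))" unfolding qr by (simp add: algebra_simps)
    finally show ?thesis using s2 by simp
  qed
  have 2: "(s*(1+p))*(s*(1+p)) - (s*r)*(s*r) - (-s*q)*(-s*q) = p"
  proof -
    have "(s*(1+p))*(s*(1+p)) - (s*r)*(s*r) - (-s*q)*(-s*q) = s*s*((1+p)*(1+p) - (q*q + r*r))"
      by (simp add: algebra_simps)
    also have "\<dots> = s*s*(2*(1+p)) * p" unfolding qr by (simp add: algebra_simps)
    finally show ?thesis using s2 by simp
  qed
  have 3: "2*(s*(1+p))*(-s*q) = -q" "2*(s*(1+p))*(s*r) = r"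
  proof -
    have "2*(s*(1+p))*(-s*q) = - (s*s*(2*(1+p)) * q)" "2*(s*(1+p))*(s*r) = s*s*(2*(1+p)) * r"
      by (simp_all add: algebra_simps)
    then show "2*(s*(1+p))*(-s*q) = -q" "2*(s*(1+p))*(s*r) = r" unfolding s2 by simp_all
  qed
  show ?thesis by (rule that[OF 1 2 3])
qed

definition bell_conj :: "complex mat \<Rightarrow> complex mat" where
  "bell_conj K = adjm bell * K * bell"

text \<open>The second factor is the entrywise conjugate of the first. On vectors read as 2x2
  matrices the gate therefore sends \<open>E\<close> to \<open>u E u^*\<close>: it fixes the unit
  and rotates the three imaginary directions. The factor 2 compensates the missing normalisation of
  \<open>bell\<close>.\<close>

lemma conj_quat_index:
  fixes a b c d :: real
  defines "K \<equiv> bell_conj (kron2 (quat a b c d) (quat a (-b) c (-d)))"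
  shows "K $$ (0,0) = 2 * of_real (a*a+b*b+c*c+d*d)" "K $$ (Suc 0,0) = 0" "K $$ (2,0) = 0" "K $$ (3,0) = 0"
    "K $$ (0,Suc 0) = 0" "K $$ (Suc 0,Suc 0) = 2 * of_real (a*a+b*b-c*c-d*d)"
    "K $$ (2,Suc 0) = 2 * of_real (2*b*c-2*a*d)" "K $$ (3,Suc 0) = 2 * of_real (2*b*d+2*a*c)"
    "K $$ (0,2) = 0" "K $$ (Suc 0,2) = 2 * of_real (2*b*c+2*a*d)"
    "K $$ (2,2) = 2 * of_real (a*a-b*b+c*c-d*d)" "K $$ (3,2) = 2 * of_real (2*c*d-2*a*b)"
  unfolding K_def bell_conj_def
  by (simp_all add: mult_index4 bell_index adjm_index kron2_index quat_index del: index_mult_mat(1))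
    (simp_all add: complex_eq_iff algebra_simps)

text \<open>This gate is left multiplication by a quaternion, and the image of the unit is that
  quaternion. Hence any real unit vector can serve as first column.\<close>

lemma left_quat_index:
  fixes a b c d :: real
  defines "K \<equiv> bell_conj (kron2 (quat a b c d) (1\<^sub>m 2))"
  shows "K $$ (0,0) = 2 * of_real a" "K $$ (Suc 0,0) = 2 * of_real b" "K $$ (2,0) = 2 * of_real c" "K $$
      (3,0) = 2 * of_real d"
  unfolding K_def bell_conj_def
  by (simp_all add: mult_index4 bell_index adjm_index kron2_index quat_index del: index_mult_mat(1))
    (simp_all add: complex_eq_iff)

lemma bell_conj_carrier [simp]: "K \<in> carrier_mat 4 4 \<Longrightarrow> bell_conj K \<in> carrier_mat 4 4" by (simp add: bell_conj_def)

lemma local_colI: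
  assumes "is_unitary 2 u" "is_unitary 2 u'"
    "\<forall>i<4. \<forall>j\<le>k. bell_conj (kron2 u u') $$ (i,j) = (if j < k then if i = j then 2 else 0 else 2 * of_real (v
        i))" "k < 4"
  shows "local_col k v"
proof -
  have h: "(adjm magic * kron2 u u' * magic) $$ (i,j) = bell_conj (kron2 u u') $$ (i,j) / 2" if "i < 4" "j <
      4" for i j
    using that bell_conj_carrier[OF kron2_carrier, of u u']
    by (simp add: magic_conj bell_conj_def del: index_mult_mat(1) bell_conj_carrier)
  have "(adjm magic * kron2 u u' * magic) $$ (i,j) = (if j < k then if i = j then 1 else 0 else of_real (v i))"
    if ij: "i < 4" "j \<le> k" for i j
  proof -
    have m: "bell_conj (kron2 u u') $$ (i,j) = (if j < k then if i = j then 2 else 0 else 2 * of_real (v i))"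
      using assms(3) ij by blast
    show ?thesis unfolding h[OF ij(1) le_less_trans[OF ij(2) assms(4)]] m by simp
  qed
  then show ?thesis unfolding local_col_def using assms(1,2) by blast
qed

text \<open>In the magic basis local gates include the rotations of real four-space, and the
  rotations fixing the first \<open>k\<close> axes still carry axis \<open>k\<close> to any unit
  vector orthogonal to them. The range stops at \<open>k < 3\<close>: with three axes fixed no
  rotation is left.\<close>

lemma local_col_exists:
  assumes v: "(\<Sum>j = 0..<4. (v j)\<^sup>2) = 1" and z: "\<And>i. i < k \<Longrightarrow> v i = (0::real)" and k: "k < 3"
  shows "local_col k v"
proof -
  have v4: "(v 0)\<^sup>2 + (v 1)\<^sup>2 + (v 2)\<^sup>2 + (v 3)\<^sup>2 = 1" using v by (simp add: sum_upto_4)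
  consider "k = 0" | "k = 1" | "k = 2" using k by linarith
  then show ?thesis
  proof cases
    case 1
    show ?thesis
      by (rule local_colI[of "quat (v 0) (v 1) (v 2) (v 3)" "1\<^sub>m 2"])
        (use 1 v4 in \<open>auto simp: quat_unitary less_4_cases left_quat_index\<close>)
  next
    case 2
    then have "(v 1)\<^sup>2 + (v 2)\<^sup>2 + (v 3)\<^sup>2 = 1" using v4 z[of 0] by simp
    then obtain a c d where acd: "a\<^sup>2 + c\<^sup>2 + d\<^sup>2 = 1" "a*a - c*c - d*d = v 1" "2*a*d = - v 2" "2*a*c = v 3"
      by (rule half_angle)
    have n: "a*a + c*c + d*d = 1" using acd(1) by (simp add: power2_eq_square)
    have le1: "j \<le> 1 \<longleftrightarrow> j = 0 \<or> j = Suc 0" for j :: nat by auto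
    show ?thesis
      by (rule local_colI[of "quat a 0 c d" "quat a 0 c (-d)"])
        (use 2 acd n z[of 0] conj_quat_index[of a 0 c d] in \<open>auto simp: quat_unitary less_4_cases
            le1[unfolded One_nat_def]\<close>)
  next
    \<comment> \<open>With two axes fixed the rotation has to be about the first imaginary axis.
      Applied with last coordinate 0, \<open>half_angle\<close> gives \<open>a c = 0\<close>. If
      \<open>a \<noteq> 0\<close>, the number \<open>d\<close> is reused as the component along the
      rotation axis; if \<open>a = 0\<close>, the target is the negative of the axis and a half turn
      does it.\<close>
    case 3
    then have "(v 2)\<^sup>2 + (v 3)\<^sup>2 + 0\<^sup>2 = 1" using v4 z[of 0] z[of 1] by simp
    then obtain a c d where acd: "a\<^sup>2 + c\<^sup>2 + d\<^sup>2 = 1" "a*a - c*c - d*d = v 2" "2*a*d = - v 3" "2*a*c = 0"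
      by (rule half_angle)
    show ?thesis
    proof (cases "a = 0")
      case False
      then have c: "c = 0" using acd by simp
      have n: "a*a + d*d = 1" using acd(1) c by (simp add: power2_eq_square)
      have le2: "j \<le> 2 \<longleftrightarrow> j = 0 \<or> j = Suc 0 \<or> j = 2" for j :: nat by auto
      show ?thesis
        by (rule local_colI[of "quat a d 0 0" "quat a (-d) 0 0"])
          (use 3 acd c n z[of 0] z[of 1] conj_quat_index[of a d 0 0] in \<open>auto simp: quat_unitary less_4_cases le2\<close>)
    next
      case True
      then have q: "v 2 = -1" "v 3 = 0" using acd by (simp_all add: power2_eq_square)
      have le2: "j \<le> 2 \<longleftrightarrow> j = 0 \<or> j = Suc 0 \<or> j = 2" for j :: nat by auto
      show ?thesis
        by (rule local_colI[of "quat 0 1 0 0" "quat 0 (-1) 0 0"])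
          (use 3 q z[of 0] z[of 1] conj_quat_index[of 0 1 0 0] in \<open>auto simp: quat_unitary less_4_cases le2\<close>)
    qed
  qed
qed


text \<open>The Bell states are the common eigenvectors of XX, YY, ZZ. As
  \<open>XX * YY * ZZ = -1\<close>, the four sign patterns are those with product -1, and the four
  phases sum to zero.\<close>

lemma canon_magic:
  "canon_gate x y z * magic = magic * mat 4 4 (\<lambda>(i,j). if i = j then
     (if i = 0 then cis (x - y + z) else if i = 1 then cis (x + y - z)
      else if i = 2 then cis (- x - y - z) else cis (- x + y + z)) else 0)" (is "_ = _ * ?D")
proof -
  have c: "cis (x - y + z) = cis z * (cos (x - y) + \<i> * sin (x - y))"
    "cis (x + y - z) = cis (-z) * (cos (x + y) + \<i> * sin (x + y))"
    "cis (- x - y - z) = cis (-z) * (cos (x + y) - \<i> * sin (x + y))"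
    "cis (- x + y + z) = cis z * (cos (x - y) - \<i> * sin (x - y))"
    "cis (y - x + z) = cis z * (cos (x - y) - \<i> * sin (x - y))"
  proof -
    have "cis t = cos t + \<i> * sin t" "cis (-t) = cos t - \<i> * sin t" for t :: real
      by (simp_all add: complex_eq_iff)
    then have e: "complex_of_real (cos t) + \<i> * complex_of_real (sin t) = cis t"
      "complex_of_real (cos t) - \<i> * complex_of_real (sin t) = cis (-t)" for t :: real by simp_all
    show "cis (x - y + z) = cis z * (cos (x - y) + \<i> * sin (x - y))"
      "cis (x + y - z) = cis (-z) * (cos (x + y) + \<i> * sin (x + y))"
      "cis (- x - y - z) = cis (-z) * (cos (x + y) - \<i> * sin (x + y))"
      "cis (- x + y + z) = cis z * (cos (x - y) - \<i> * sin (x - y))"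
      "cis (y - x + z) = cis z * (cos (x - y) - \<i> * sin (x - y))"
      unfolding e cis_mult by (simp_all add: algebra_simps)
  qed
  have "canon_gate x y z * bell = bell * ?D"
    by (rule eq_mat4_casesI)
      (simp_all add: mult_index4 canon_index bell_index del: index_mult_mat(1),
       simp_all only: c, simp_all add: canon_entry_def, simp_all add: algebra_simps)
  then show ?thesis
    by (simp add: magic_def smult_mat4)
qed

lemma diagonal_in_magic:
  assumes U: "is_unitary 4 U" and d: "fixes_below 3 (adjm magic * U * magic)"
  obtains p x y z where "cmod p = 1" "U = p \<cdot>\<^sub>m canon_gate x y z"
proof -
  define W where "W = adjm magic * U * magic"
  have cU: "U \<in> carrier_mat 4 4" using U by (rule unitary_carrier)
  have W: "is_unitary 4 W" unfolding W_def by (intro unitary_mult unitary_adjm magic_unitary U)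
  have f: "fixes_below 3 W" using d by (simp add: W_def)
  have off: "W $$ (i,j) = 0" if "i < 4" "j < 4" "i \<noteq> j" for i j
    using fixes_below_rows(1)[OF W f, of i j] f that by (cases "j < 3") (auto simp: fixes_below_def)
  have n3: "cmod (W $$ (3,3)) = 1"
  proof -
    have "fixes_below 4 W" using off by (auto simp: fixes_below_def)
    then show ?thesis using fixes_below_rows(2)[OF W, of 4 3 0] by simp
  qed
  have n: "cmod (W $$ (i,i)) = 1" if "i < 3" for i
    using fixes_below_rows(2)[OF W f that, of "if i = 0 then 1 else 0"] that by auto
  define t where "t i = Arg (W $$ (i,i))" for i
  have t: "W $$ (i,i) = cis (t i)" if "i < 4" for i
  proof -
    have "cmod (W $$ (i,i)) = 1" using n[of i] n3 that by (cases "i = 3") auto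
    then show ?thesis using rcis_cmod_Arg[of "W $$ (i,i)"] by (simp add: rcis_def t_def)
  qed
  \<comment> \<open>Inverts the map from coordinates to phases. The exponents in
    \<open>canon_magic\<close> sum to zero, so the global phase \<open>q\<close> is the mean of the
    four phases, and adding two exponents isolates twice one coordinate.\<close>
  define q where "q = (t 0 + t 1 + t 2 + t 3) / 4"
  define x y z where "x = (t 0 + t 1) / 2 - q" and "y = (t 1 + t 3) / 2 - q" and "z = (t 0 + t 3) / 2 - q"
  define D where "D = mat 4 4 (\<lambda>(i,j). if i = j then
     (if i = 0 then cis (x - y + z) else if i = 1 then cis (x + y - z)
      else if i = 2 then cis (- x - y - z) else cis (- x + y + z)) else 0)"
  have s: "q + (x - y + z) = t 0" "q + (x + y - z) = t (Suc 0)" "q + (- x - y - z) = t 2" "q + (y - x + z) = t 3"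
    by (simp_all add: x_def y_def z_def q_def field_simps)
  have cW: "W \<in> carrier_mat 4 4" using W by (rule unitary_carrier)
  have WD: "W = cis q \<cdot>\<^sub>m D"
    by (rule eq_mat4_casesI) (simp_all add: D_def cW off t cis_mult s)
  have "magic * W = (magic * adjm magic) * (U * magic)"
    using cU by (simp add: W_def assoc_mat4)
  then have "magic * W = U * magic" using cU unitary_right[OF magic_unitary] by simp
  then have "U * magic = cis q \<cdot>\<^sub>m (canon_gate x y z * magic)"
    unfolding WD canon_magic D_def[symmetric]
    by (simp add: D_def smult_mat4)
  then have "(U * magic) * adjm magic = (cis q \<cdot>\<^sub>m (canon_gate x y z * magic)) * adjm magic" by simp
  then have "U = cis q \<cdot>\<^sub>m canon_gate x y z"
    using cU unitary_right[OF magic_unitary]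
    by (simp add: smult_mat4 assoc_mat4 right_one_mat4)
  then show ?thesis by (intro that[of "cis q"]) auto
qed

section \<open>Diagonalising one more column by local gates\<close>

lemma mult_col_index:
  assumes "A \<in> carrier_mat 4 4" "B \<in> carrier_mat 4 4" "i < 4" "j < 4"
  shows "(A * B) $$ (i,j) = (\<Sum>k = 0..<4. A $$ (i,k) * B $$ (k,j))"
  using assms by (simp add: mult_index4 sum_upto_4 del: index_mult_mat(1))

text \<open>In the magic basis the gate carries a real direction \<open>v\<close> to a multiple of a
  real direction \<open>w\<close>, both orthogonal to the axes already treated. Local gates
  \<open>A\<close> and \<open>B\<close> carry axis \<open>k\<close> to \<open>v\<close> and to
  \<open>w\<close>, so \<open>adjm B * U * A\<close> maps axis \<open>k\<close> to a multiple of
  itself and leaves the earlier columns diagonal.\<close>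

lemma diagonalize_step:
  assumes U: "is_unitary 4 U" and d: "fixes_below k (adjm magic * U * magic)" and k: "k < 3"
  obtains u u' w w' V where "is_unitary 2 u" "is_unitary 2 u'" "is_unitary 2 w" "is_unitary 2 w'"
    "is_unitary 4 V" "U = kron2 u u' * V * kron2 w w'" "fixes_below (Suc k) (adjm magic * V * magic)"
proof -
  define W where "W = adjm magic * U * magic"
  have cU: "U \<in> carrier_mat 4 4" using U by (rule unitary_carrier)
  have W: "is_unitary 4 W" unfolding W_def by (intro unitary_mult unitary_adjm magic_unitary U)
  have cW: "W \<in> carrier_mat 4 4" using W by (rule unitary_carrier)
  have f: "fixes_below k W" using d by (simp add: W_def)
  obtain v w :: "nat \<Rightarrow> real" and l where vw: "(\<Sum>j = 0..<4. (v j)\<^sup>2) = 1" "(\<Sum>j = 0..<4. (w j)\<^sup>2) = 1"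
    "\<And>i. i < k \<Longrightarrow> v i = 0" "\<And>i. i < k \<Longrightarrow> w i = 0"
    "\<And>i. i < 4 \<Longrightarrow> (\<Sum>j = 0..<4. W $$ (i,j) * of_real (v j)) = l * of_real (w i)"
    using unitary_real_direction_above[OF W f] k by auto
  obtain a a' where a: "is_unitary 2 a" "is_unitary 2 a'"
    "\<forall>i<4. \<forall>j\<le>k. (adjm magic * kron2 a a' * magic) $$ (i,j) =
         (if j < k then if i = j then 1 else 0 else of_real (v i))"
    using local_col_exists[OF vw(1,3) k] unfolding local_col_def by blast
  obtain b b' where b: "is_unitary 2 b" "is_unitary 2 b'"
    "\<forall>i<4. \<forall>j\<le>k. (adjm magic * kron2 b b' * magic) $$ (i,j) =
         (if j < k then if i = j then 1 else 0 else of_real (w i))"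
    using local_col_exists[OF vw(2,4) k] unfolding local_col_def by blast
  define A B where "A = kron2 a a'" and "B = kron2 b b'"
  have uA: "is_unitary 4 A" "is_unitary 4 B" unfolding A_def B_def by (intro unitary_kron2 a b)+
  note cA = uA[THEN unitary_carrier]
  define V where "V = adjm B * U * A"
  define L R where "L = adjm magic * A * magic" and "R = adjm magic * B * magic"
  have uL: "is_unitary 4 L" "is_unitary 4 R" unfolding L_def R_def by (intro unitary_mult unitary_adjm
      magic_unitary uA)+
  note cL = uL[THEN unitary_carrier]
  have uV: "is_unitary 4 V" unfolding V_def by (intro unitary_mult unitary_adjm uA U)
  have UV: "U = kron2 b b' * V * kron2 (adjm a) (adjm a')"
  proof -
    have "B * V * adjm A = (B * adjm B) * (U * (A * adjm A))"
      using cA cU by (simp add: V_def assoc_mat4)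
    also have "\<dots> = U" using uA[THEN unitary_right] cU by simp
    finally show ?thesis using a(1,2)[THEN unitary_carrier] by (simp add: A_def B_def adjm_kron2)
  qed
  have WV: "adjm magic * V * magic = adjm R * (W * L)"
  proof -
    have "adjm R = adjm magic * adjm B * magic"
      using cA by (simp add: R_def adjm_mult[of _ 4 4 _ 4] assoc_mat4)
    then have "adjm R * (W * L) = (adjm magic * adjm B) * ((magic * adjm magic) * (U * ((magic * adjm magic)
        * (A * magic))))"
      using cA cU by (simp add: W_def L_def assoc_mat4)
    also have "\<dots> = adjm magic * V * magic"
      using cA cU unitary_right[OF magic_unitary] by (simp add: V_def assoc_mat4)
    finally show ?thesis by simp
  qed
  \<comment> \<open>Columns up to \<open>k\<close> of \<open>W * L\<close> are multiples of those of
    \<open>R\<close>, with the old diagonal entry as factor before \<open>k\<close> and with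
    \<open>l\<close> at \<open>k\<close>. Orthonormality of the columns of \<open>R\<close> finishes
    the argument.\<close>
  have col: "(W * L) $$ (i,j) = (if j < k then W $$ (j,j) else l) * R $$ (i,j)" if ij: "i < 4" "j \<le> k" for i j
  proof -
    have j4: "j < 4" using ij k by simp
    have e: "(W * L) $$ (i,j) = (\<Sum>m = 0..<4. W $$ (i,m) * L $$ (m,j))"
      by (rule mult_col_index) (use cW cL ij j4 in auto)
    show ?thesis
    proof (cases "j < k")
      case True
      have "(\<Sum>m = 0..<4. W $$ (i,m) * L $$ (m,j)) = (\<Sum>m = 0..<4. if m = j then W $$ (i,j) else 0)"
        using a(3) ij True by (intro sum.cong refl) (auto simp: L_def A_def)
      also have "\<dots> = W $$ (i,j)" using j4 by simp
      finally show ?thesis using e b(3) ij True f by (auto simp: R_def B_def fixes_below_def)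
    next
      case False
      then have "j = k" using ij by simp
      have "(\<Sum>m = 0..<4. W $$ (i,m) * L $$ (m,j)) = (\<Sum>m = 0..<4. W $$ (i,m) * of_real (v m))"
        using a(3) ij \<open>j = k\<close> by (intro sum.cong refl) (auto simp: L_def A_def)
      also have "\<dots> = l * of_real (w i)" using vw(5) ij by simp
      finally show ?thesis using e b(3) ij \<open>j = k\<close> by (auto simp: R_def B_def)
    qed
  qed
  have "fixes_below (Suc k) (adjm R * (W * L))"
    unfolding fixes_below_def
  proof (intro allI impI)
    fix i j :: nat assume ij: "i < Suc k" "j < 4" "j \<noteq> i"
    then have i4: "i < 4" using k by simp
    define c where "c = (if i < k then W $$ (i,i) else l)"
    have "(adjm R * (W * L)) $$ (j,i) = (\<Sum>m = 0..<4. adjm R $$ (j,m) * (W * L) $$ (m,i))"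
      by (rule mult_col_index) (use cW cL ij i4 in auto)
    also have "\<dots> = (\<Sum>m = 0..<4. c * (cnj (R $$ (m,j)) * R $$ (m,i)))"
      using col ij cL by (intro sum.cong refl) (auto simp: c_def simp del: index_mult_mat(1))
    also have "\<dots> = c * (if j = i then 1 else 0)"
      unfolding sum_distrib_left[symmetric] using unitary_cols[OF uL(2) ij(2) i4] by simp
    finally show "(adjm R * (W * L)) $$ (j,i) = 0" using ij by simp
  qed
  then show ?thesis
    by (intro that[OF b(1,2) unitary_adjm[OF a(1)] unitary_adjm[OF a(2)] uV UV]) (simp add: WV)
qed

section \<open>The Weyl chamber\<close>

text \<open>Equal elementary symmetric functions mean equal cubics. Evaluating at the largest root
  of either side identifies the largest roots; the sum and product of the others give a quadratic,
  treated in the same way.\<close>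

lemma sorted_roots_unique:
  fixes a b c :: real
  assumes "a \<le> b" "b \<le> c" "a' \<le> b'" "b' \<le> c'"
    and e: "a + b + c = a' + b' + c'" "a*b + b*c + a*c = a'*b' + b'*c' + a'*c'" "a*b*c = a'*b'*c'"
  shows "a = a'" "b = b'" "c = c'"
proof -
  have "(t - a) * (t - b) * (t - c) = t^3 - (a + b + c) * t^2 + (a*b + b*c + a*c) * t - a*b*c" for t a b c :: real
    by (simp add: power2_eq_square power3_eq_cube algebra_simps)
  then have p: "(t - a) * (t - b) * (t - c) = (t - a') * (t - b') * (t - c')" for t
    by (simp add: e)
  have "c \<le> c'" using p[of c] assms by auto
  moreover have "c' \<le> c" using p[of c'] assms by auto
  ultimately show c: "c = c'" by simp
  have s: "a + b = a' + b'" using e c by simp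
  have m: "a * b = a' * b'" using e(2) s c by (metis add.assoc add_right_cancel distrib_right add.commute
      mult.commute)
  have q: "(t - a) * (t - b) = (t - a') * (t - b')" for t
  proof -
    have "(t - a) * (t - b) = t^2 - (a + b) * t + a*b" for t a b :: real
      by (simp add: power2_eq_square algebra_simps)
    then show ?thesis by (simp add: s m)
  qed
  have "b \<le> b'" using q[of b] assms by auto
  moreover have "b' \<le> b" using q[of b'] assms by auto
  ultimately show b: "b = b'" by simp
  show "a = a'" using s b by simp
qed

text \<open>Since \<open>x\<close> may exceed \<open>pi/4\<close>, \<open>cos (2*x)\<close> may be
  negative; the inequality \<open>x + y \<le> pi/2\<close> still bounds its absolute value by
  \<open>cos (2*y)\<close>.\<close>

lemma chamber_cos_order:
  assumes "weyl_chamber (x, y, z)"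
  shows "(cos (2*x))\<^sup>2 \<le> (cos (2*y))\<^sup>2" "(cos (2*y))\<^sup>2 \<le> (cos (2*z))\<^sup>2" "0 \<le> cos (2*y)" "0 \<le> cos (2*z)"
proof -
  have b: "0 \<le> y" "y \<le> x" "x + y \<le> pi/2" "0 \<le> z" "z \<le> y" "x \<le> pi/2"
    using assms by (auto simp: weyl_chamber_def split: if_splits)
  show y: "0 \<le> cos (2*y)" and "0 \<le> cos (2*z)" using b by (auto intro!: cos_ge_zero)
  have "cos (2*x) \<le> cos (2*y)" using b by (intro cos_monotone_0_pi_le) auto
  moreover have "- cos (2*y) \<le> cos (2*x)"
  proof -
    have "cos (pi - 2*y) \<le> cos (2*x)" using b by (intro cos_monotone_0_pi_le) auto
    then show ?thesis by (simp add: cos_diff)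
  qed
  ultimately have "\<bar>cos (2*x)\<bar> \<le> \<bar>cos (2*y)\<bar>" by linarith
  then show "(cos (2*x))\<^sup>2 \<le> (cos (2*y))\<^sup>2" by (simp add: abs_le_square_iff)
  have "cos (2*y) \<le> cos (2*z)" using b by (intro cos_monotone_0_pi_le) auto
  then show "(cos (2*y))\<^sup>2 \<le> (cos (2*z))\<^sup>2" using y by (intro power_mono) auto
qed

text \<open>The unknowns are the squared cosines of the doubled coordinates. Their product comes
  from \<open>r\<close>; then \<open>s\<close> and \<open>R\<close> give two independent linear
  relations between the other two elementary symmetric functions, so the sorted triple is
  determined. Only the sign of \<open>cos (2*x)\<close> remains, and \<open>rs\<close> decides
  it.\<close>

lemma chamber_unique:
  assumes ch: "weyl_chamber (x, y, z)" and ch': "weyl_chamber (x', y', z')"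
    and r: "(cos (2*x) * cos (2*y) * cos (2*z))\<^sup>2 = (cos (2*x') * cos (2*y') * cos (2*z'))\<^sup>2"
    and s: "(sin (2*x) * sin (2*y) * sin (2*z))\<^sup>2 = (sin (2*x') * sin (2*y') * sin (2*z'))\<^sup>2"
    and rs: "(cos (2*x) * cos (2*y) * cos (2*z)) * (sin (2*x) * sin (2*y) * sin (2*z))
       = (cos (2*x') * cos (2*y') * cos (2*z')) * (sin (2*x') * sin (2*y') * sin (2*z'))"
    and R: "cos (4*x) * cos (4*y) * cos (4*z) = cos (4*x') * cos (4*y') * cos (4*z')"
  shows "(x, y, z) = (x', y', z')"
proof -
  have c4: "cos (4*t) = 2 * (cos (2*t))\<^sup>2 - 1" for t :: real
    using cos_double_cos[of "2*t"] by simp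
  have s2: "(sin (2*t))\<^sup>2 = 1 - (cos (2*t))\<^sup>2" for t :: real by (rule sin_squared_eq)
  define a b c where "a = (cos (2*x))\<^sup>2" and "b = (cos (2*y))\<^sup>2" and "c = (cos (2*z))\<^sup>2"
  define a' b' c' where "a' = (cos (2*x'))\<^sup>2" and "b' = (cos (2*y'))\<^sup>2" and "c' = (cos (2*z'))\<^sup>2"
  note o = chamber_cos_order[OF ch] chamber_cos_order[OF ch']
  have e3: "a*b*c = a'*b'*c'" using r by (simp add: a_def b_def c_def a'_def b'_def c'_def power_mult_distrib)
  have "(1-a)*(1-b)*(1-c) = (1-a')*(1-b')*(1-c')"
    using s by (simp add: a_def b_def c_def a'_def b'_def c'_def power_mult_distrib s2)
  then have e12: "(a + b + c) - (a*b+b*c+a*c) = (a' + b' + c') - (a'*b'+b'*c'+a'*c')"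
    using e3 by (simp add: algebra_simps)
  have "(2*a-1)*(2*b-1)*(2*c-1) = (2*a'-1)*(2*b'-1)*(2*c'-1)"
    using R by (simp add: a_def b_def c_def a'_def b'_def c'_def c4)
  then have e12': "2*(a + b + c) - 4*(a*b+b*c+a*c) = 2*(a' + b' + c') - 4*(a'*b'+b'*c'+a'*c')"
    using e3 by (simp add: algebra_simps)
  have lin: "p = p' \<and> q = q'" if "p - q = p' - q'" "2*p - 4*q = 2*p' - 4*q'" for p q p' q' :: real
    using that by linarith
  have "a + b + c = a' + b' + c'" "a*b+b*c+a*c = a'*b'+b'*c'+a'*c'"
    using lin[OF e12 e12'] by auto
  then have abc: "a = a'" "b = b'" "c = c'"
    using sorted_roots_unique[of a b c a' b' c'] o e3
    by (auto simp: a_def b_def c_def a'_def b'_def c'_def)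
  have B: "0 \<le> x" "0 \<le> y" "y \<le> x" "x + y \<le> pi/2" "0 \<le> z" "z \<le> y" "x < pi/2"
    using ch pi_gt_zero by (auto simp: weyl_chamber_def simp del: pi_gt_zero split: if_splits)
  have Bz: "z = 0 \<Longrightarrow> x \<le> pi/4" using ch by (simp add: weyl_chamber_def)
  have B': "0 \<le> x'" "0 \<le> y'" "y' \<le> x'" "x' + y' \<le> pi/2" "0 \<le> z'" "z' \<le> y'" "x' < pi/2"
    using ch' pi_gt_zero by (auto simp: weyl_chamber_def simp del: pi_gt_zero split: if_splits)
  have Bz': "z' = 0 \<Longrightarrow> x' \<le> pi/4" using ch' by (simp add: weyl_chamber_def)
  have y: "y = y'"
  proof -
    have "cos (2*y) = cos (2*y')" using abc(2) o by (simp add: b_def b'_def)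
    then have "2*y = 2*y'" by (rule cos_inj_pi[rotated 4]) (use B B' in linarith)+
    then show ?thesis by simp
  qed
  have z: "z = z'"
  proof -
    have "cos (2*z) = cos (2*z')" using abc(3) o by (simp add: c_def c'_def)
    then have "2*z = 2*z'" by (rule cos_inj_pi[rotated 4]) (use B B' in linarith)+
    then show ?thesis by simp
  qed
  have "cos (2*x) = cos (2*x') \<or> cos (2*x) = - cos (2*x')"
    using abc(1) by (simp add: a_def a'_def power2_eq_iff)
  then have x: "x = x'"
  proof
    assume "cos (2*x) = cos (2*x')"
    then have "2*x = 2*x'" by (rule cos_inj_pi[rotated 4]) (use B B' in linarith)+
    then show ?thesis by simp
  next
    \<comment> \<open>The competitor is the reflection \<open>x' = pi/2 - x\<close>, which reverses
      the sign of the product in \<open>rs\<close>; that product is therefore 0. Each vanishing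
      factor puts the point on a wall where the reflection is trivial or leaves the chamber. For
      \<open>z = 0\<close> this uses the stricter bound \<open>x \<le> pi/4\<close>.\<close>
    assume n: "cos (2*x) = - cos (2*x')"
    then have "cos (2*x) = cos (pi - 2*x')" by (simp add: cos_diff)
    then have "2*x = pi - 2*x'" by (rule cos_inj_pi[rotated 4]) (use B B' in linarith)+
    then have xx: "x' = pi/2 - x" by simp
    have sx: "sin (2*x') = sin (2*x)" by (simp add: xx sin_diff right_diff_distrib)
    define K where "K = (cos (2*y) * sin (2*y)) * (cos (2*z) * sin (2*z))"
    have "cos (2*x) * sin (2*x) * K = - (cos (2*x) * sin (2*x) * K)"
      using rs unfolding K_def n y[symmetric] z[symmetric] sx by (simp add: algebra_simps)
    then have "cos (2*x) * sin (2*x) * K = 0" by linarith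
    then consider "cos (2*x) = 0" | "sin (2*x) = 0" | "cos (2*y) = 0" | "sin (2*y) = 0" | "cos (2*z) = 0" |
        "sin (2*z) = 0"
      by (auto simp: K_def)
    then show ?thesis
    proof cases
      case 1
      then have "cos (2*x) = cos (pi/2)" by simp
      then have "2*x = pi/2" by (rule cos_inj_pi[rotated 4]) (use B in linarith)+
      then show ?thesis using xx by simp
    next
      case 2
      moreover have "2*x < pi" using B by linarith
      ultimately have "\<not> 0 < 2*x" using sin_gt_zero[of "2*x"] by linarith
      then show ?thesis using xx B B' by auto
    next
      case 3
      then have "cos (2*y) = cos (pi/2)" by simp
      then have "2*y = pi/2" by (rule cos_inj_pi[rotated 4]) (use B in linarith)+
      then show ?thesis using xx B B' by auto
    next
      case 4
      moreover have "2*y < pi" using B by linarith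
      ultimately have "\<not> 0 < 2*y" using sin_gt_zero[of "2*y"] by linarith
      then have "z = 0" using B by linarith
      then show ?thesis using xx Bz Bz' z by auto
    next
      case 5
      then have "cos (2*z) = cos (pi/2)" by simp
      then have "2*z = pi/2" by (rule cos_inj_pi[rotated 4]) (use B in linarith)+
      then show ?thesis using xx B B' by auto
    next
      case 6
      moreover have "2*z < pi" using B by linarith
      ultimately have "\<not> 0 < 2*z" using sin_gt_zero[of "2*z"] by linarith
      then have "z = 0" using B by linarith
      then show ?thesis using xx Bz Bz' z by auto
    qed
  qed
  show ?thesis using x y z by simp
qed

section \<open>Local equivalence and uniqueness of the coordinates\<close>

definition local_equiv :: "complex mat \<Rightarrow> complex mat \<Rightarrow> bool" where
  "local_equiv U V \<longleftrightarrow> (\<exists>u u' w w'. is_unitary 2 u \<and> is_unitary 2 u' \<and> is_unitary 2 w \<and> is_unitary 2 w' \<and>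
        U = kron2 u u' * V * kron2 w w')"

text \<open>The scalar \<open>d\<close> in \<open>local_invariants\<close> is fixed by
  \<open>det U\<close> up to sign, so the traces \<open>r + \<i> s\<close> of two representations
  agree up to a common sign. This leaves the squares of \<open>r\<close> and \<open>s\<close> and
  the product \<open>r * s\<close>. The trace of the squared flip product contains only the square
  of \<open>d\<close> and is compared directly.\<close>

lemma weyl_coords_unique:
  assumes "weyl_chamber (x, y, z)" "local_equiv U (canon_gate x y z)"
    and "weyl_chamber (x', y', z')" "local_equiv U (canon_gate x' y' z')"
  shows "(x, y, z) = (x', y', z')"
proof -
  obtain d where d: "cmod d = 1" "det U = d\<^sup>2"
    "tr4 (spin_flip U * U) = d * tr4 (canon_gate (2*x) (2*y) (2*z))"
    "tr4 ((spin_flip U * U) * (spin_flip U * U)) = d\<^sup>2 * tr4 (canon_gate (4*x) (4*y) (4*z))"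
    using assms(2) unfolding local_equiv_def by (metis local_invariants)
  obtain d' where d': "cmod d' = 1" "det U = d'\<^sup>2"
    "tr4 (spin_flip U * U) = d' * tr4 (canon_gate (2*x') (2*y') (2*z'))"
    "tr4 ((spin_flip U * U) * (spin_flip U * U)) = d'\<^sup>2 * tr4 (canon_gate (4*x') (4*y') (4*z'))"
    using assms(4) unfolding local_equiv_def by (metis local_invariants)
  have n: "d \<noteq> 0" "d' \<noteq> 0" using d(1) d'(1) by auto
  have "d\<^sup>2 = d'\<^sup>2" using d(2) d'(2) by simp
  then have dd: "d = d' \<or> d = - d'" by (simp add: power2_eq_iff)
  define T where "T = tr4 (canon_gate (2*x) (2*y) (2*z))"
  define T' where "T' = tr4 (canon_gate (2*x') (2*y') (2*z'))"
  have eq: "d * T = d' * T'" using d(3) d'(3) by (simp add: T_def T'_def)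
  from dd have "d' * (T - T') = 0 \<or> d' * (T + T') = 0"
  proof
    assume "d = d'"
    then show ?thesis using eq by (simp add: right_diff_distrib)
  next
    assume m: "d = - d'"
    show ?thesis unfolding distrib_left eq[symmetric] m by simp
  qed
  then have "T = T' \<or> T = - T'" using n by (auto simp: add_eq_0_iff)
  then have t: "tr4 (canon_gate (2*x) (2*y) (2*z)) = tr4 (canon_gate (2*x') (2*y') (2*z')) \<or>
     tr4 (canon_gate (2*x) (2*y) (2*z)) = - tr4 (canon_gate (2*x') (2*y') (2*z'))"
    unfolding T_def T'_def .
  have q: "tr4 (canon_gate (4*x) (4*y) (4*z)) = tr4 (canon_gate (4*x') (4*y') (4*z'))"
    using d(4) d'(4) \<open>d\<^sup>2 = d'\<^sup>2\<close> n by auto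
  define r where "r x y z = cos (2*x) * cos (2*y) * cos (2*z)" for x y z :: real
  define s where "s x y z = sin (2*x) * sin (2*y) * sin (2*z)" for x y z :: real
  have t': "tr4 (canon_gate (2*x) (2*y) (2*z)) = 4 * Complex (r x y z) (s x y z)" for x y z
    unfolding tr4_canon r_def s_def by (simp add: complex_eq_iff)
  have "Complex (r x y z) (s x y z) = Complex (r x' y' z') (s x' y' z') \<or>
     Complex (r x y z) (s x y z) = - Complex (r x' y' z') (s x' y' z')"
    using t unfolding t' by (simp add: minus_mult_right del: mult_minus_right)
  then have "(r x y z = r x' y' z' \<and> s x y z = s x' y' z') \<or> (r x y z = - r x' y' z' \<and> s x y z = - s x' y' z')"
    by (auto simp: complex_eq_iff)
  then have rs: "(r x y z)\<^sup>2 = (r x' y' z')\<^sup>2" "(s x y z)\<^sup>2 = (s x' y' z')\<^sup>2" "r x y z * s x y z = r x' y'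
      z' * s x' y' z'"
    by auto
  have "cos (4*x) * cos (4*y) * cos (4*z) = cos (4*x') * cos (4*y') * cos (4*z')"
    using arg_cong[OF q, of Re] unfolding tr4_canon by simp
  then show ?thesis
    using chamber_unique[OF assms(1,3)] rs unfolding r_def s_def by blast
qed

lemma local_equiv_refl: "A \<in> carrier_mat 4 4 \<Longrightarrow> local_equiv A A"
  unfolding local_equiv_def
  by (intro exI[of _ "1\<^sub>m 2"]) (simp add: kron2_one)

lemma local_equivI:
  assumes "is_unitary 2 u" "is_unitary 2 u'" "is_unitary 2 w" "is_unitary 2 w'"
    and "U = kron2 u u' * V * kron2 w w'"
  shows "local_equiv U V"
  using assms unfolding local_equiv_def by blast

lemma local_equiv_trans:
  assumes "local_equiv A B" "local_equiv B C" "C \<in> carrier_mat 4 4"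
  shows "local_equiv A C"
proof -
  obtain u u' w w' where u: "is_unitary 2 u" "is_unitary 2 u'" "is_unitary 2 w" "is_unitary 2 w'"
    and A: "A = kron2 u u' * B * kron2 w w'" using assms(1) unfolding local_equiv_def by blast
  obtain a a' b b' where a: "is_unitary 2 a" "is_unitary 2 a'" "is_unitary 2 b" "is_unitary 2 b'"
    and B: "B = kron2 a a' * C * kron2 b b'" using assms(2) unfolding local_equiv_def by blast
  note c = u[THEN unitary_carrier] a[THEN unitary_carrier]
  have "A = (kron2 u u' * kron2 a a') * C * (kron2 b b' * kron2 w w')"
    unfolding A B using assms(3) by (simp add: assoc_mat4)
  also have "\<dots> = kron2 (u * a) (u' * a') * C * kron2 (b * w) (b' * w')" using c by (simp add: kron2_mult)
  finally show ?thesis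
    by (rule local_equivI[OF unitary_mult[OF u(1) a(1)] unitary_mult[OF u(2) a(2)]
          unitary_mult[OF a(3) u(3)] unitary_mult[OF a(4) u(4)]])
qed

section \<open>Reduction of arbitrary coordinates to the chamber\<close>

definition canon_equiv :: "real \<times> real \<times> real \<Rightarrow> real \<times> real \<times> real \<Rightarrow> bool" where
  "canon_equiv a b \<longleftrightarrow> (case a of (x, y, z) \<Rightarrow> case b of (x', y', z') \<Rightarrow>
     local_equiv (canon_gate x y z) (canon_gate x' y' z'))"

lemma canon_equiv_refl: "canon_equiv a a" by (auto simp: canon_equiv_def local_equiv_refl)

lemma canon_equiv_trans: "canon_equiv a b \<Longrightarrow> canon_equiv b c \<Longrightarrow> canon_equiv a c"
  by (auto simp: canon_equiv_def intro: local_equiv_trans)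

lemma pauli_unitary: "is_unitary 2 pauliX" "is_unitary 2 pauliY" "is_unitary 2 pauliZ"
  unfolding is_unitary_def
  by (auto intro!: eq_mat2I simp: mult_index2 pauli_index carrier_matD[OF pauli_carrier(1)]
     carrier_matD[OF pauli_carrier(2)] carrier_matD[OF pauli_carrier(3)] simp del: index_mult_mat(1))

text \<open>At angle \<open>pi/2\<close> the interaction along XX equals \<open>\<i> XX\<close>, a
  local gate.\<close>

lemma canon_equiv_shift_up: "canon_equiv (x + pi/2, y, z) (x, y, z)"
proof -
  have "canon_gate (pi/2) 0 0 = kron2 (\<i> \<cdot>\<^sub>m pauliX) pauliX"
    by (rule eq_mat4_casesI) (simp_all add: canon_index canon_entry_def kron2_smult_left kron2_index pauli_index
      carrier_matD[OF pauli_carrier(1)])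
  then have "canon_gate (x + pi/2) y z = kron2 (\<i> \<cdot>\<^sub>m pauliX) pauliX * canon_gate x y z * kron2 (1\<^sub>m 2) (1\<^sub>m 2)"
    using canon_mult[of "pi/2" 0 0 x y z] by (simp add: kron2_one add.commute)
  from local_equivI[OF _ _ _ _ this] show ?thesis unfolding canon_equiv_def
    by (simp add: unitary_smult pauli_unitary)
qed

lemma canon_equiv_shift_down: "canon_equiv (x - pi/2, y, z) (x, y, z)"
proof -
  have "canon_gate (-(pi/2)) 0 0 = kron2 ((-\<i>) \<cdot>\<^sub>m pauliX) pauliX"
    by (rule eq_mat4_casesI) (simp_all add: canon_index canon_entry_def kron2_smult_left kron2_index pauli_index
      carrier_matD[OF pauli_carrier(1)])
  then have "canon_gate (x - pi/2) y z = kron2 ((-\<i>) \<cdot>\<^sub>m pauliX) pauliX * canon_gate x y z * kron2 (1\<^sub>m 2) (1\<^sub>m 2)"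
    using canon_mult[of "-(pi/2)" 0 0 x y z] by (simp add: kron2_one add.commute)
  from local_equivI[OF _ _ _ _ this] show ?thesis unfolding canon_equiv_def
    by (simp add: unitary_smult pauli_unitary)
qed

definition hadamard :: "complex mat" where
  "hadamard = mat 2 2 (\<lambda>(i,j). if i = 1 \<and> j = 1 then - complex_of_real (1 / sqrt 2) else complex_of_real (1
      / sqrt 2))"

definition phase_gate :: "complex \<Rightarrow> complex mat" where
  "phase_gate c = mat 2 2 (\<lambda>(i,j). if i = j then (if i = 0 then 1 else c) else 0)"

lemma sqrt_half: "complex_of_real (1 / sqrt 2) * complex_of_real (1 / sqrt 2) = 1/2"
  by (simp flip: of_real_mult)

lemma hadamard_unitary: "is_unitary 2 hadamard"
  unfolding is_unitary_def
  by (auto intro!: eq_mat2I simp: mult_index2 hadamard_def adjm_def sqrt_half[simplified] field_simps simp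
      del: index_mult_mat(1))

lemma phase_gate_unitary: "cmod c = 1 \<Longrightarrow> is_unitary 2 (phase_gate c)"
  using complex_norm_square[of c] unfolding is_unitary_def
  by (auto intro!: eq_mat2I simp: mult_index2 phase_gate_def adjm_def simp del: index_mult_mat(1))

text \<open>Conjugating both qubits by the phase gate with entries 1 and \<open>\<i>\<close>
  exchanges XX and YY and fixes ZZ.\<close>

lemma canon_equiv_swap12: "canon_equiv (x, y, z) (y, x, z)"
proof -
  have s: "sin (y - x) = - sin (x - y)" "cos (y - x) = cos (x - y)"
    using sin_minus[of "x - y"] cos_minus[of "x - y"] by simp_all
  have "canon_gate x y z = kron2 (phase_gate \<i>) (phase_gate \<i>) * canon_gate y x z * kron2 (phase_gate (-\<i>))
      (phase_gate (-\<i>))"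
    by (rule eq_mat4_casesI)
      (simp_all add: mult_index4 canon_index canon_entry_def kron2_index phase_gate_def s add.commute del:
          index_mult_mat(1), simp_all add: algebra_simps)
  from local_equivI[OF _ _ _ _ this] show ?thesis unfolding canon_equiv_def
    by (simp add: phase_gate_unitary)
qed

text \<open>Conjugation by Z on one qubit negates XX and YY and fixes ZZ. Sign changes of this kind
  always come in pairs.\<close>

lemma canon_equiv_neg12: "canon_equiv (x, y, z) (-x, -y, z)"
proof -
  have e: "- x + y = - (x - y)" "y - x = - (x - y)" "- x - y = - (x + y)" "-y - x = - (x + y)" by simp_all
  have s: "sin (y - x) = - sin (x - y)" "cos (y - x) = cos (x - y)"
    "sin (- x - y) = - sin (x + y)" "cos (-x - y) = cos (x + y)"
    unfolding e sin_minus cos_minus by simp_all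
  have "canon_gate x y z = kron2 pauliZ (1\<^sub>m 2) * canon_gate (-x) (-y) z * kron2 pauliZ (1\<^sub>m 2)"
    by (rule eq_mat4_casesI)
      (simp_all add: mult_index4 canon_index canon_entry_def kron2_index pauli_index s del: index_mult_mat(1))
  from local_equivI[OF _ _ _ _ this] show ?thesis unfolding canon_equiv_def
    by (simp add: pauli_unitary)
qed

text \<open>Hadamard gates on both qubits exchange XX and ZZ; the sign acquired by Y occurs twice in
  YY and cancels.\<close>

lemma canon_equiv_swap13: "canon_equiv (x, y, z) (z, y, x)"
proof -
  have c: "cis t = cos t + \<i> * sin t" "cis (-t) = cos t - \<i> * sin t" for t :: real
    by (simp_all add: complex_eq_iff)
  have h: "hadamard $$ (0,0) = complex_of_real (1 / sqrt 2)" "hadamard $$ (0,Suc 0) = complex_of_real (1 / sqrt 2)"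
      "hadamard $$ (Suc 0,0) = complex_of_real (1 / sqrt 2)" "hadamard $$ (Suc 0,Suc 0) = - complex_of_real
          (1 / sqrt 2)"
    by (simp_all add: hadamard_def)
  have hh: "kron2 hadamard hadamard $$ (i,j) = (if (i div 2 = 1 \<and> j div 2 = 1) \<noteq> (i mod 2 = 1 \<and> j mod 2 = 1)
      then -1/2 else 1/2)"
    if "i < 4" "j < 4" for i j
    using that unfolding less_4_cases by (elim disjE) (simp_all add: kron2_index h sqrt_half del: of_real_divide)
  have "canon_gate x y z = kron2 hadamard hadamard * canon_gate z y x * kron2 hadamard hadamard"
    by (rule eq_mat4_casesI)
      (simp_all add: mult_index4 canon_index hh del: index_mult_mat(1), simp_all add: canon_entry_def c
          cos_add cos_diff sin_add sin_diff
        field_simps)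
  from local_equivI[OF _ _ _ _ this] show ?thesis unfolding canon_equiv_def
    by (simp add: hadamard_unitary)
qed

lemma canon_equiv_swap23: "canon_equiv (x, y, z) (x, z, y)"
  using canon_equiv_trans[OF canon_equiv_trans[OF canon_equiv_swap12 canon_equiv_swap13] canon_equiv_swap12] .

lemma canon_equiv_neg23: "canon_equiv (x, y, z) (x, -y, -z)"
  using canon_equiv_trans[OF canon_equiv_trans[OF canon_equiv_swap13 canon_equiv_neg12] canon_equiv_swap13] .

lemma canon_equiv_neg13: "canon_equiv (x, y, z) (-x, y, -z)"
  using canon_equiv_trans[OF canon_equiv_trans[OF canon_equiv_swap23 canon_equiv_neg12] canon_equiv_swap23] .

definition reducible :: "real \<times> real \<times> real \<Rightarrow> bool" where
  "reducible a \<longleftrightarrow> (\<exists>b. weyl_chamber b \<and> canon_equiv a b)"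

lemma reducible_step: "canon_equiv a b \<Longrightarrow> reducible b \<Longrightarrow> reducible a"
  using canon_equiv_trans unfolding reducible_def by blast

text \<open>Paired sign changes cannot remove a single minus sign. A negative \<open>z\<close> is
  turned positive together with a reversal of \<open>x\<close>, and \<open>-x\<close> is then
  shifted by \<open>pi/2\<close>. This is why the chamber extends beyond \<open>pi/4\<close> when
  \<open>z \<noteq> 0\<close>.\<close>

lemma reducible_signed:
  assumes "\<bar>z\<bar> \<le> y" "y \<le> x" "x \<le> pi/4"
  shows "reducible (x, y, z)"
proof (cases "z \<ge> 0")
  case True
  then have "weyl_chamber (x, y, z)" using assms pi_gt_zero by (auto simp: weyl_chamber_def)
  then show ?thesis using canon_equiv_refl unfolding reducible_def by blast
next
  case False
  have "weyl_chamber (pi/2 - x, y, -z)" using assms False pi_gt_zero by (auto simp: weyl_chamber_def min_def)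
  moreover have "canon_equiv (- x, y, - z) (pi/2 - x, y, -z)" using canon_equiv_shift_down[of "pi/2 - x" y
      "-z"] by simp
  then have "canon_equiv (x, y, z) (pi/2 - x, y, -z)" by (rule canon_equiv_trans[OF canon_equiv_neg13])
  ultimately show ?thesis unfolding reducible_def by blast
qed

lemma reducible_abs:
  assumes "\<bar>z\<bar> \<le> \<bar>y\<bar>" "\<bar>y\<bar> \<le> \<bar>x\<bar>" "\<bar>x\<bar> \<le> pi/4"
  shows "reducible (x, y, z)"
proof -
  consider "x \<ge> 0" "y \<ge> 0" | "x < 0" "y < 0" | "x < 0" "y \<ge> 0" | "x \<ge> 0" "y < 0" by linarith
  then show ?thesis
  proof cases
    case 1 then show ?thesis using assms by (auto intro: reducible_signed)
  next
    case 2 then show ?thesis using assms by (auto intro: reducible_step[OF canon_equiv_neg12 reducible_signed])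
  next
    case 3 then show ?thesis using assms by (auto intro: reducible_step[OF canon_equiv_neg13 reducible_signed])
  next
    case 4 then show ?thesis using assms by (auto intro: reducible_step[OF canon_equiv_neg23 reducible_signed])
  qed
qed

lemma reducible_small:
  assumes "\<bar>x\<bar> \<le> pi/4" "\<bar>y\<bar> \<le> pi/4" "\<bar>z\<bar> \<le> pi/4"
  shows "reducible (x, y, z)"
proof -
  have 1: "reducible (x, y, z)" if "\<bar>z\<bar> \<le> \<bar>x\<bar>" "\<bar>z\<bar> \<le> \<bar>y\<bar>" "\<bar>x\<bar> \<le> pi/4" "\<bar>y\<bar> \<le> pi/4" for x y z
    using reducible_abs[of z y x] reducible_step[OF canon_equiv_swap12 reducible_abs[of z x y]] that by linarith
  have 2: "reducible (x, y, z)" if "\<bar>y\<bar> \<le> \<bar>x\<bar>" "\<bar>y\<bar> \<le> \<bar>z\<bar>" using reducible_step[OF canon_equiv_swap23 1[of y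
      x z]] that assms by blast
  have 3: "reducible (x, y, z)" if "\<bar>x\<bar> \<le> \<bar>y\<bar>" "\<bar>x\<bar> \<le> \<bar>z\<bar>" using reducible_step[OF canon_equiv_swap13 1[of x
      z y]] that assms by blast
  show ?thesis using 1[of z x y] 2 3 assms by linarith
qed

text \<open>Subtracting the nearest multiple of the period \<open>pi/2\<close> leaves at most half a
  period.\<close>

lemma canon_equiv_reduce_first: "\<exists>x'. \<bar>x'\<bar> \<le> pi/4 \<and> canon_equiv (x, y, z) (x', y, z)"
proof -
  have up: "canon_equiv (x + real n * (pi/2), y, z) (x, y, z)" for x n
  proof (induction n)
    case (Suc n)
    then show ?case
      using canon_equiv_trans[OF canon_equiv_shift_up[of "x + real n * (pi/2)" y z] Suc] by (simp add:
          algebra_simps add_divide_distrib)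
  qed (simp add: canon_equiv_refl)
  have down: "canon_equiv (x - real n * (pi/2), y, z) (x, y, z)" for x n
  proof (induction n)
    case (Suc n)
    then show ?case
      using canon_equiv_trans[OF canon_equiv_shift_down[of "x - real n * (pi/2)" y z] Suc] by (simp add:
          algebra_simps add_divide_distrib)
  qed (simp add: canon_equiv_refl)
  define k where "k = round (x / (pi/2))"
  define x' where "x' = x - of_int k * (pi/2)"
  have "\<bar>of_int k - x / (pi/2)\<bar> \<le> 1/2" unfolding k_def by (rule of_int_round_abs_le)
  then have "\<bar>of_int k - x / (pi/2)\<bar> * (pi/2) \<le> 1/2 * (pi/2)" by (intro mult_right_mono) auto
  also have "\<bar>of_int k - x / (pi/2)\<bar> * (pi/2) = \<bar>(of_int k - x / (pi/2)) * (pi/2)\<bar>" by (simp add: abs_mult)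
  also have "(of_int k - x / (pi/2)) * (pi/2) = - x'" by (simp add: x'_def field_simps)
  finally have "\<bar>x'\<bar> \<le> pi/4" by simp
  moreover have "canon_equiv (x, y, z) (x', y, z)"
  proof (cases "k \<ge> 0")
    case True
    then show ?thesis using up[of x' "nat k"] by (simp add: x'_def)
  next
    case False
    then show ?thesis using down[of x' "nat (-k)"] by (simp add: x'_def)
  qed
  ultimately show ?thesis by blast
qed

lemma canon_reducible: "reducible (x, y, z)"
proof -
  obtain x' where x: "\<bar>x'\<bar> \<le> pi/4" "canon_equiv (x, y, z) (x', y, z)" using canon_equiv_reduce_first by blast
  obtain y' where y: "\<bar>y'\<bar> \<le> pi/4" "canon_equiv (y, x', z) (y', x', z)" using canon_equiv_reduce_first by blast
  obtain z' where z: "\<bar>z'\<bar> \<le> pi/4" "canon_equiv (z, x', y') (z', x', y')" using canon_equiv_reduce_first by blast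
  have "reducible (z', x', y')" using x y z by (intro reducible_small) auto
  then have "reducible (z, x', y')" using z(2) reducible_step by blast
  then have "reducible (y', x', z)" using reducible_step[OF canon_equiv_trans[OF canon_equiv_swap13
      canon_equiv_swap23]]
    using reducible_step[OF canon_equiv_swap13] reducible_step[OF canon_equiv_swap23] by blast
  then have "reducible (y, x', z)" using y(2) reducible_step by blast
  then have "reducible (x', y, z)" using reducible_step[OF canon_equiv_swap12] by blast
  then show ?thesis using x(2) reducible_step by blast
qed

section \<open>Products of two operators of Schmidt rank two\<close>

text \<open>The left side is the determinant of a sum of two tensor products, expanded as in
  \<open>det_mat4\<close>. The right side is the resultant of \<open>da t^2 + p t + db\<close> and
  \<open>dd t^2 - q t + dc\<close>, where \<open>p\<close> and \<open>q\<close> are the polarised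
  determinants of the two pairs. When \<open>da\<close> and \<open>dc\<close> are nonzero, both are
  \<open>(da dc)^2\<close> times the product of all \<open>1 + \<lambda> \<mu>\<close>, with
  \<open>\<lambda>\<close> and \<open>\<mu>\<close> ranging over the eigenvalues of second factor
  relative to first in each pair.\<close>

lemma resultant_identity:
  fixes a0 a1 a2 a3 b0 b1 b2 b3 c0 c1 c2 c3 d0 d1 d2 d3 :: complex
  defines "x00 \<equiv> a0*c0 + b0*d0" and "x01 \<equiv> a0*c1 + b0*d1" and "x02 \<equiv> a1*c0+b1*d0" and "x03 \<equiv> a1*c1+b1*d1"
  and "x10 \<equiv> a0*c2 + b0*d2" and "x11 \<equiv> a0*c3 + b0*d3" and "x12 \<equiv> a1*c2+b1*d2" and "x13 \<equiv> a1*c3+b1*d3"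
  and "x20 \<equiv> a2*c0 + b2*d0" and "x21 \<equiv> a2*c1 + b2*d1" and "x22 \<equiv> a3*c0+b3*d0" and "x23 \<equiv> a3*c1+b3*d1"
  and "x30 \<equiv> a2*c2 + b2*d2" and "x31 \<equiv> a2*c3 + b2*d3" and "x32 \<equiv> a3*c2+b3*d2" and "x33 \<equiv> a3*c3+b3*d3"
  defines "p \<equiv> a0*b3 + a3*b0 - a1*b2 - a2*b1" and "q \<equiv> c0*d3+c3*d0-c1*d2-c2*d1"
    and "da \<equiv> a0*a3-a1*a2" and "db \<equiv> b0*b3-b1*b2" and "dc \<equiv> c0*c3-c1*c2" and "dd \<equiv> d0*d3-d1*d2"
  shows "(x00*x11-x01*x10)*(x22*x33-x23*x32) - (x00*x21-x01*x20)*(x12*x33-x13*x32)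
   + (x00*x31-x01*x30)*(x12*x23-x13*x22) + (x10*x21-x11*x20)*(x02*x33-x03*x32)
   - (x10*x31-x11*x30)*(x02*x23-x03*x22) + (x20*x31-x21*x30)*(x02*x13-x03*x12)
   = (da*dc - db*dd)*(da*dc-db*dd) + p*q*(da*dc+db*dd) + da*db*q*q + p*p*dc*dd"
  unfolding assms by (simp add: algebra_simps)


text \<open>The flip product consists of two determinants and the cross terms
  \<open>P \<otimes> Q\<close> and \<open>adj P \<otimes> adj Q\<close>. A 2x2 matrix is half its
  trace plus a traceless part, and the adjugate reverses the latter; so the mixed terms cancel and
  only a scalar and \<open>2 P0 \<otimes> Q0\<close> survive. A traceless 2x2 matrix squares to
  minus its determinant, which makes the square of \<open>M\<close> a scalar.\<close>

lemma flip_product_rank_two: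
  assumes "B1 \<in> carrier_mat 2 2" "B2 \<in> carrier_mat 2 2" "D1 \<in> carrier_mat 2 2" "D2 \<in> carrier_mat 2 2"
    and V: "V = kron2 B1 D1 + kron2 B2 D2"
  obtains c M where "M \<in> carrier_mat 4 4" "spin_flip V * V = c \<cdot>\<^sub>m 1\<^sub>m 4 + M" "tr4 M = 0"
    "M * M = (c * c - det V) \<cdot>\<^sub>m 1\<^sub>m 4"
proof -
  define P where "P = adjugate2 B1 * B2" define Q where "Q = adjugate2 D1 * D2"
  define p where "p = P $$ (0,0) + P $$ (1,1)" define q where "q = Q $$ (0,0) + Q $$ (1,1)"
  define traceless :: "complex mat \<Rightarrow> complex mat" where
    "traceless P = mat 2 2 (\<lambda>(i,j). if i = j then (P $$ (i,i) - P $$ (1-i,1-i)) / 2 else P $$ (i,j))" for P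
  define P0 where "P0 = traceless P" define Q0 where "Q0 = traceless Q"
  define M where "M = 2 \<cdot>\<^sub>m kron2 P0 Q0"
  define c where "c = det2 B1 * det2 D1 + det2 B2 * det2 D2 + p * q / 2"
  have traceless: "traceless P \<in> carrier_mat 2 2" "traceless P $$ (0,0) = (P $$ (0,0) - P $$ (1,1)) / 2"
     "traceless P $$ (0,Suc 0) = P $$ (0,1)" "traceless P $$ (Suc 0,0) = P $$ (1,0)"
     "traceless P $$ (Suc 0,Suc 0) = (P $$ (1,1) - P $$ (0,0)) / 2" for P
    by (simp_all add: traceless_def)
  have PQ: "P \<in> carrier_mat 2 2" "Q \<in> carrier_mat 2 2" using assms by (auto simp: P_def Q_def)
  have P0: "P0 \<in> carrier_mat 2 2" "Q0 \<in> carrier_mat 2 2" by (simp_all add: P0_def Q0_def traceless)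
  have pol: "kron2 P Q + kron2 (adjugate2 P) (adjugate2 Q) = (p * q / 2) \<cdot>\<^sub>m 1\<^sub>m 4 + M"
    by (rule eq_mat4_casesI)
      (simp_all add: M_def kron2_index adjugate2_index p_def q_def P0_def Q0_def traceless field_simps)
  have ad_P: "adjugate2 P = adjugate2 B2 * B1" "adjugate2 Q = adjugate2 D2 * D1"
    using assms by (auto intro!: eq_mat2I simp: P_def Q_def mult_index2 adjugate2_index algebra_simps
       simp del: index_mult_mat(1))
  have "spin_flip V * V = (kron2 (adjugate2 B1) (adjugate2 D1) + kron2 (adjugate2 B2) (adjugate2 D2)) *
      (kron2 B1 D1 + kron2 B2 D2)"
    by (simp add: V spin_flip_add spin_flip_kron2)
  also have "\<dots> = (kron2 (adjugate2 B1 * B1) (adjugate2 D1 * D1) + kron2 (adjugate2 B2 * B1) (adjugate2 D2 * D1))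
     + (kron2 (adjugate2 B1 * B2) (adjugate2 D1 * D2) + kron2 (adjugate2 B2 * B2) (adjugate2 D2 * D2))"
    using assms by (simp add: distrib_mat4 kron2_mult)
  also have "kron2 (adjugate2 B1 * B1) (adjugate2 D1 * D1) = (det2 B1 * det2 D1) \<cdot>\<^sub>m 1\<^sub>m 4"
    using assms by (simp add: adjugate2_mult_left kron2_smult_left kron2_smult_right kron2_one
        smult_smult_mat mult.commute)
  also have "kron2 (adjugate2 B2 * B2) (adjugate2 D2 * D2) = (det2 B2 * det2 D2) \<cdot>\<^sub>m 1\<^sub>m 4"
    using assms by (simp add: adjugate2_mult_left kron2_smult_left kron2_smult_right kron2_one
        smult_smult_mat mult.commute)
  also have "(det2 B1 * det2 D1) \<cdot>\<^sub>m 1\<^sub>m 4 + kron2 (adjugate2 B2 * B1) (adjugate2 D2 * D1)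
     + (kron2 (adjugate2 B1 * B2) (adjugate2 D1 * D2) + (det2 B2 * det2 D2) \<cdot>\<^sub>m 1\<^sub>m 4)
     = (det2 B1 * det2 D1 + det2 B2 * det2 D2) \<cdot>\<^sub>m 1\<^sub>m 4 + (kron2 P Q + kron2 (adjugate2 P) (adjugate2 Q))"
    unfolding ad_P unfolding P_def Q_def
    by (rule eq_matI) (simp_all add: algebra_simps)
  also have "\<dots> = c \<cdot>\<^sub>m 1\<^sub>m 4 + M"
    unfolding pol by (rule eq_matI) (simp_all add: M_def c_def algebra_simps)
  finally have 1: "spin_flip V * V = c \<cdot>\<^sub>m 1\<^sub>m 4 + M" .
  have 2: "tr4 M = 0" by (simp add: tr4_def M_def kron2_index P0_def Q0_def traceless field_simps)
  have sq: "traceless P * traceless P = (- det2 (traceless P)) \<cdot>\<^sub>m 1\<^sub>m 2" for P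
    by (rule eq_mat2I) (simp_all add: traceless mult_index2 det2_def field_simps del: index_mult_mat(1))
  have "M * M = 4 \<cdot>\<^sub>m kron2 (P0 * P0) (Q0 * Q0)"
    using P0 by (simp add: M_def smult_mat4
      smult_smult_mat kron2_mult)
  also have "\<dots> = (4 * det2 P0 * det2 Q0) \<cdot>\<^sub>m 1\<^sub>m 4"
    unfolding P0_def Q0_def sq
    by (simp add: kron2_smult_left kron2_smult_right smult_smult_mat kron2_one mult_ac)
  also have "4 * det2 P0 * det2 Q0 = 4 * (det2 B1 * det2 B2 - p*p/4) * (det2 D1 * det2 D2 - q*q/4)"
  proof -
    have dd: "det2 (traceless P) = det2 P - (P $$ (0,0) + P $$ (1,1)) * (P $$ (0,0) + P $$ (1,1)) / 4" for P
      by (simp add: det2_def traceless field_simps)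
    have "det2 P = det2 B1 * det2 B2" "det2 Q = det2 D1 * det2 D2"
      using assms by (simp_all add: P_def Q_def det2_mult) (simp_all add: det2_def adjugate2_index mult.commute)
    then show ?thesis by (simp add: P0_def Q0_def dd p_def q_def)
  qed
  \<comment> \<open>Everything is now a polynomial in the four determinants and in \<open>p\<close>
    and \<open>q\<close>; \<open>det V\<close> enters through the resultant.\<close>
  also have "\<dots> = c * c - det V"
  proof -
    have pair_qubits: "p = B1 $$ (0,0) * B2 $$ (1,1) + B1 $$ (1,1) * B2 $$ (0,0) - B1 $$ (0,1) * B2 $$ (1,0)
        - B1 $$ (1,0) * B2 $$ (0,1)"
       "q = D1 $$ (0,0) * D2 $$ (1,1) + D1 $$ (1,1) * D2 $$ (0,0) - D1 $$ (0,1) * D2 $$ (1,0) - D1 $$ (1,0)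
           * D2 $$ (0,1)"
      using assms by (simp_all add: p_def q_def P_def Q_def mult_index2 adjugate2_index algebra_simps del:
          index_mult_mat(1))
    have "V \<in> carrier_mat 4 4" by (simp add: V)
    from det_mat4[OF this]
    have "det V = (det2 B1 * det2 D1 - det2 B2 * det2 D2)*(det2 B1 * det2 D1 - det2 B2 * det2 D2)
        + p*q*(det2 B1 * det2 D1 + det2 B2 * det2 D2) + det2 B1 * det2 B2 *q*q + p*p*det2 D1 * det2 D2"
      unfolding pair_qubits det2_def resultant_identity[symmetric]
      by (simp add: V kron2_index)
    then show ?thesis unfolding c_def by (simp only:) (simp add: field_simps)
  qed
  finally have 3: "M * M = (c * c - det V) \<cdot>\<^sub>m 1\<^sub>m 4" .
  show ?thesis using that[OF _ 1 2 3] by (simp add: M_def)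
qed


lemma smult_one_mat: "1 \<cdot>\<^sub>m A = (A :: complex mat)"
  by (intro eq_matI) auto

text \<open>Cyclicity gives \<open>tr X = tr ((V~ V) (W W~))\<close> with
  \<open>V~ V = a + M\<close> and \<open>W W~ = b + L\<close>. The matrices \<open>P = a - M\<close>
  and \<open>Q = b - L\<close> invert these up to \<open>det V\<close> and \<open>det W\<close>. As
  \<open>M\<close> and \<open>L\<close> are traceless, the two sign changes cancel in
  \<open>tr (P Q)\<close>, which therefore equals \<open>tr X\<close>. Computed through inverses,
  \<open>tr (P Q)\<close> is \<open>det U\<close> times the trace of the inverse of
  \<open>X\<close>, which is a conjugate since \<open>X\<close> is unitary.\<close>

lemma trace_of_two_rank_two_factors:
  assumes B: "B1 \<in> carrier_mat 2 2" "B2 \<in> carrier_mat 2 2" "D1 \<in> carrier_mat 2 2" "D2 \<in> carrier_mat 2 2"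
    and A: "A1 \<in> carrier_mat 2 2" "A2 \<in> carrier_mat 2 2" "C1 \<in> carrier_mat 2 2" "C2 \<in> carrier_mat 2 2"
    and U: "is_unitary 4 U" "U = (kron2 B1 D1 + kron2 B2 D2) * (kron2 A1 C1 + kron2 A2 C2)"
  shows "tr4 (spin_flip U * U) = det U * cnj (tr4 (spin_flip U * U))"
proof -
  define V where "V = kron2 B1 D1 + kron2 B2 D2"
  define W where "W = kron2 A1 C1 + kron2 A2 C2"
  have c: "V \<in> carrier_mat 4 4" "W \<in> carrier_mat 4 4" "U \<in> carrier_mat 4 4"
    using unitary_carrier[OF U(1)] by (simp_all add: V_def W_def)
  have UVW: "U = V * W" by (simp add: U V_def W_def)
  obtain a M where M: "M \<in> carrier_mat 4 4" "spin_flip V * V = a \<cdot>\<^sub>m 1\<^sub>m 4 + M" "tr4 M = 0"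
    "M * M = (a * a - det V) \<cdot>\<^sub>m 1\<^sub>m 4"
    by (rule flip_product_rank_two[OF B V_def])
  have W': "spin_flip W = kron2 (adjugate2 A1) (adjugate2 C1) + kron2 (adjugate2 A2) (adjugate2 C2)"
    by (simp add: W_def spin_flip_add spin_flip_kron2)
  have detsf: "det (spin_flip W) = det W"
    by (simp add: det_mat4[OF spin_flip_carrier] det_mat4[OF c(2)] spin_flip_index algebra_simps)
  \<comment> \<open>\<open>W * spin_flip W\<close> is the flip product of
    \<open>spin_flip W\<close>, which is again a sum of two tensor products.\<close>
  obtain b L where L: "L \<in> carrier_mat 4 4" "spin_flip (spin_flip W) * spin_flip W = b \<cdot>\<^sub>m 1\<^sub>m 4 + L" "tr4 L = 0"
    "L * L = (b * b - det (spin_flip W)) \<cdot>\<^sub>m 1\<^sub>m 4"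
    by (rule flip_product_rank_two[OF adjugate2_carrier adjugate2_carrier adjugate2_carrier adjugate2_carrier W'])
  have WL: "W * spin_flip W = b \<cdot>\<^sub>m 1\<^sub>m 4 + L" using L(2) c by (simp add: spin_flip_spin_flip)
  define P where "P = a \<cdot>\<^sub>m 1\<^sub>m 4 - M" define Q where "Q = b \<cdot>\<^sub>m 1\<^sub>m 4 - L"
  have PQ: "P \<in> carrier_mat 4 4" "Q \<in> carrier_mat 4 4" by (simp_all add: P_def Q_def M L minus_carrier_mat)
  have diffsq: "(x \<cdot>\<^sub>m 1\<^sub>m 4 - N) * (x \<cdot>\<^sub>m 1\<^sub>m 4 + N) = d \<cdot>\<^sub>m 1\<^sub>m 4"
    if "N \<in> carrier_mat 4 4" "N * N = (x * x - d) \<cdot>\<^sub>m 1\<^sub>m 4" for x d :: complex and N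
  proof -
    have "(x \<cdot>\<^sub>m 1\<^sub>m 4 - N) * (x \<cdot>\<^sub>m 1\<^sub>m 4 + N) = (x \<cdot>\<^sub>m 1\<^sub>m 4) * (x \<cdot>\<^sub>m 1\<^sub>m 4) + (x \<cdot>\<^sub>m 1\<^sub>m 4) * N - (N *
        (x \<cdot>\<^sub>m 1\<^sub>m 4) + N * N)"
      using that(1) by (simp add: minus_mult_distrib_mat[of _ 4 4 _ _ 4] mult_add_distrib_mat[of _ 4 4 _ 4])
    also have "\<dots> = (x * x) \<cdot>\<^sub>m 1\<^sub>m 4 + x \<cdot>\<^sub>m N - (x \<cdot>\<^sub>m N + (x * x - d) \<cdot>\<^sub>m 1\<^sub>m 4)"
      using that by (simp add: smult_mat4 smult_smult_mat)
    also have "\<dots> = d \<cdot>\<^sub>m 1\<^sub>m 4"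
      using that(1) by (intro eq_matI) (auto simp: algebra_simps)
    finally show ?thesis .
  qed
  have PA: "P * (spin_flip V * V) = det V \<cdot>\<^sub>m 1\<^sub>m 4" unfolding M(2) P_def using diffsq[OF M(1,4)] .
  have QB: "Q * (W * spin_flip W) = det W \<cdot>\<^sub>m 1\<^sub>m 4" unfolding WL Q_def using diffsq[OF L(1,4)] detsf by simp
  have traces: "tr4 (P * Q) = tr4 ((spin_flip V * V) * (W * spin_flip W))"
  proof -
    have e: "(x \<cdot>\<^sub>m 1\<^sub>m 4 + M') * (y \<cdot>\<^sub>m 1\<^sub>m 4 + L') = (x * y) \<cdot>\<^sub>m 1\<^sub>m 4 + x \<cdot>\<^sub>m L' + (y \<cdot>\<^sub>m M' + M' * L')"
      if "M' \<in> carrier_mat 4 4" "L' \<in> carrier_mat 4 4" for x y :: complex and M' L'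
    proof -
      have "(x \<cdot>\<^sub>m 1\<^sub>m 4 + M') * (y \<cdot>\<^sub>m 1\<^sub>m 4 + L') = y \<cdot>\<^sub>m (x \<cdot>\<^sub>m 1\<^sub>m 4 + M') + (x \<cdot>\<^sub>m L' + M' * L')"
        using that by (simp add: distrib_mat4
          smult_mat4 smult_smult_mat)
      then show ?thesis using that by (auto intro!: eq_matI simp: algebra_simps)
    qed
    have P': "P = a \<cdot>\<^sub>m 1\<^sub>m 4 + (-1) \<cdot>\<^sub>m M" "Q = b \<cdot>\<^sub>m 1\<^sub>m 4 + (-1) \<cdot>\<^sub>m L"
      using M(1) L(1) by (auto simp: P_def Q_def intro!: eq_matI)
    have "tr4 (P * Q) = tr4 ((a * b) \<cdot>\<^sub>m 1\<^sub>m 4 + M * L)"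
      unfolding P' using M L
      by (simp add: e tr4_add tr4_smult smult_mat4 smult_smult_mat)
    also have "\<dots> = tr4 ((spin_flip V * V) * (W * spin_flip W))"
      unfolding M(2) WL using M L by (simp add: e tr4_add tr4_smult)
    finally show ?thesis .
  qed
  define X where "X = spin_flip U * U"
  have cX: "X \<in> carrier_mat 4 4" using c by (simp add: X_def)
  have uX: "is_unitary 4 X" unfolding X_def by (intro unitary_mult spin_flip_unitary U(1))
  have X: "X = spin_flip W * ((spin_flip V * V) * W)"
    using c by (simp add: X_def UVW spin_flip_mult assoc_mat4)
  have dU: "det U = det V * det W" unfolding UVW using c by (simp add: det_mult[of _ 4])
  have "det U * cnj (det U) = det (U * adjm U)"
  proof -
    have "det (adjm U) = cnj (det U)"
      using c(3) by (simp add: det_mat4 algebra_simps)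
    then show ?thesis using c(3) by (simp add: det_mult[of _ 4])
  qed
  then have dn: "det V \<noteq> 0" "det W \<noteq> 0" using unitary_right[OF U(1)] dU by auto
  \<comment> \<open>The inverse of \<open>spin_flip V * V\<close>, expressed through the known
    inverse \<open>adjm X\<close> of \<open>X\<close>.\<close>
  define Z where "Z = W * (adjm X * spin_flip W)"
  have cZ: "Z \<in> carrier_mat 4 4" using c cX by (simp add: Z_def)
  have "spin_flip W * ((spin_flip V * V) * W * adjm X) = 1\<^sub>m 4"
    using unitary_right[OF uX] c cX X by (simp add: assoc_mat4)
  then have "((spin_flip V * V) * W * adjm X) * spin_flip W = 1\<^sub>m 4"
    by (rule mat_mult_left_right_inverse[rotated 2]) (use c cX in simp_all)
  then have AZ: "(spin_flip V * V) * Z = 1\<^sub>m 4"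
    using c cX by (simp add: Z_def assoc_mat4)
  have PZ: "P = det V \<cdot>\<^sub>m Z"
  proof -
    have "P = P * ((spin_flip V * V) * Z)" using PQ by (simp add: AZ)
    also have "\<dots> = (P * (spin_flip V * V)) * Z"
      using PQ c cZ by (simp add: assoc_mult_mat[of P 4 4 "spin_flip V * V" 4 Z 4])
    also have "\<dots> = det V \<cdot>\<^sub>m Z" unfolding PA using cZ by (simp add: smult_mat4)
    finally show ?thesis .
  qed
  have "((inverse (det W)) \<cdot>\<^sub>m (Q * W)) * spin_flip W = 1\<^sub>m 4"
    using QB PQ c dn smult_one_mat
    by (simp add: smult_mat4 assoc_mat4 smult_smult_mat)
  then have "spin_flip W * ((inverse (det W)) \<cdot>\<^sub>m (Q * W)) = 1\<^sub>m 4"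
    by (rule mat_mult_left_right_inverse[rotated 2]) (use c PQ in simp_all)
  then have "det W \<cdot>\<^sub>m (inverse (det W) \<cdot>\<^sub>m (spin_flip W * (Q * W))) = det W \<cdot>\<^sub>m 1\<^sub>m 4"
    using c PQ by (simp add: smult_mat4)
  then have WQW: "spin_flip W * (Q * W) = det W \<cdot>\<^sub>m 1\<^sub>m 4" using dn by (simp add: smult_smult_mat smult_one_mat)
  have "tr4 (P * Q) = det V * tr4 (Z * Q)" using PZ cZ PQ by (simp add: smult_mat4 tr4_smult)
  also have "tr4 (Z * Q) = tr4 ((Q * W) * (adjm X * spin_flip W))"
    using cZ PQ c cX by (subst tr4_comm) (simp_all add: Z_def assoc_mat4)
  also have "\<dots> = tr4 (adjm X * (spin_flip W * (Q * W)))"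
    using PQ c cX by (subst tr4_comm) (simp_all add: assoc_mat4)
  also have "\<dots> = det W * cnj (tr4 X)"
    unfolding WQW using cX by (simp add: smult_mat4 tr4_smult tr4_adjm right_one_mat4)
  also have "tr4 (P * Q) = tr4 X"
    unfolding traces X using c by (subst tr4_comm) (simp_all add: assoc_mat4)
  finally show ?thesis by (simp add: dU X_def mult.assoc)
qed

text \<open>With \<open>det U = d^2\<close> and \<open>d * cnj d = 1\<close> the trace identity
  makes \<open>r + \<i> s\<close> real. In the chamber with \<open>z \<noteq> 0\<close> all doubled
  coordinates lie strictly between 0 and \<open>pi\<close>, so \<open>s\<close> would be
  positive.\<close>

lemma rank_two_factors_imp_z_zero:
  assumes "A1 \<in> carrier_mat 2 2" "A2 \<in> carrier_mat 2 2" "C1 \<in> carrier_mat 2 2" "C2 \<in> carrier_mat 2 2"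
    and "B1 \<in> carrier_mat 2 2" "B2 \<in> carrier_mat 2 2" "D1 \<in> carrier_mat 2 2" "D2 \<in> carrier_mat 2 2"
    and U: "is_unitary 4 U" "U = (kron2 B1 D1 + kron2 B2 D2) * (kron2 A1 C1 + kron2 A2 C2)"
    and u: "is_unitary 2 u" "is_unitary 2 u'" "is_unitary 2 w" "is_unitary 2 w'"
    and Uc: "U = kron2 u u' * canon_gate x y z * kron2 w w'" and ch: "weyl_chamber (x, y, z)"
  shows "z = 0"
proof (rule ccontr)
  assume "z \<noteq> 0"
  obtain d where d: "cmod d = 1" "det U = d\<^sup>2"
    "tr4 (spin_flip U * U) = d * tr4 (canon_gate (2*x) (2*y) (2*z))"
    by (rule local_invariants[OF u Uc])
  have dd: "d * cnj d = 1" using d(1) complex_norm_square[of d] by simp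
  define r s where "r = cos (2*x) * cos (2*y) * cos (2*z)" and "s = sin (2*x) * sin (2*y) * sin (2*z)"
  have t: "tr4 (canon_gate (2*x) (2*y) (2*z)) = 4 * (of_real r + \<i> * of_real s)"
    unfolding r_def s_def by (rule tr4_canon)
  have "d * (4 * (of_real r + \<i> * of_real s)) = d * (d * cnj d) * (4 * (of_real r - \<i> * of_real s))"
    using trace_of_two_rank_two_factors[OF assms(5-8,1-4) U] unfolding d t by (simp add: power2_eq_square
        algebra_simps)
  then have "of_real r + \<i> * of_real s = of_real r - \<i> * complex_of_real s"
    using d(1) by (auto simp: dd)
  then have "s = 0" by (simp add: complex_eq_iff)
  moreover have "0 < x" "x < pi/2" "0 < y" "y < pi/2" "0 < z" "z < pi/2"
    using ch \<open>z \<noteq> 0\<close> by (auto simp: weyl_chamber_def)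
  then have "0 < s" unfolding s_def by (intro mult_pos_pos sin_gt_zero) auto
  ultimately show False by simp
qed

text \<open>A 3x3 matrix that is a sum of two dyads is singular.\<close>

lemma rank_two_minor:
  fixes a b :: "nat \<Rightarrow> complex"
  assumes "\<And>i j. m i j = a i * c j + b i * d j"
  shows "m 0 0 * (m 1 1 * m 2 2 - m 1 2 * m 2 1) - m 0 1 * (m 1 0 * m 2 2 - m 1 2 * m 2 0)
    + m 0 2 * (m 1 0 * m 2 1 - m 1 1 * m 2 0) = (0 :: complex)"
  unfolding assms by (simp add: algebra_simps)

text \<open>Realign the gate so that rows are indexed by entries of the first tensor factor and
  columns by entries of the second. Two product terms make every 3x3 minor vanish, and one well
  chosen minor is a product of three sines. The local gates are first moved into the tensor
  factors.\<close>

lemma rank_two_imp_y_zero: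
  assumes B: "B1 \<in> carrier_mat 2 2" "B2 \<in> carrier_mat 2 2" "D1 \<in> carrier_mat 2 2" "D2 \<in> carrier_mat 2 2"
    and U: "is_unitary 4 U" "U = kron2 B1 D1 + kron2 B2 D2"
    and u: "is_unitary 2 u" "is_unitary 2 u'" "is_unitary 2 w" "is_unitary 2 w'"
    and Uc: "U = kron2 u u' * canon_gate x y z * kron2 w w'" and ch: "weyl_chamber (x, y, z)"
  shows "z = 0" "y = 0"
proof -
  note c = u[THEN unitary_carrier]
  have z: "0\<^sub>m 2 2 \<in> carrier_mat 2 2" by simp
  \<comment> \<open>The identity, as a sum of two tensor products, serves as second factor, so the
    result on products applies and gives \<open>z = 0\<close>.\<close>
  have "kron2 (1\<^sub>m 2) (1\<^sub>m 2) + kron2 (0\<^sub>m 2 2) (0\<^sub>m 2 2) = 1\<^sub>m 4"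
    by (rule eq_mat4_casesI) (simp_all add: kron2_index)
  then have "U = (kron2 B1 D1 + kron2 B2 D2) * (kron2 (1\<^sub>m 2) (1\<^sub>m 2) + kron2 (0\<^sub>m 2 2) (0\<^sub>m 2 2))"
    using unitary_carrier[OF U(1)] U(2) by simp
  from rank_two_factors_imp_z_zero[OF _ z _ z B U(1) this u Uc ch] show z0: "z = 0" by simp
  define B1' B2' D1' D2' where "B1' = adjm u * (B1 * adjm w)" and "B2' = adjm u * (B2 * adjm w)"
    and "D1' = adjm u' * (D1 * adjm w')" and "D2' = adjm u' * (D2 * adjm w')"
  define K L where "K = kron2 u u'" and "L = kron2 w w'"
  have K: "is_unitary 4 K" "is_unitary 4 L" unfolding K_def L_def by (auto intro: unitary_kron2 u)
  note cK = K[THEN unitary_carrier]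
  have "adjm K * (U * adjm L) = (adjm K * K) * (canon_gate x y z * (L * adjm L))"
    unfolding Uc K_def[symmetric] L_def[symmetric] using cK
    by (simp add: assoc_mat4)
  also have "\<dots> = canon_gate x y z" using unitary_left[OF K(1)] unitary_right[OF K(2)] by simp
  finally have "canon_gate x y z = adjm K * ((kron2 B1 D1 + kron2 B2 D2) * adjm L)" by (simp add: U(2))
  also have "\<dots> = kron2 B1' D1' + kron2 B2' D2'"
    using c B by (simp add: K_def L_def adjm_kron2 distrib_mat4 kron2_mult B1'_def B2'_def D1'_def D2'_def)
  finally have e: "canon_gate x y z = kron2 B1' D1' + kron2 B2' D2'" .
  have ind: "canon_entry x y z i j = B1' $$ (i div 2, j div 2) * D1' $$ (i mod 2, j mod 2)
      + B2' $$ (i div 2, j div 2) * D2' $$ (i mod 2, j mod 2)" if "i < 4" "j < 4" for i j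
    using arg_cong[OF e, of "\<lambda>A. A $$ (i,j)"] that by (simp add: canon_index kron2_index)
  \<comment> \<open>Rows 00, 11, 01 and columns 00, 11, 10 of the realigned matrix. Parity
    conservation isolates the entry \<open>m 2 2\<close>, which is \<open>\<i> sin (x + y)\<close>
    at \<open>z = 0\<close>; the rest is a 2x2 minor of diagonal entries of the gate.\<close>
  define rr cc where "rr = (\<lambda>i::nat. if i = 0 then (0,0) else if i = 1 then (1,1) else (0::nat,1::nat))"
    and "cc = (\<lambda>i::nat. if i = 0 then (0,0) else if i = 1 then (1,1) else (1::nat,0::nat))"
  define m where "m i j = B1' $$ (rr i) * D1' $$ (cc j) + B2' $$ (rr i) * D2' $$ (cc j)" for i j
  have mm: "m 0 0 * (m 1 1 * m 2 2 - m 1 2 * m 2 1) - m 0 1 * (m 1 0 * m 2 2 - m 1 2 * m 2 0)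
    + m 0 2 * (m 1 0 * m 2 1 - m 1 1 * m 2 0) = 0"
    by (rule rank_two_minor) (rule m_def)
  have mv: "m 0 0 = canon_entry x y z 0 0" "m 0 1 = canon_entry x y z 1 1" "m 0 2 = canon_entry x y z 1 0"
    "m 1 0 = canon_entry x y z 2 2" "m 1 1 = canon_entry x y z 3 3" "m 1 2 = canon_entry x y z 3 2"
    "m 2 0 = canon_entry x y z 0 2" "m 2 1 = canon_entry x y z 1 3" "m 2 2 = canon_entry x y z 1 2"
    by (simp_all add: ind m_def rr_def cc_def)
  have "complex_of_real ((cos (x - y) * cos (x - y) - cos (x + y) * cos (x + y)) * sin (x + y)) = 0"
    using mm unfolding mv by (simp add: canon_entry_def z0 algebra_simps)
  then have "(cos (x - y) * cos (x - y) - cos (x + y) * cos (x + y)) * sin (x + y) = 0"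
    by (simp only: of_real_eq_0_iff)
  moreover have "cos (x - y) * cos (x - y) - cos (x + y) * cos (x + y) = sin (2*x) * sin (2*y)"
    by (simp only: sin_double cos_add cos_diff) (simp add: algebra_simps)
  ultimately have s: "sin (2*x) * sin (2*y) * sin (x + y) = 0" by simp
  show "y = 0"
  proof (rule ccontr)
    assume "y \<noteq> 0"
    then have "0 < y" "0 < x" "x < pi/2" "y < pi/2" "x + y \<le> pi/2"
      using ch z0 by (auto simp: weyl_chamber_def)
    then have "0 < sin (2*x) * sin (2*y) * sin (x + y)"
      by (intro mult_pos_pos sin_gt_zero) auto
    with s show False by (metis less_irrefl)
  qed
qed

section \<open>Local instruments acting on pure states\<close>

lemma finite_bst: "finite S \<Longrightarrow> finite (bst S)"
proof -
  assume "finite S"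
  moreover have "bst S \<subseteq> (\<lambda>A q. q \<in> A) ` Pow S"
  proof
    fix f assume "f \<in> bst S"
    then have "f = (\<lambda>q. q \<in> Collect f)" "Collect f \<in> Pow S" by (auto simp: bst_def)
    then show "f \<in> (\<lambda>A q. q \<in> A) ` Pow S" by blast
  qed
  ultimately show ?thesis by (meson finite_Pow_iff finite_imageI finite_subset)
qed

lemma bst_upd: "x \<in> bst S \<Longrightarrow> p \<in> S \<Longrightarrow> x(p := b) \<in> bst S"
  by (auto simp: bst_def)

definition op_apply :: "qlab set \<Rightarrow> op \<Rightarrow> ((qlab \<Rightarrow> bool) \<Rightarrow> complex) \<Rightarrow> (qlab \<Rightarrow> bool) \<Rightarrow> complex" where
  "op_apply S K F x = (\<Sum>a\<in>bst S. K x a * F a)"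

lemma op_apply_mmul: "op_apply S (mmul S L K) F = op_apply S L (op_apply S K F)"
proof
  fix x
  have "op_apply S (mmul S L K) F x = (\<Sum>a\<in>bst S. \<Sum>z\<in>bst S. L x z * K z a * F a)"
    by (simp add: op_apply_def mmul_def sum_distrib_right)
  also have "\<dots> = (\<Sum>z\<in>bst S. \<Sum>a\<in>bst S. L x z * K z a * F a)" by (rule sum.swap)
  also have "\<dots> = op_apply S L (op_apply S K F) x"
    by (simp add: op_apply_def sum_distrib_left mult.assoc)
  finally show "op_apply S (mmul S L K) F x = op_apply S L (op_apply S K F) x" .
qed

text \<open>A Kraus operator keeps a pure state pure, so protocols are followed on amplitudes and
  density matrices are formed only at the end.\<close>

lemma apply_kraus_pure:
  "apply_kraus S Ks (\<lambda>x y. F x * cnj (F y)) x y = (\<Sum>K\<leftarrow>Ks. op_apply S K F x * cnj (op_apply S K F y))"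
proof -
  have "(\<Sum>a\<in>bst S. \<Sum>b\<in>bst S. K x a * (F a * cnj (F b)) * cnj (K y b)) = op_apply S K F x * cnj (op_apply S K
      F y)" for K
    unfolding op_apply_def cnj_sum sum_product by (intro sum.cong refl) simp
  then show ?thesis by (simp add: apply_kraus_def)
qed

definition merge :: "nat \<Rightarrow> (qlab \<Rightarrow> bool) \<Rightarrow> (qlab \<Rightarrow> bool) \<Rightarrow> qlab \<Rightarrow> bool" where
  "merge k a c = (\<lambda>q. if q \<in> out_qubits k then a q else c q)"

definition branch_sum :: "nat \<Rightarrow> nat \<Rightarrow> op list \<Rightarrow> ((qlab \<Rightarrow> bool) \<Rightarrow> complex) \<Rightarrow> op" where
  "branch_sum k N Ks F a b = (\<Sum>c\<in>bst (qubits k N - out_qubits k).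
      \<Sum>K\<leftarrow>Ks. op_apply (qubits k N) K F (merge k a c) * cnj (op_apply (qubits k N) K F (merge k b c)))"

lemma ptrace_pure:
  "ptrace_out k N (apply_kraus (qubits k N) Ks (\<lambda>x y. F x * cnj (F y))) a b = branch_sum k N Ks F a b"
  unfolding ptrace_out_def branch_sum_def apply_kraus_pure merge_def by simp

lemma sum_list_concat: "sum_list (concat xss) = (\<Sum>xs\<leftarrow>xss. sum_list xs :: 'a :: comm_monoid_add)"
  by (induction xss) auto

text \<open>Mirrors the list built by \<open>locc_step\<close>: a branch is a first outcome followed
  by a branch of the continuation chosen for it.\<close>

lemma branch_sum_concat:
  "branch_sum k N (concat (map (\<lambda>i. map (\<lambda>L. mmul (qubits k N) L (Ks ! i)) (Ps ! i)) [0..<n])) F a b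
   = (\<Sum>i<n. branch_sum k N (Ps ! i) (op_apply (qubits k N) (Ks ! i) F) a b)"
proof -
  have "(\<Sum>K\<leftarrow>concat (map (\<lambda>i. map (\<lambda>L. mmul (qubits k N) L (Ks ! i)) (Ps ! i)) [0..<n]).
      op_apply (qubits k N) K F x * cnj (op_apply (qubits k N) K F y)) =
     (\<Sum>i<n. \<Sum>L\<leftarrow>Ps ! i. op_apply (qubits k N) L (op_apply (qubits k N) (Ks ! i) F) x *
        cnj (op_apply (qubits k N) L (op_apply (qubits k N) (Ks ! i) F) y))" for x y
    by (simp add: map_concat sum_list_concat o_def op_apply_mmul interv_sum_list_conv_sum_set_nat atLeast0LessThan)
  then have "branch_sum k N (concat (map (\<lambda>i. map (\<lambda>L. mmul (qubits k N) L (Ks ! i)) (Ps ! i)) [0..<n])) F a b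
     = (\<Sum>c\<in>bst (qubits k N - out_qubits k). \<Sum>i<n. \<Sum>L\<leftarrow>Ps ! i. op_apply (qubits k N) L (op_apply (qubits k N)
         (Ks ! i) F) (merge k a c) *
        cnj (op_apply (qubits k N) L (op_apply (qubits k N) (Ks ! i) F) (merge k b c)))"
    by (simp add: branch_sum_def)
  also have "\<dots> = (\<Sum>i<n. branch_sum k N (Ps ! i) (op_apply (qubits k N) (Ks ! i) F) a b)"
    unfolding branch_sum_def by (rule sum.swap)
  finally show ?thesis .
qed

lemma branch_sum_scale: "branch_sum k N Ks (\<lambda>x. c * F x) a b = c * cnj c * branch_sum k N Ks F a b"
proof -
  have "op_apply S K (\<lambda>x. c * F x) x = c * op_apply S K F x" for S K x
    by (simp add: op_apply_def sum_distrib_left mult_ac)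
  then show ?thesis
    by (simp add: branch_sum_def sum_distrib_left sum_list_const_mult[symmetric] mult_ac)
qed

lemma op_apply_cong: "(\<And>x. x \<in> bst S \<Longrightarrow> F x = F' x) \<Longrightarrow> op_apply S K F = op_apply S K F'"
  unfolding op_apply_def by (intro ext sum.cong) auto

text \<open>One protocol serves the whole family: \<open>Ks\<close> is chosen before
  \<open>i\<close>, which stands for an input unknown to the nodes. \<open>F\<close> gives pure
  states, possibly unnormalised, and \<open>T\<close> the desired amplitudes on the two output
  qubits.\<close>

definition conv :: "nat \<Rightarrow> ('i \<Rightarrow> (qlab \<Rightarrow> bool) \<Rightarrow> complex) \<Rightarrow> ('i \<Rightarrow> bool \<Rightarrow> bool \<Rightarrow> complex) \<Rightarrow> bool" where
  "conv N F T \<longleftrightarrow> (\<exists>Ks. locc 2 N Ks \<and> (\<forall>i. \<forall>a\<in>bst (out_qubits 2). \<forall>b\<in>bst (out_qubits 2).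
     branch_sum 2 N Ks (F i) a b = T i (a (Outp 1)) (a (Outp 2)) * cnj (T i (b (Outp 1)) (b (Outp 2)))))"

lemma conv_cong:
  assumes "conv N F T" "\<And>i x. x \<in> bst (qubits 2 N) \<Longrightarrow> F i x = F' i x"
  shows "conv N F' T"
proof -
  have "op_apply (qubits 2 N) K (F i) = op_apply (qubits 2 N) K (F' i)" for i K
    using assms(2) by (rule op_apply_cong)
  then have "branch_sum 2 N Ks (F i) = branch_sum 2 N Ks (F' i)" for Ks i by (simp add: branch_sum_def fun_eq_iff)
  then show ?thesis using assms(1) by (simp add: conv_def)
qed

lemma conv_reindex: "conv N F T \<Longrightarrow> conv N (\<lambda>i. F (h i)) (\<lambda>i. T (h i))"
  unfolding conv_def by blast

text \<open>Prepends an instrument to protocols that are already available. Rescaled by the square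
  root of the number \<open>n\<close> of outcomes, every outcome must lead to the same target, so
  each contributes the share \<open>1/n\<close> of the final density matrix.\<close>

lemma conv_step:
  assumes v: "v \<in> cl_nodes 2 N"
    and loc: "\<forall>K\<in>set Ks. local_on (qubits 2 N) (node_qubits 2 N v) K"
    and comp: "kraus_complete (qubits 2 N) Ks" and ne: "Ks \<noteq> []"
    and nxt: "\<And>K. K \<in> set Ks \<Longrightarrow> conv N (\<lambda>i x. complex_of_real (sqrt (length Ks)) * op_apply (qubits 2 N) K (F
        i) x) T"
  shows "conv N F T"
proof -
  let ?n = "length Ks" let ?S = "qubits 2 N"
  define P where "P K Q \<longleftrightarrow> locc 2 N Q \<and> (\<forall>i. \<forall>a\<in>bst (out_qubits 2). \<forall>b\<in>bst (out_qubits 2).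
     branch_sum 2 N Q (\<lambda>x. complex_of_real (sqrt ?n) * op_apply ?S K (F i) x) a b = T i (a (Outp 1)) (a
         (Outp 2)) * cnj (T i (b (Outp 1)) (b (Outp 2))))" for K Q
  have "\<forall>K\<in>set Ks. \<exists>Q. P K Q" using nxt unfolding conv_def P_def by blast
  then obtain f where f: "\<And>K. K \<in> set Ks \<Longrightarrow> P K (f K)" by metis
  define Ps where "Ps = map f Ks"
  have n0: "complex_of_real (real ?n) \<noteq> 0" using ne by simp
  have s: "complex_of_real (sqrt ?n) * cnj (complex_of_real (sqrt ?n)) = of_nat ?n"
    by (simp flip: of_real_mult)
  have l: "locc 2 N (concat (map (\<lambda>i. map (\<lambda>L. mmul ?S L (Ks ! i)) (Ps ! i)) [0..<?n]))"
    by (rule locc_step[OF v loc comp]) (use f in \<open>auto simp: Ps_def P_def\<close>)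
  have "branch_sum 2 N (concat (map (\<lambda>i. map (\<lambda>L. mmul ?S L (Ks ! i)) (Ps ! i)) [0..<?n])) (F i) a b =
     T i (a (Outp 1)) (a (Outp 2)) * cnj (T i (b (Outp 1)) (b (Outp 2)))" (is "_ = ?t")
    if "a\<in>bst (out_qubits 2)" "b\<in>bst (out_qubits 2)" for i a b
  proof -
    have "branch_sum 2 N (Ps ! j) (op_apply ?S (Ks ! j) (F i)) a b = ?t / of_nat ?n" if j: "j < ?n" for j
    proof -
      have "branch_sum 2 N (Ps ! j) (\<lambda>x. complex_of_real (sqrt ?n) * op_apply ?S (Ks ! j) (F i) x) a b = ?t"
        using f[of "Ks ! j"] that \<open>a\<in>_\<close> \<open>b\<in>_\<close> by (auto simp: P_def Ps_def)
      then have "of_nat ?n * branch_sum 2 N (Ps ! j) (op_apply ?S (Ks ! j) (F i)) a b = ?t"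
        unfolding branch_sum_scale s .
      then show ?thesis using n0 by (simp add: field_simps)
    qed
    then have "(\<Sum>j<?n. branch_sum 2 N (Ps ! j) (op_apply ?S (Ks ! j) (F i)) a b) = (\<Sum>j<?n. ?t / of_nat ?n)"
      by (intro sum.cong) auto
    then show ?thesis unfolding branch_sum_concat using n0 by simp
  qed
  then show ?thesis unfolding conv_def using l by blast
qed

section \<open>Instruments acting on two qubits of one node\<close>

definition two_qubit_op :: "qlab \<Rightarrow> qlab \<Rightarrow> (bool \<Rightarrow> bool \<Rightarrow> bool \<Rightarrow> bool \<Rightarrow> complex) \<Rightarrow> op" where
  "two_qubit_op p q M x y = (if \<forall>r. r \<noteq> p \<and> r \<noteq> q \<longrightarrow> x r = y r then M (x p) (x q) (y p) (y q) else 0)"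

lemma two_qubit_op_local:
  assumes "p \<in> Q" "q \<in> Q" "Q \<subseteq> S"
  shows "local_on S Q (two_qubit_op p q M)"
  unfolding local_on_def
proof (intro exI[of _ "two_qubit_op p q M"] ballI)
  fix x y assume xy: "x \<in> bst S" "y \<in> bst S"
  have "(\<forall>r. r \<noteq> p \<and> r \<noteq> q \<longrightarrow> x r = y r) \<longleftrightarrow>
     (\<forall>r\<in>S - Q. x r = y r) \<and> (\<forall>r. r \<noteq> p \<and> r \<noteq> q \<longrightarrow> restr x Q r = restr y Q r)"
    using xy assms by (auto simp: restr_def bst_def)
  then show "two_qubit_op p q M x y = (if \<forall>q\<in>S - Q. x q = y q then two_qubit_op p q M (restr x Q) (restr y
      Q) else 0)"
    using assms by (auto simp: two_qubit_op_def restr_def)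
qed

text \<open>Only four basis states have a nonzero entry in the row of \<open>x\<close>;
  \<open>h\<close> enumerates them by the old values of the two bits. In \<open>M\<close> the two
  new bits precede the two old ones.\<close>

lemma op_apply_two_qubit_op:
  assumes S: "finite S" "p \<in> S" "q \<in> S" "p \<noteq> q" and x: "x \<in> bst S"
  shows "op_apply S (two_qubit_op p q M) F x = (\<Sum>b\<in>UNIV. \<Sum>c\<in>UNIV. M (x p) (x q) b c * F (x(p := b, q := c)))"
proof -
  define h where "h = (\<lambda>(b,c). x(p := b, q := c))"
  have inj: "inj_on h UNIV"
  proof (rule inj_onI)
    fix u v assume e: "h u = h v"
    have "h u p = fst u" "h u q = snd u" "h v p = fst v" "h v q = snd v"
      using S by (auto simp: h_def split: prod.splits)
    then show "u = v" using e by (simp add: prod_eq_iff)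
  qed
  have sub: "h ` UNIV \<subseteq> bst S" using S x by (auto simp: h_def bst_upd)
  have zero: "two_qubit_op p q M x y * F y = 0" if "y \<in> bst S - h ` UNIV" for y
  proof -
    have "\<not> (\<forall>r. r \<noteq> p \<and> r \<noteq> q \<longrightarrow> x r = y r)"
    proof
      assume "\<forall>r. r \<noteq> p \<and> r \<noteq> q \<longrightarrow> x r = y r"
      then have "y = h (y p, y q)" by (auto simp: h_def fun_eq_iff)
      then show False using that by blast
    qed
    then show ?thesis by (auto simp: two_qubit_op_def)
  qed
  have "op_apply S (two_qubit_op p q M) F x = (\<Sum>y\<in>h ` UNIV. two_qubit_op p q M x y * F y)"
    unfolding op_apply_def using zero sub finite_bst[OF S(1)] by (intro sum.mono_neutral_right) auto
  also have "\<dots> = (\<Sum>u\<in>UNIV. two_qubit_op p q M x (h u) * F (h u))"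
    using inj by (simp add: sum.reindex)
  also have "\<dots> = (\<Sum>u\<in>UNIV \<times> UNIV. case u of (b,c) \<Rightarrow> M (x p) (x q) b c * F (x(p := b, q := c)))"
    using S by (intro sum.cong) (auto simp: h_def two_qubit_op_def)
  also have "\<dots> = (\<Sum>b\<in>UNIV. \<Sum>c\<in>UNIV. M (x p) (x q) b c * F (x(p := b, q := c)))"
    by (subst sum.cartesian_product) simp
  finally show ?thesis .
qed

definition two_qubit_complete :: "(bool \<Rightarrow> bool \<Rightarrow> bool \<Rightarrow> bool \<Rightarrow> complex) list \<Rightarrow> bool" where
  "two_qubit_complete Ms \<longleftrightarrow> (\<forall>b c b' c'. (\<Sum>M\<leftarrow>Ms. \<Sum>d\<in>UNIV. \<Sum>e\<in>UNIV. cnj (M d e b c) * M d e b' c') = (if b =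
      b' \<and> c = c' then 1 else 0))"

lemma two_qubit_op_complete:
  assumes S: "finite S" "p \<in> S" "q \<in> S" "p \<noteq> q" and M: "two_qubit_complete Ms"
  shows "kraus_complete S (map (two_qubit_op p q) Ms)"
  unfolding kraus_complete_def
proof (intro ballI)
  fix x y assume x: "x \<in> bst S" and y: "y \<in> bst S"
  have 1: "mmul S (adj_op (two_qubit_op p q M)) (two_qubit_op p q M) x y =
     (if \<forall>r. r \<noteq> p \<and> r \<noteq> q \<longrightarrow> x r = y r then
      (\<Sum>d\<in>UNIV. \<Sum>e\<in>UNIV. cnj (M d e (x p) (x q)) * M d e (y p) (y q)) else 0)" for M
  proof -
    have a: "adj_op (two_qubit_op p q M) = two_qubit_op p q (\<lambda>b c b' c'. cnj (M b' c' b c))"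
      by (auto simp: adj_op_def two_qubit_op_def fun_eq_iff)
    have "mmul S (adj_op (two_qubit_op p q M)) (two_qubit_op p q M) x y = op_apply S (adj_op (two_qubit_op p
        q M)) (\<lambda>z. two_qubit_op p q M z y) x"
      by (simp add: mmul_def op_apply_def)
    also have "\<dots> = (\<Sum>d\<in>UNIV. \<Sum>e\<in>UNIV. cnj (M d e (x p) (x q)) * two_qubit_op p q M (x(p := d, q := e)) y)"
      unfolding a by (rule op_apply_two_qubit_op[OF S x])
    also have "\<dots> = (if \<forall>r. r \<noteq> p \<and> r \<noteq> q \<longrightarrow> x r = y r then
      (\<Sum>d\<in>UNIV. \<Sum>e\<in>UNIV. cnj (M d e (x p) (x q)) * M d e (y p) (y q)) else 0)"
    proof -
      have c: "(\<forall>r. r \<noteq> p \<and> r \<noteq> q \<longrightarrow> (x(p := d, q := e)) r = y r) \<longleftrightarrow> (\<forall>r. r \<noteq> p \<and> r \<noteq> q \<longrightarrow> x r = y r)" for d e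
        by simp
      have "two_qubit_op p q M (x(p := d, q := e)) y = (if \<forall>r. r \<noteq> p \<and> r \<noteq> q \<longrightarrow> x r = y r then M d e (y p) (y
          q) else 0)" for d e
        unfolding two_qubit_op_def c using S(4) by (intro if_cong refl) auto
      moreover define C where "C \<longleftrightarrow> (\<forall>r. r \<noteq> p \<and> r \<noteq> q \<longrightarrow> x r = y r)"
      ultimately show ?thesis unfolding C_def[symmetric] by simp
    qed
    finally show ?thesis .
  qed
  have "(x = y) \<longleftrightarrow> (\<forall>r. r \<noteq> p \<and> r \<noteq> q \<longrightarrow> x r = y r) \<and> x p = y p \<and> x q = y q" by auto
  moreover define C where "C \<longleftrightarrow> (\<forall>r. r \<noteq> p \<and> r \<noteq> q \<longrightarrow> x r = y r)"
  ultimately have xy: "(x = y) \<longleftrightarrow> C \<and> x p = y p \<and> x q = y q" by simp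
  show "(\<Sum>K\<leftarrow>map (two_qubit_op p q) Ms. mmul S (adj_op K) K x y) = id_op x y"
    using M unfolding id_op_def xy by (cases C) (simp_all add: o_def 1 C_def[symmetric] two_qubit_complete_def)
qed

lemma conv_two_qubit_op:
  assumes v: "v \<in> cl_nodes 2 N" and fin: "finite (qubits 2 N)"
    and pair_qubits: "p \<in> node_qubits 2 N v" "q \<in> node_qubits 2 N v" "p \<noteq> q"
    and M: "two_qubit_complete Ms" "Ms \<noteq> []"
    and nxt: "\<And>M. M \<in> set Ms \<Longrightarrow> conv N (\<lambda>i x. complex_of_real (sqrt (length Ms)) *
       (\<Sum>b\<in>UNIV. \<Sum>c\<in>UNIV. M (x p) (x q) b c * F i (x(p := b, q := c)))) T"
  shows "conv N F T"
proof (rule conv_step[OF v, of "map (two_qubit_op p q) Ms"])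
  have sub: "node_qubits 2 N v \<subseteq> qubits 2 N" by (auto simp: node_qubits_def)
  have S: "p \<in> qubits 2 N" "q \<in> qubits 2 N" using sub pair_qubits by auto
  show "\<forall>K\<in>set (map (two_qubit_op p q) Ms). local_on (qubits 2 N) (node_qubits 2 N v) K"
    using two_qubit_op_local[OF pair_qubits(1,2) sub] by auto
  show "kraus_complete (qubits 2 N) (map (two_qubit_op p q) Ms)" by (rule two_qubit_op_complete[OF fin S
      pair_qubits(3) M(1)])
  show "map (two_qubit_op p q) Ms \<noteq> []" using M(2) by simp
  fix K assume "K \<in> set (map (two_qubit_op p q) Ms)"
  then obtain M where M: "M \<in> set Ms" "K = two_qubit_op p q M" by auto
  show "conv N (\<lambda>i x. complex_of_real (sqrt (length (map (two_qubit_op p q) Ms))) * op_apply (qubits 2 N) K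
      (F i) x) T"
    by (rule conv_cong[OF nxt[OF M(1)]]) (simp add: M(2) op_apply_two_qubit_op[OF fin S pair_qubits(3)])
qed

lemma sum_bool: "(\<Sum>b\<in>UNIV. f b) = f False + (f True :: 'a :: comm_monoid_add)"
  by (simp add: UNIV_bool)

section \<open>Bridge interaction, teleportation and single-node operations\<close>

definition phase_sign :: "bool \<Rightarrow> complex" where "phase_sign b = (if b then -1 else 1)"

text \<open>Diagonal of \<open>e^(i t ZZ)\<close> as a function of the two bits.\<close>

definition ezz :: "real \<Rightarrow> bool \<Rightarrow> bool \<Rightarrow> complex" where
  "ezz t a b = cis (if a = b then t else - t)"

definition inv_sqrt2 :: complex where "inv_sqrt2 = complex_of_real (1 / sqrt 2)"

lemma inv_sqrt2: "inv_sqrt2 * inv_sqrt2 = 1/2" "cnj inv_sqrt2 = inv_sqrt2" "complex_of_real (sqrt 2) *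
    inv_sqrt2 = 1" "2 * (inv_sqrt2 * inv_sqrt2) = 1"
  unfolding inv_sqrt2_def by (simp_all flip: of_real_mult)

lemma ezz_cnj: "cnj (ezz t a b) * ezz t a b = 1" by (simp add: ezz_def cis_cnj cis_mult)

text \<open>Outcome \<open>m\<close> is the parity of the data bit \<open>a\<close> and the EPR half
  \<open>e'\<close>; the half is reset in the same operation.\<close>

lemma two_qubit_complete_parity:
  "two_qubit_complete (map (\<lambda>m a e a' e'. of_bool (a = a' \<and> \<not> e \<and> e' = (a \<noteq> m))) [False, True])"
  unfolding two_qubit_complete_def by (simp add: UNIV_bool all_bool_eq)

text \<open>Three actions in one Kraus operator: \<open>e' \<noteq> m\<close> recovers the remote
  bit from its copy and the announced parity, this bit enters the phase \<open>ezz\<close>, and the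
  copy is erased by an X measurement with outcome \<open>s\<close> and reset.\<close>

lemma two_qubit_complete_hadamard:
  "two_qubit_complete (map (\<lambda>s b e b' e'. of_bool (b = b' \<and> \<not> e) * (inv_sqrt2 * phase_sign (s \<and> (e' \<noteq> m)) *
      ezz t (e' \<noteq> m) b')) [False, True])"
  using ezz_cnj[of t] inv_sqrt2(1)
  unfolding two_qubit_complete_def by (cases m) (simp_all add: UNIV_bool all_bool_eq phase_sign_def
      inv_sqrt2(2) mult_ac)


text \<open>A gate on one qubit, presented as a one-outcome instrument on a pair; the second qubit
  is an idle companion at the same node.\<close>

lemma two_qubit_complete_unitary:
  assumes "\<And>b c. (\<Sum>d\<in>UNIV. cnj (u d b) * u d c) = (if b = c then 1 else (0::complex))"
  shows "two_qubit_complete [\<lambda>b (c::bool) b' c'. of_bool (c = c') * u b b']"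
  using assms[unfolded UNIV_bool] unfolding two_qubit_complete_def by (auto simp: UNIV_bool all_bool_eq)

text \<open>In time order: the parity measurement at A leaves \<open>eB\<close> equal to
  \<open>dA\<close> up to the flip \<open>m\<close>; gate and erasure at B leave the sign
  \<open>phase_sign (s \<and> dA)\<close>; a Z at A removes it. The proof treats these in reverse.
  Two equally likely outcomes cancel one \<open>inv_sqrt2\<close> each time, once from the EPR pair
  and once from the X basis. \<open>G\<close> carries the rest of the state.\<close>

lemma gate_step:
  fixes G :: "'i \<Rightarrow> bool \<Rightarrow> bool \<Rightarrow> (qlab \<Rightarrow> bool) \<Rightarrow> complex"
  assumes fin: "finite (qubits 2 N)" and v: "vA \<in> cl_nodes 2 N" "vB \<in> cl_nodes 2 N"
    and q: "dA \<in> node_qubits 2 N vA" "eA \<in> node_qubits 2 N vA" "dB \<in> node_qubits 2 N vB" "eB \<in> node_qubits 2 N vB"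
    and d: "dA \<noteq> eA" "dB \<noteq> eB" "dA \<noteq> dB" "dA \<noteq> eB" "eA \<noteq> dB" "eA \<noteq> eB"
    and G: "\<And>i a b x c. G i a b (x(dA := c)) = G i a b x" "\<And>i a b x c. G i a b (x(dB := c)) = G i a b x"
      "\<And>i a b x c. G i a b (x(eA := c)) = G i a b x" "\<And>i a b x c. G i a b (x(eB := c)) = G i a b x"
    and conv: "conv N (\<lambda>i x. ezz t (x dA) (x dB) * G i (x dA) (x dB) x * of_bool (\<not> x eA \<and> \<not> x eB)) T"
  shows "conv N (\<lambda>i x. inv_sqrt2 * G i (x dA) (x dB) x * of_bool (x eA = x eB)) T"
proof -
  note dd = d d[symmetric]
  let ?P = "\<lambda>m (a::bool) e a' e'. of_bool (a = a' \<and> \<not> e \<and> e' = (a \<noteq> m)) :: complex"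
  let ?H = "\<lambda>m s (b::bool) e b' e'. of_bool (b = b' \<and> \<not> e) * (inv_sqrt2 * phase_sign (s \<and> (e' \<noteq> m)) * ezz t
      (e' \<noteq> m) b')"
  have A: "conv N (\<lambda>i x. phase_sign (s \<and> x dA) * ezz t (x dA) (x dB) * G i (x dA) (x dB) x * of_bool (\<not> x eA
      \<and> \<not> x eB)) T" for s
  proof (rule conv_two_qubit_op[OF v(1) fin q(1,2) d(1), of "[\<lambda>b (c::bool) b' c'. of_bool (c = c') *
      (of_bool (b = b') * phase_sign (s \<and> b))]"])
    show "two_qubit_complete [\<lambda>b (c::bool) b' c'. of_bool (c = c') * (of_bool (b = b') * phase_sign (s \<and> b))]"
      by (rule two_qubit_complete_unitary, unfold sum_bool) (auto simp: phase_sign_def)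
    fix M assume "M \<in> set [\<lambda>b (c::bool) b' c'. of_bool (c = c') * (of_bool (b = b') * phase_sign (s \<and> b))]"
    then have M: "M = (\<lambda>b (c::bool) b' c'. of_bool (c = c') * (of_bool (b = b') * phase_sign (s \<and> b)))" by simp
    show "conv N (\<lambda>i x. complex_of_real (sqrt (length [\<lambda>b (c::bool) b' c'. of_bool (c = c') * (of_bool (b =
        b') * phase_sign (s \<and> b))])) *
      (\<Sum>b\<in>UNIV. \<Sum>c\<in>UNIV. M (x dA) (x eA) b c * (phase_sign (s \<and> (x(dA := b, eA := c)) dA) * ezz t ((x(dA :=
          b, eA := c)) dA) ((x(dA := b, eA := c)) dB) *
         G i ((x(dA := b, eA := c)) dA) ((x(dA := b, eA := c)) dB) (x(dA := b, eA := c)) * of_bool (\<not> (x(dA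
             := b, eA := c)) eA \<and> \<not> (x(dA := b, eA := c)) eB)))) T"
      by (rule conv_cong[OF conv]) (unfold sum_bool, simp add: M G dd phase_sign_def)
  qed simp
  have B: "conv N (\<lambda>i x. G i (x dA) (x dB) x * of_bool (\<not> x eA \<and> x eB = (x dA \<noteq> m))) T" for m
  proof (rule conv_two_qubit_op[OF v(2) fin q(3,4) d(2) two_qubit_complete_hadamard[of m t]])
    fix M assume "M \<in> set (map (?H m) [False, True])"
    then obtain s where M: "M = ?H m s" unfolding set_map by blast
    show "conv N (\<lambda>i x. complex_of_real (sqrt (length (map (?H m) [False, True]))) *
      (\<Sum>b\<in>UNIV. \<Sum>c\<in>UNIV. M (x dB) (x eB) b c * (G i ((x(dB := b, eB := c)) dA) ((x(dB := b, eB := c)) dB)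
          (x(dB := b, eB := c))
         * of_bool (\<not> (x(dB := b, eB := c)) eA \<and> (x(dB := b, eB := c)) eB = ((x(dB := b, eB := c)) dA \<noteq> m))))) T"
      by (rule conv_cong[OF A[of s]]) (unfold sum_bool, use inv_sqrt2(3) in \<open>auto simp: M G dd\<close>)
  qed simp
  show ?thesis
  proof (rule conv_two_qubit_op[OF v(1) fin q(1,2) d(1) two_qubit_complete_parity])
    fix M assume "M \<in> set (map ?P [False, True])"
    then obtain m where M: "M = ?P m" unfolding set_map by blast
    show "conv N (\<lambda>i x. complex_of_real (sqrt (length (map ?P [False, True]))) *
      (\<Sum>b\<in>UNIV. \<Sum>c\<in>UNIV. M (x dA) (x eA) b c * (inv_sqrt2 * G i ((x(dA := b, eA := c)) dA) ((x(dA := b, eA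
          := c)) dB) (x(dA := b, eA := c))
         * of_bool ((x(dA := b, eA := c)) eA = (x(dA := b, eA := c)) eB)))) T"
      by (rule conv_cong[OF B[of m]]) (unfold sum_bool, use inv_sqrt2(3) in \<open>auto simp: M G dd\<close>)
  qed simp
qed

text \<open>Bell measurement with reset: \<open>p\<close> is the parity of the two bits and
  \<open>q\<close> the relative sign.\<close>

lemma two_qubit_complete_bell:
  "two_qubit_complete (map (\<lambda>(p,q) d h d' h'. of_bool (\<not> d \<and> \<not> h \<and> h' = (d' \<noteq> p)) * (inv_sqrt2 * phase_sign
      (q \<and> d')))
     [(False, False), (False, True), (True, False), (True, True)])"
  using inv_sqrt2(4) unfolding two_qubit_complete_def sum_bool by (simp add: all_bool_eq phase_sign_def
      inv_sqrt2(2))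

text \<open>The amplitudes of the EPR pair and of the Bell vectors, \<open>inv_sqrt2\<close> each,
  cancel the rescaling by \<open>sqrt 4\<close> for four outcomes. The outcome tells the far node to
  undo a bit flip \<open>p\<close> and a sign \<open>q\<close> on \<open>h'\<close>;
  \<open>r\<close> is its idle companion.\<close>

lemma teleport_step:
  fixes G :: "'i \<Rightarrow> bool \<Rightarrow> (qlab \<Rightarrow> bool) \<Rightarrow> complex"
  assumes fin: "finite (qubits 2 N)" and v: "v \<in> cl_nodes 2 N" "v' \<in> cl_nodes 2 N"
    and q: "d \<in> node_qubits 2 N v" "h \<in> node_qubits 2 N v" "h' \<in> node_qubits 2 N v'" "r \<in> node_qubits 2 N v'"
    and ne: "d \<noteq> h" "h' \<noteq> r" "h \<noteq> h'" "d \<noteq> h'"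
    and G: "\<And>i a x c. G i a (x(d := c)) = G i a x" "\<And>i a x c. G i a (x(h := c)) = G i a x"
      "\<And>i a x c. G i a (x(h' := c)) = G i a x"
    and conv: "conv N (\<lambda>i x. G i (x h') x * of_bool (\<not> x d \<and> \<not> x h)) T"
  shows "conv N (\<lambda>i x. inv_sqrt2 * G i (x d) x * of_bool (x h = x h')) T"
proof -
  note dd = ne ne[symmetric]
  let ?C = "\<lambda>p q b (c::bool) b' c'. of_bool (c = c') * (of_bool (b' = (b \<noteq> p)) * phase_sign (q \<and> b))"
  let ?B = "\<lambda>(p,q) d h d' h'. of_bool (\<not> d \<and> \<not> h \<and> h' = (d' \<noteq> p)) * (inv_sqrt2 * phase_sign (q \<and> d'))"
  have A: "conv N (\<lambda>i x. phase_sign (q \<and> (x h' \<noteq> p)) * G i (x h' \<noteq> p) x * of_bool (\<not> x d \<and> \<not> x h)) T" for p q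
  proof (rule conv_two_qubit_op[OF v(2) fin q(3,4) ne(2), of "[?C p (q)]"])
    show "two_qubit_complete [?C p q]"
      by (rule two_qubit_complete_unitary, unfold sum_bool) (auto simp: phase_sign_def)
    fix M assume "M \<in> set [?C p q]"
    then have M: "M = ?C p q" by simp
    show "conv N (\<lambda>i x. complex_of_real (sqrt (length [?C p q])) *
      (\<Sum>b\<in>UNIV. \<Sum>c\<in>UNIV. M (x h') (x r) b c * (phase_sign (q \<and> ((x(h' := b, r := c)) h' \<noteq> p)) * G i ((x(h'
          := b, r := c)) h' \<noteq> p) (x(h' := b, r := c)) * of_bool (\<not> (x(h' := b, r := c)) d \<and> \<not> (x(h' := b, r
          := c)) h)))) T"
    proof (rule conv_cong[OF conv])
      fix i and x :: "qlab \<Rightarrow> bool"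
      have e: "x(h' := b, r := x r) = x(h' := b)" for b using ne by (auto simp: fun_eq_iff)
      have "(\<Sum>b\<in>UNIV. \<Sum>c\<in>UNIV. M (x h') (x r) b c * (phase_sign (q \<and> ((x(h' := b, r := c)) h' \<noteq> p)) * G i
          ((x(h' := b, r := c)) h' \<noteq> p) (x(h' := b, r := c)) * of_bool (\<not> (x(h' := b, r := c)) d \<and> \<not> (x(h'
          := b, r := c)) h)))
        = (\<Sum>b\<in>UNIV. of_bool (b = (x h' \<noteq> p)) * phase_sign (q \<and> x h') * (phase_sign (q \<and> (b \<noteq> p)) * G i (b \<noteq>
            p) (x(h' := b)) * of_bool (\<not> (x(h' := b)) d \<and> \<not> (x(h' := b)) h)))"
      proof (rule sum.cong[OF refl])
        fix b
        have "(\<Sum>c\<in>UNIV. M (x h') (x r) b c * (phase_sign (q \<and> ((x(h' := b, r := c)) h' \<noteq> p)) * G i ((x(h' :=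
            b, r := c)) h' \<noteq> p) (x(h' := b, r := c)) * of_bool (\<not> (x(h' := b, r := c)) d \<and> \<not> (x(h' := b, r
            := c)) h)))
          = (\<Sum>c\<in>UNIV. if c = x r then of_bool (b = (x h' \<noteq> p)) * phase_sign (q \<and> x h') * (phase_sign (q \<and> (b
              \<noteq> p)) * G i (b \<noteq> p) (x(h' := b)) * of_bool (\<not> (x(h' := b)) d \<and> \<not> (x(h' := b)) h)) else 0)"
          by (rule sum.cong[OF refl], rename_tac c, case_tac "c = x r") (simp_all add: M e ne)
        then show "(\<Sum>c\<in>UNIV. M (x h') (x r) b c * (phase_sign (q \<and> ((x(h' := b, r := c)) h' \<noteq> p)) * G i
            ((x(h' := b, r := c)) h' \<noteq> p) (x(h' := b, r := c)) * of_bool (\<not> (x(h' := b, r := c)) d \<and> \<not> (x(h'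
            := b, r := c)) h)))
          = of_bool (b = (x h' \<noteq> p)) * phase_sign (q \<and> x h') * (phase_sign (q \<and> (b \<noteq> p)) * G i (b \<noteq> p) (x(h'
              := b)) * of_bool (\<not> (x(h' := b)) d \<and> \<not> (x(h' := b)) h))"
          by simp
      qed
      then show "G i (x h') x * of_bool (\<not> x d \<and> \<not> x h) = complex_of_real (sqrt (length [?C p q])) *
         (\<Sum>b\<in>UNIV. \<Sum>c\<in>UNIV. M (x h') (x r) b c * (phase_sign (q \<and> ((x(h' := b, r := c)) h' \<noteq> p)) * G i
             ((x(h' := b, r := c)) h' \<noteq> p) (x(h' := b, r := c)) * of_bool (\<not> (x(h' := b, r := c)) d \<and> \<not>
             (x(h' := b, r := c)) h)))"
        unfolding sum_bool by (cases p) (simp_all add: G dd phase_sign_def)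
    qed
  qed simp
  have s4: "complex_of_real (sqrt 4) * inv_sqrt2 * inv_sqrt2 = 1" by (simp only: mult.assoc inv_sqrt2(1)) simp
  show ?thesis
  proof (rule conv_two_qubit_op[OF v(1) fin q(1,2) ne(1) two_qubit_complete_bell])
    fix M assume "M \<in> set (map ?B [(False, False), (False, True), (True, False), (True, True)])"
    then obtain z where "M = ?B z" unfolding set_map by blast
    moreover obtain p q where "z = (p, q)" by (cases z)
    ultimately have M: "M = ?B (p, q)" by simp
    show "conv N (\<lambda>i x. complex_of_real (sqrt (length (map ?B [(False, False), (False, True), (True, False),
        (True, True)]))) *
      (\<Sum>b\<in>UNIV. \<Sum>c\<in>UNIV. M (x d) (x h) b c * (inv_sqrt2 * G i ((x(d := b, h := c)) d) (x(d := b, h := c)) *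
          of_bool ((x(d := b, h := c)) h = (x(d := b, h := c)) h')))) T"
      by (rule conv_cong[OF A[of q p]]) (unfold sum_bool, use inv_sqrt2(4) in \<open>cases p; auto simp: M G dd
          phase_sign_def mult_ac\<close>)
  qed simp
qed

lemma unitary_step:
  fixes G :: "'i \<Rightarrow> bool \<Rightarrow> (qlab \<Rightarrow> bool) \<Rightarrow> complex"
  assumes fin: "finite (qubits 2 N)" and v: "v \<in> cl_nodes 2 N"
    and q: "d \<in> node_qubits 2 N v" "r \<in> node_qubits 2 N v" "d \<noteq> r"
    and u: "\<And>b c. (\<Sum>a\<in>UNIV. cnj (u a b) * u a c) = (if b = c then 1 else (0::complex))"
    and G: "\<And>i a x c. G i a (x(d := c)) = G i a x"
    and conv: "conv N (\<lambda>i x. \<Sum>b\<in>UNIV. u (x d) b * G i b x) T"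
  shows "conv N (\<lambda>i x. G i (x d) x) T"
proof (rule conv_two_qubit_op[OF v fin q, of "[\<lambda>b (c::bool) b' c'. of_bool (c = c') * u b b']"])
  show "two_qubit_complete [\<lambda>b (c::bool) b' c'. of_bool (c = c') * u b b']" by (rule
      two_qubit_complete_unitary[OF u])
  fix M assume "M \<in> set [\<lambda>b (c::bool) b' c'. of_bool (c = c') * u b b']"
  then have M: "M = (\<lambda>b (c::bool) b' c'. of_bool (c = c') * u b b')" by simp
  show "conv N (\<lambda>i x. complex_of_real (sqrt (length [\<lambda>b (c::bool) b' c'. of_bool (c = c') * u b b'])) *
      (\<Sum>b\<in>UNIV. \<Sum>c\<in>UNIV. M (x d) (x r) b c * G i ((x(d := b, r := c)) d) (x(d := b, r := c)))) T"
  proof (rule conv_cong[OF conv])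
    fix i and x :: "qlab \<Rightarrow> bool"
    have e: "x(d := b, r := x r) = x(d := b)" for b using q(3) by (auto simp: fun_eq_iff)
    have "(\<Sum>c\<in>UNIV. M (x d) (x r) b c * G i ((x(d := b, r := c)) d) (x(d := b, r := c))) = (\<Sum>c\<in>UNIV. if c =
        x r then u (x d) b * G i b x else 0)" for b
      using q(3) by (intro sum.cong refl) (auto simp: M e G)
    then show "(\<Sum>b\<in>UNIV. u (x d) b * G i b x) = complex_of_real (sqrt (length [\<lambda>b (c::bool) b' c'. of_bool
        (c = c') * u b b'])) *
      (\<Sum>b\<in>UNIV. \<Sum>c\<in>UNIV. M (x d) (x r) b c * G i ((x(d := b, r := c)) d) (x(d := b, r := c)))"
      by simp
  qed
qed simp

text \<open>In the last column the result sits on an input qubit or an EPR half and is exchanged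
  with the output qubit of the same node.\<close>

lemma swap_step:
  fixes G :: "'i \<Rightarrow> bool \<Rightarrow> (qlab \<Rightarrow> bool) \<Rightarrow> complex"
  assumes fin: "finite (qubits 2 N)" and v: "v \<in> cl_nodes 2 N"
    and q: "d \<in> node_qubits 2 N v" "o' \<in> node_qubits 2 N v" "d \<noteq> o'"
    and G: "\<And>i a x c. G i a (x(d := c)) = G i a x" "\<And>i a x c. G i a (x(o' := c)) = G i a x"
    and conv: "conv N (\<lambda>i x. G i (x o') x * of_bool (\<not> x d)) T"
  shows "conv N (\<lambda>i x. G i (x d) x * of_bool (\<not> x o')) T"
proof (rule conv_two_qubit_op[OF v fin q, of "[\<lambda>b c b' c'. of_bool (c = b' \<and> b = c')]"])
  show "two_qubit_complete [\<lambda>b c b' c'. of_bool (c = b' \<and> b = c')]" unfolding two_qubit_complete_def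
      sum_bool by (simp add: all_bool_eq)
  fix M assume "M \<in> set [\<lambda>(b::bool) (c::bool) b' c'. of_bool (c = b' \<and> b = c') :: complex]"
  then have M: "M = (\<lambda>b c b' c'. of_bool (c = b' \<and> b = c') :: complex)" by simp
  show "conv N (\<lambda>i x. complex_of_real (sqrt (length [\<lambda>(b::bool) (c::bool) b' c'. of_bool (c = b' \<and> b = c')
      :: complex])) *
      (\<Sum>b\<in>UNIV. \<Sum>c\<in>UNIV. M (x d) (x o') b c * (G i ((x(d := b, o' := c)) d) (x(d := b, o' := c)) * of_bool
          (\<not> (x(d := b, o' := c)) o')))) T"
    by (rule conv_cong[OF conv]) (unfold sum_bool, use q(3) in \<open>auto simp: M G\<close>)
qed simp

text \<open>With every discarded qubit equal to 0 the partial trace reduces to the term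
  \<open>c = (\<lambda>_. False)\<close>, and the empty protocol suffices.\<close>

lemma conv_final:
  assumes fin: "finite (qubits 2 N)"
    and F: "\<And>i x. x \<in> bst (qubits 2 N) \<Longrightarrow> F i x = T i (x (Outp 1)) (x (Outp 2)) * of_bool (\<forall>q\<in>qubits 2 N -
        out_qubits 2. \<not> x q)"
  shows "conv N F T"
  unfolding conv_def
proof (intro exI[of _ "[id_op]"] conjI allI ballI)
  show "locc 2 N [id_op]" by (rule locc_id)
  fix i a b assume ab: "a \<in> bst (out_qubits 2)" "b \<in> bst (out_qubits 2)"
  let ?S = "qubits 2 N" let ?O = "out_qubits 2"
  have OS: "?O \<subseteq> ?S" by (auto simp: out_qubits_def qubits_def)
  have o12: "Outp 1 \<in> ?O" "Outp 2 \<in> ?O" by (auto simp: out_qubits_def)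
  have id: "op_apply ?S id_op F x = F x" if "x \<in> bst ?S" for F x
    unfolding op_apply_def id_op_def using that finite_bst[OF fin] by (simp add: if_distrib[of "\<lambda>c. c * _"]
        cong: if_cong)
  have m: "merge 2 a c \<in> bst ?S" if "a \<in> bst ?O" "c \<in> bst (?S - ?O)" for a c
    using that OS by (auto simp: merge_def bst_def)
  have v: "F i (merge 2 a c) = (if c = (\<lambda>_. False) then T i (a (Outp 1)) (a (Outp 2)) else 0)" if "a \<in> bst
      ?O" "c \<in> bst (?S - ?O)" for a c
  proof -
    have "(\<forall>q\<in>?S - ?O. \<not> merge 2 a c q) \<longleftrightarrow> c = (\<lambda>_. False)"
      using that by (auto simp: merge_def bst_def fun_eq_iff)
    then show ?thesis unfolding F[OF m[OF that]] using o12 by (simp add: merge_def)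
  qed
  have "branch_sum 2 N [id_op] (F i) a b = (\<Sum>c\<in>bst (?S - ?O). if c = (\<lambda>_. False) then T i (a (Outp 1)) (a
      (Outp 2)) * cnj (T i (b (Outp 1)) (b (Outp 2))) else 0)"
    unfolding branch_sum_def using ab by (intro sum.cong refl) (simp add: id m v)
  also have "\<dots> = T i (a (Outp 1)) (a (Outp 2)) * cnj (T i (b (Outp 1)) (b (Outp 2)))"
    using finite_bst[of "?S - ?O"] fin by (simp add: bst_def)
  finally show "branch_sum 2 N [id_op] (F i) a b = T i (a (Outp 1)) (a (Outp 2)) * cnj (T i (b (Outp 1)) (b
      (Outp 2)))" .
qed

section \<open>Moving the data along the ladder\<close>

definition bit :: "bool \<Rightarrow> nat" where "bit a = (if a then 1 else 0)"

definition pair_index :: "bool \<Rightarrow> bool \<Rightarrow> nat" where "pair_index a b = 2 * bit a + bit b"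

definition amp_action :: "complex mat \<Rightarrow> (bool \<Rightarrow> bool \<Rightarrow> complex) \<Rightarrow> bool \<Rightarrow> bool \<Rightarrow> complex" where
  "amp_action U f a b = (\<Sum>a'\<in>UNIV. \<Sum>b'\<in>UNIV. U $$ (pair_index a b, pair_index a' b') * f a' b')"

lemma pair_index_less: "pair_index a b < 4" by (simp add: pair_index_def bit_def)

lemma amp_action_expand: "amp_action U f a b = U $$ (pair_index a b, 0) * f False False + U $$ (pair_index a
    b, 1) * f False True
    + U $$ (pair_index a b, 2) * f True False + U $$ (pair_index a b, 3) * f True True"
  by (simp add: amp_action_def sum_bool pair_index_def bit_def add.assoc)

lemma pair_index_simps: "pair_index False False = 0" "pair_index False True = 1" "pair_index True False = 2"
    "pair_index True True = 3"
  by (simp_all add: pair_index_def bit_def)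

lemma amp_action_mult: "A \<in> carrier_mat 4 4 \<Longrightarrow> B \<in> carrier_mat 4 4 \<Longrightarrow> amp_action (A * B) f = amp_action A
    (amp_action B f)"
  by (intro ext, unfold amp_action_expand[of A] amp_action_expand[of "A * B"])
    (simp add: mult_index4 pair_index_less amp_action_expand pair_index_simps algebra_simps del: index_mult_mat(1))

lemma amp_action_kron2: "amp_action (kron2 u u') f a b =
   (\<Sum>a'\<in>UNIV. u $$ (bit a, bit a') * (\<Sum>b'\<in>UNIV. u' $$ (bit b, bit b') * f a' b'))"
  by (cases a; cases b) (simp_all add: amp_action_expand sum_bool kron2_index pair_index_def bit_def algebra_simps)

lemma amp_action_canon_zz: "amp_action (canon_gate 0 0 t) f a b = ezz t a b * f a b"
  by (cases a; cases b) (simp_all add: amp_action_expand canon_index canon_entry_def pair_index_def bit_def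
      ezz_def)

lemma unitary_bool:
  assumes "is_unitary 2 u"
  shows "(\<Sum>a\<in>UNIV. cnj (u $$ (bit a, bit b)) * u $$ (bit a, bit c)) = (if b = c then 1 else 0)"
proof -
  have c: "u \<in> carrier_mat 2 2" using assms by (rule unitary_carrier)
  have d: "bit b < 2" "bit c < 2" by (auto simp: bit_def)
  have "(adjm u * u) $$ (bit b, bit c) = (\<Sum>a\<in>UNIV. cnj (u $$ (bit a, bit b)) * u $$ (bit a, bit c))"
    using c d by (simp add: mult_index2 sum_bool bit_def adjm_index carrier_matD[OF c] del: index_mult_mat(1))
  moreover have "(1\<^sub>m 2) $$ (bit b, bit c) = (if b = c then 1 else (0::complex))"
    by (cases b; cases c) (simp_all add: bit_def)
  ultimately show ?thesis using unitary_left[OF assms] by metis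
qed

text \<open>Teleportation leaves the data on the far half of a horizontal pair, so from the second
  column on the data qubit is the half shared with the column to the left.\<close>

definition data_qubit :: "nat \<Rightarrow> nat \<Rightarrow> qlab" where
  "data_qubit r j = (if j \<le> 1 then Inp r else Half (r, j) (r, j - 1))"
definition bridge_top :: "nat \<Rightarrow> qlab" where "bridge_top j = Half (1, j) (2, j)"
definition bridge_bottom :: "nat \<Rightarrow> qlab" where "bridge_bottom j = Half (2, j) (1, j)"
definition right_half :: "nat \<Rightarrow> nat \<Rightarrow> qlab" where "right_half r j = Half (r, j) (r, Suc j)"
definition left_half :: "nat \<Rightarrow> nat \<Rightarrow> qlab" where "left_half r j = Half (r, Suc j) (r, j)"

lemma data_qubit_Suc: "1 \<le> j \<Longrightarrow> data_qubit r (Suc j) = left_half r j" by (simp add: data_qubit_def left_half_def)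

lemma finite_qubits: "finite (qubits k N)"
proof -
  have n: "finite (cl_nodes k N)"
    by (rule finite_subset[of _ "{1..k} \<times> {1..N}"]) (auto simp: cl_nodes_def)
  have "qubits k N \<subseteq> Inp ` {1..k} \<union> Outp ` {1..k} \<union> (\<lambda>(v, w). Half v w) ` (cl_nodes k N \<times> cl_nodes k N)"
    by (auto simp: qubits_def cl_adj_def image_iff)
  then show ?thesis by (rule finite_subset) (use n in auto)
qed

lemma cl_adj_2: "cl_adj 2 N v w \<longleftrightarrow>
   (\<exists>i. 1 \<le> i \<and> i \<le> N \<and> (v = (1,i) \<and> w = (2,i) \<or> v = (2,i) \<and> w = (1,i))) \<or>
   (\<exists>i r. (r = 1 \<or> r = 2) \<and> 1 \<le> i \<and> i < N \<and> (v = (r,i) \<and> w = (r,Suc i) \<or> v = (r,Suc i) \<and> w = (r,i)))"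
  (is "_ \<longleftrightarrow> ?R")
proof
  obtain a b c d where vw: "v = (a,b)" "w = (c,d)" by (cases v; cases w)
  assume "cl_adj 2 N v w"
  then have h: "1 \<le> a" "a \<le> 2" "1 \<le> b" "b \<le> N" "1 \<le> c" "c \<le> 2" "1 \<le> d" "d \<le> N"
    "(a = c \<and> (d = b + 1 \<or> b = d + 1)) \<or> (b = d \<and> (c = a + 1 \<or> a = c + 1))"
    by (auto simp: cl_adj_def cl_nodes_def vw)
  then have ac: "a = 1 \<or> a = 2" "c = 1 \<or> c = 2" by auto
  from h(9) consider "a = c" "d = b + 1" | "a = c" "b = d + 1" | "b = d" "c = a + 1" | "b = d" "a = c + 1" by blast
  then show ?R
  proof cases
    case 1
    then have "(a = 1 \<or> a = 2) \<and> 1 \<le> b \<and> b < N \<and> (v = (a,b) \<and> w = (a,Suc b) \<or> v = (a,Suc b) \<and> w = (a,b))"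
      using h ac vw by simp
    then show ?thesis by blast
  next
    case 2
    then have "(a = 1 \<or> a = 2) \<and> 1 \<le> d \<and> d < N \<and> (v = (a,d) \<and> w = (a,Suc d) \<or> v = (a,Suc d) \<and> w = (a,d))"
      using h ac vw by simp
    then show ?thesis by blast
  next
    case 3
    then have "1 \<le> b \<and> b \<le> N \<and> (v = (1,b) \<and> w = (2,b) \<or> v = (2,b) \<and> w = (1,b))"
      using h ac vw by auto
    then show ?thesis by blast
  next
    case 4
    then have "1 \<le> b \<and> b \<le> N \<and> (v = (1,b) \<and> w = (2,b) \<or> v = (2,b) \<and> w = (1,b))"
      using h ac vw by auto
    then show ?thesis by blast
  qed
next
  assume ?R then show "cl_adj 2 N v w" by (auto simp: cl_adj_def cl_nodes_def)
qed

lemma qubits_2: "qubits 2 N = {Inp 1, Inp 2, Outp 1, Outp 2} \<union> (\<Union>i\<in>{1..N}. {bridge_top i, bridge_bottom i})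
   \<union> (\<Union>i\<in>{1..<N}. {right_half 1 i, right_half 2 i, left_half 1 i, left_half 2 i})" (is "?L = ?R")
proof
  have i12: "1 \<le> i \<and> i \<le> (2::nat) \<longleftrightarrow> i = 1 \<or> i = 2" for i by auto
  show "?L \<subseteq> ?R"
    unfolding qubits_def i12 cl_adj_2 by (auto simp: bridge_top_def bridge_bottom_def right_half_def left_half_def)
  have io: "Inp 1 \<in> ?L" "Inp 2 \<in> ?L" "Outp 1 \<in> ?L" "Outp 2 \<in> ?L"
    by (auto simp: qubits_def)
  have h: "Half v w \<in> ?L" if "cl_adj 2 N v w" for v w using that unfolding qubits_def by blast
  have v: "bridge_top i \<in> ?L" "bridge_bottom i \<in> ?L" if "i \<in> {1..N}" for i
    unfolding bridge_top_def bridge_bottom_def by (rule h; use that in \<open>auto simp: cl_adj_2\<close>)+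
  have r: "right_half r i \<in> ?L" "left_half r i \<in> ?L" if "i \<in> {1..<N}" "r = 1 \<or> r = 2" for i r
    unfolding right_half_def left_half_def by (rule h; use that in \<open>auto simp: cl_adj_2\<close>)+
  show "?R \<subseteq> ?L" using io v r by blast
qed

lemma node_members:
  assumes "1 \<le> j" "j \<le> N" "r = 1 \<or> r = 2"
  shows "(r, j) \<in> cl_nodes 2 N" "data_qubit r j \<in> node_qubits 2 N (r, j)"
    "bridge_top j \<in> node_qubits 2 N (1, j)" "bridge_bottom j \<in> node_qubits 2 N (2, j)"
    "j < N \<Longrightarrow> right_half r j \<in> node_qubits 2 N (r, j)"
    "j < N \<Longrightarrow> left_half r j \<in> node_qubits 2 N (r, Suc j)"
    "Outp r \<in> node_qubits 2 N (r, N)"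
proof -
  show "(r, j) \<in> cl_nodes 2 N" using assms by (auto simp: cl_nodes_def)
  show "bridge_top j \<in> node_qubits 2 N (1, j)" "bridge_bottom j \<in> node_qubits 2 N (2, j)"
    using assms by (auto simp: node_qubits_def qubits_2 bridge_top_def bridge_bottom_def)
  show "j < N \<Longrightarrow> right_half r j \<in> node_qubits 2 N (r, j)" "j < N \<Longrightarrow> left_half r j \<in> node_qubits 2 N (r, Suc j)"
    using assms by (auto simp: node_qubits_def qubits_2 right_half_def left_half_def)
  show "Outp r \<in> node_qubits 2 N (r, N)" using assms by (auto simp: node_qubits_def qubits_2)
  show "data_qubit r j \<in> node_qubits 2 N (r, j)"
  proof (cases "j = 1")
    case True then show ?thesis using assms by (auto simp: node_qubits_def qubits_2 data_qubit_def)
  next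
    case False
    then obtain i where i: "j = Suc i" "1 \<le> i" using assms by (cases j) auto
    then show ?thesis unfolding i(1) data_qubit_Suc[OF i(2)] using assms i by (auto simp: node_qubits_def
        qubits_2 left_half_def)
  qed
qed

section \<open>The state when the data has reached a given column\<close>

definition pair_qubits :: "nat \<Rightarrow> nat \<Rightarrow> qlab set" where
  "pair_qubits N j = (\<Union>i\<in>{j..N}. {bridge_top i, bridge_bottom i}) \<union> (\<Union>i\<in>{j..<N}. {right_half 1 i, right_half
      2 i, left_half 1 i, left_half 2 i})"

definition live :: "nat \<Rightarrow> nat \<Rightarrow> qlab set" where
  "live N j = {data_qubit 1 j, data_qubit 2 j} \<union> pair_qubits N j"

definition pairs :: "nat \<Rightarrow> nat \<Rightarrow> (qlab \<Rightarrow> bool) \<Rightarrow> bool" where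
  "pairs N j x \<longleftrightarrow> (\<forall>i\<in>{j..N}. x (bridge_top i) = x (bridge_bottom i)) \<and>
     (\<forall>i\<in>{j..<N}. x (right_half 1 i) = x (left_half 1 i) \<and> x (right_half 2 i) = x (left_half 2 i))"

definition zero_on :: "qlab set \<Rightarrow> (qlab \<Rightarrow> bool) \<Rightarrow> bool" where
  "zero_on A x \<longleftrightarrow> (\<forall>q\<in>A. \<not> x q)"

text \<open>The global state when the data has reached column \<open>j\<close>: the EPR pairs from column \<open>j\<close> on are
  intact and every qubit measured before has been reset.\<close>
definition column_state :: "nat \<Rightarrow> nat \<Rightarrow> (bool \<Rightarrow> bool \<Rightarrow> complex) \<Rightarrow> (qlab \<Rightarrow> bool) \<Rightarrow> complex" where
  "column_state N j f x = inv_sqrt2 ^ (3 * (N - j) + 1) * f (x (data_qubit 1 j)) (x (data_qubit 2 j)) *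
     of_bool (pairs N j x \<and> zero_on (qubits 2 N - live N j) x)"

lemma pairs_upd: "q \<notin> pair_qubits N j \<Longrightarrow> pairs N j (x(q := c)) = pairs N j x"
proof -
  assume q: "q \<notin> pair_qubits N j"
  have "bridge_top i \<noteq> q" "bridge_bottom i \<noteq> q" if "i \<in> {j..N}" for i using that q by (auto simp: pair_qubits_def)
  moreover have "right_half 1 i \<noteq> q" "left_half 1 i \<noteq> q" "right_half 2 i \<noteq> q" "left_half 2 i \<noteq> q" if "i \<in>
      {j..<N}" for i
    using that q unfolding pair_qubits_def by blast+
  ultimately show ?thesis unfolding pairs_def by (intro conj_cong ball_cong refl) simp_all
qed

lemma zero_on_upd: "q \<notin> A \<Longrightarrow> zero_on A (x(q := c)) = zero_on A x"
  by (auto simp: zero_on_def)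

lemma zero_on_insert: "zero_on (insert q A) x \<longleftrightarrow> \<not> x q \<and> zero_on A x"
  by (auto simp: zero_on_def)

lemma diff_split: "X \<subseteq> Q \<Longrightarrow> X \<inter> Y = {} \<Longrightarrow> Q - Y = X \<union> (Q - (X \<union> Y))"
  by blast

lemma qlab_simps [simp]:
  "data_qubit r j \<noteq> bridge_top i" "bridge_top i \<noteq> data_qubit r j" "data_qubit r j \<noteq> bridge_bottom i"
      "bridge_bottom i \<noteq> data_qubit r j" "data_qubit r j \<noteq> right_half s i" "right_half s i \<noteq> data_qubit r j"
  "data_qubit r j \<noteq> Outp s" "Outp s \<noteq> data_qubit r j" "data_qubit r j = data_qubit s j \<longleftrightarrow> r = s"
  "bridge_top i \<noteq> bridge_bottom k" "bridge_bottom k \<noteq> bridge_top i" "bridge_top i \<noteq> right_half r k"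
      "right_half r k \<noteq> bridge_top i" "bridge_top i \<noteq> left_half r k" "left_half r k \<noteq> bridge_top i"
  "bridge_bottom i \<noteq> right_half r k" "right_half r k \<noteq> bridge_bottom i" "bridge_bottom i \<noteq> left_half r k"
      "left_half r k \<noteq> bridge_bottom i" "right_half r i \<noteq> left_half s k" "left_half s k \<noteq> right_half r i"
  "bridge_top i \<noteq> Outp s" "Outp s \<noteq> bridge_top i" "bridge_bottom i \<noteq> Outp s" "Outp s \<noteq> bridge_bottom i"
  "right_half r i = right_half s k \<longleftrightarrow> r = s \<and> i = k" "left_half r i = left_half s k \<longleftrightarrow> r = s \<and> i = k"
  by (auto simp: data_qubit_def bridge_top_def bridge_bottom_def right_half_def left_half_def)

text \<open>The data qubit of column \<open>i + 1\<close> is the \<open>left_half\<close> belonging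
  to \<open>i\<close>; the bound \<open>j \<le> i\<close> excludes this coincidence.\<close>

lemma data_qubit_lq [simp]: "j \<le> i \<Longrightarrow> data_qubit r j \<noteq> left_half s i" "j \<le> i \<Longrightarrow> left_half s i \<noteq> data_qubit r j"
  by (auto simp: data_qubit_def left_half_def)

lemma pair_qubits_Suc: "j < N \<Longrightarrow> pair_qubits N j = {bridge_top j, bridge_bottom j, right_half 1 j, right_half
    2 j, left_half 1 j, left_half 2 j} \<union> pair_qubits N (Suc j)"
proof -
  assume "j < N"
  then have "{j..N} = insert j {Suc j..N}" "{j..<N} = insert j {Suc j..<N}" by auto
  then show ?thesis by (auto simp: pair_qubits_def)
qed

lemma pairs_Suc: "j < N \<Longrightarrow> pairs N j x \<longleftrightarrow> x (bridge_top j) = x (bridge_bottom j) \<and> x (right_half 1 j) = x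
    (left_half 1 j) \<and> x (right_half 2 j) = x (left_half 2 j)
     \<and> pairs N (Suc j) x"
proof -
  assume "j < N"
  then have "{j..N} = insert j {Suc j..N}" "{j..<N} = insert j {Suc j..<N}" by auto
  then show ?thesis by (auto simp: pairs_def)
qed

lemma fresh:
  assumes "1 \<le> j" "r = 1 \<or> r = 2"
  shows "data_qubit r j \<notin> pair_qubits N (Suc j)" "bridge_top j \<notin> pair_qubits N (Suc j)" "bridge_bottom j \<notin>
      pair_qubits N (Suc j)" "right_half r j \<notin> pair_qubits N (Suc j)" "left_half r j \<notin> pair_qubits N (Suc j)"
  using assms by (auto simp: pair_qubits_def data_qubit_def bridge_top_def bridge_bottom_def right_half_def
      left_half_def)

lemma local_step:
  fixes f :: "'i \<Rightarrow> bool \<Rightarrow> bool \<Rightarrow> complex"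
  assumes j: "1 \<le> j" "j \<le> N" and u: "is_unitary 2 u" "is_unitary 2 u'"
    and K: "\<And>x c. K (x(data_qubit 1 j := c)) = K x" "\<And>x c. K (x(data_qubit 2 j := c)) = K x"
    and conv: "conv N (\<lambda>i x. amp_action (kron2 u u') (f i) (x (data_qubit 1 j)) (x (data_qubit 2 j)) * K x) T"
  shows "conv N (\<lambda>i x. f i (x (data_qubit 1 j)) (x (data_qubit 2 j)) * K x) T"
proof (rule unitary_step[OF finite_qubits node_members(1)[OF j, of 1] node_members(2)[OF j, of 1]
    node_members(3)[OF j, of 1]
      qlab_simps(1) unitary_bool[OF u(1)], where G = "\<lambda>i a x. f i a (x (data_qubit 2 j)) * K x"])
  show "conv N (\<lambda>i x. \<Sum>b\<in>UNIV. u $$ (bit (x (data_qubit 1 j)), bit b) * (f i b (x (data_qubit 2 j)) * K x)) T"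
  proof (rule unitary_step[OF finite_qubits node_members(1)[OF j, of 2] node_members(2)[OF j, of 2]
      node_members(4)[OF j, of 2]
      qlab_simps(3) unitary_bool[OF u(2)], where G = "\<lambda>i b x. \<Sum>a\<in>UNIV. u $$ (bit (x (data_qubit 1 j)), bit
          a) * (f i a b * K x)"])
    show "conv N (\<lambda>i x. \<Sum>b\<in>UNIV. u' $$ (bit (x (data_qubit 2 j)), bit b) * (\<Sum>a\<in>UNIV. u $$ (bit (x
        (data_qubit 1 j)), bit a) * (f i a b * K x))) T"
      by (rule conv_cong[OF conv]) (simp add: amp_action_kron2 sum_bool algebra_simps)
  qed (unfold K, simp_all)
qed (unfold K, simp_all)

lemma bridge_step:
  fixes f :: "'i \<Rightarrow> bool \<Rightarrow> bool \<Rightarrow> complex"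
  assumes j: "1 \<le> j" "j \<le> N" and u: "is_unitary 2 w" "is_unitary 2 w'"
    and K: "\<And>x c. K (x(data_qubit 1 j := c)) = K x" "\<And>x c. K (x(data_qubit 2 j := c)) = K x"
      "\<And>x c. K (x(bridge_top j := c)) = K x" "\<And>x c. K (x(bridge_bottom j := c)) = K x"
    and conv: "conv N (\<lambda>i x. amp_action (canon_gate 0 0 t) (amp_action (kron2 w w') (f i)) (x (data_qubit 1
        j)) (x (data_qubit 2 j)) * K x * of_bool (\<not> x (bridge_top j) \<and> \<not> x (bridge_bottom j))) T"
  shows "conv N (\<lambda>i x. inv_sqrt2 * f i (x (data_qubit 1 j)) (x (data_qubit 2 j)) * K x * of_bool (x
      (bridge_top j) = x (bridge_bottom j))) T"
proof -
  have 1: "conv N (\<lambda>i x. inv_sqrt2 * (amp_action (kron2 w w') (f i) (x (data_qubit 1 j)) (x (data_qubit 2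
      j)) * K x) * of_bool (x (bridge_top j) = x (bridge_bottom j))) T"
    by (rule gate_step[OF finite_qubits node_members(1)[OF j, of 1] node_members(1)[OF j, of 2]
       node_members(2)[OF j, of 1] node_members(3)[OF j, of 1] node_members(2)[OF j, of 2]
           node_members(4)[OF j, of 2],
       where G = "\<lambda>i a b x. amp_action (kron2 w w') (f i) a b * K x" and t = t])
      (unfold K, use conv in \<open>simp_all add: amp_action_canon_zz mult.assoc\<close>)
  have 2: "conv N (\<lambda>i x. f i (x (data_qubit 1 j)) (x (data_qubit 2 j)) * (inv_sqrt2 * K x * of_bool (x
      (bridge_top j) = x (bridge_bottom j)))) T"
  proof (rule local_step[OF j u])
    show "conv N (\<lambda>i x. amp_action (kron2 w w') (f i) (x (data_qubit 1 j)) (x (data_qubit 2 j)) * (inv_sqrt2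
        * K x * of_bool (x (bridge_top j) = x (bridge_bottom j)))) T"
      by (rule conv_cong[OF 1]) simp
  qed (unfold K, simp_all)
  then show ?thesis by (simp add: mult_ac)
qed

text \<open>In time order: local gates and interaction on the bridge of column \<open>j\<close>,
  then teleportation of row 1 and of row 2. The proof starts from the state at the next column and
  undoes these operations one by one, from \<open>c1\<close> to \<open>c4\<close>.\<close>

lemma column_step:
  assumes j: "1 \<le> j" "j < N" and w: "is_unitary 2 w" "is_unitary 2 w'"
    and conv: "conv N (column_state N (Suc j)) W"
  shows "conv N (column_state N j) (\<lambda>f. W (amp_action (canon_gate 0 0 t) (amp_action (kron2 w w') f)))"
proof -
  have jN: "j \<le> N" using j by simp
  have sj: "1 \<le> Suc j" "Suc j \<le> N" using j by auto
  define g where "g f = amp_action (canon_gate 0 0 t) (amp_action (kron2 w w') f)" for f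
  define Z where "Z = qubits 2 N - live N j"
  \<comment> \<open>The part of the state that the operations at column \<open>j\<close> do not
    touch. The bridge and the two horizontal pairs at \<open>j\<close> account for the three factors
    \<open>inv_sqrt2\<close> missing from it.\<close>
  define B where "B x = inv_sqrt2 ^ (3 * (N - Suc j) + 1) * of_bool (pairs N (Suc j) x \<and> zero_on Z x)" for x
  have six: "{data_qubit 1 j, data_qubit 2 j, bridge_top j, bridge_bottom j, right_half 1 j, right_half 2 j}
      \<subseteq> qubits 2 N"
    using node_members(2-5)[OF j(1) jN, of 1] node_members(2-5)[OF j(1) jN, of 2] j(2) by (auto simp:
        node_qubits_def)
  have live: "live N j = {data_qubit 1 j, data_qubit 2 j, bridge_top j, bridge_bottom j, right_half 1 j,
      right_half 2 j} \<union> live N (Suc j)"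
    using pair_qubits_Suc[OF j(2)] data_qubit_Suc[OF j(1)] by (auto simp: live_def)
  have disj: "{data_qubit 1 j, data_qubit 2 j, bridge_top j, bridge_bottom j, right_half 1 j, right_half 2
      j} \<inter> live N (Suc j) = {}"
    using fresh[OF j(1), of 1 N] fresh[OF j(1), of 2 N] data_qubit_Suc[OF j(1)] by (auto simp: live_def)
  \<comment> \<open>Passing to the next column retires six qubits: data, bridge half and right half
    in each row. The left halves remain live as the new data.\<close>
  have ZS: "qubits 2 N - live N (Suc j) = insert (data_qubit 1 j) (insert (data_qubit 2 j) (insert
      (bridge_top j) (insert (bridge_bottom j) (insert (right_half 1 j) (insert (right_half 2 j) Z)))))"
    using diff_split[OF six disj] live unfolding Z_def by simp
  have inlive: "data_qubit 1 j \<notin> Z" "data_qubit 2 j \<notin> Z" "bridge_top j \<notin> Z" "bridge_bottom j \<notin> Z"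
      "right_half 1 j \<notin> Z" "right_half 2 j \<notin> Z" "left_half 1 j \<notin> Z" "left_half 2 j \<notin> Z"
    using live pair_qubits_Suc[OF j(2)] by (auto simp: Z_def live_def)
  have Bi: "B (x(p := c)) = B x" if "p \<in> {data_qubit 1 j, data_qubit 2 j, bridge_top j, bridge_bottom j,
      right_half 1 j, right_half 2 j, left_half 1 j, left_half 2 j}" for x p c
  proof -
    have "p \<notin> pair_qubits N (Suc j)" using that fresh[OF j(1), of 1 N] fresh[OF j(1), of 2 N] by auto
    moreover have "p \<notin> Z" using that inlive by auto
    ultimately show ?thesis by (simp add: B_def pairs_upd zero_on_upd)
  qed
  have Bu: "B (x(data_qubit 1 j := c)) = B x" "B (x(data_qubit 2 j := c)) = B x" "B (x(bridge_top j := c)) =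
      B x" "B (x(bridge_bottom j := c)) = B x" for x c
    by (rule Bi; simp)+
  have e1: "column_state N (Suc j) f x = f (x (left_half 1 j)) (x (left_half 2 j)) * of_bool (\<not> x
      (data_qubit 1 j) \<and> \<not> x (right_half 1 j)) *
     of_bool (\<not> x (bridge_top j) \<and> \<not> x (bridge_bottom j)) * B x * of_bool (\<not> x (data_qubit 2 j) \<and> \<not> x
         (right_half 2 j))" for f x
    unfolding column_state_def ZS zero_on_insert data_qubit_Suc[OF j(1)] B_def by auto
  have c1: "conv N (\<lambda>f x. g f (x (left_half 1 j)) (x (left_half 2 j)) * of_bool (\<not> x (data_qubit 1 j) \<and> \<not> x
      (right_half 1 j)) *
     of_bool (\<not> x (bridge_top j) \<and> \<not> x (bridge_bottom j)) * B x * of_bool (\<not> x (data_qubit 2 j) \<and> \<not> x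
         (right_half 2 j))) (\<lambda>f. W (g f))"
    using conv_reindex[OF conv, of g] unfolding e1 .
  have c2: "conv N (\<lambda>f x. inv_sqrt2 * (g f (x (left_half 1 j)) (x (data_qubit 2 j)) * of_bool (\<not> x
      (data_qubit 1 j) \<and> \<not> x (right_half 1 j)) *
     of_bool (\<not> x (bridge_top j) \<and> \<not> x (bridge_bottom j)) * B x) * of_bool (x (right_half 2 j) = x
         (left_half 2 j))) (\<lambda>f. W (g f))"
    by (rule teleport_step[OF finite_qubits node_members(1)[OF j(1) jN, of 2] node_members(1)[OF sj, of 2]
        node_members(2)[OF j(1) jN, of 2] node_members(5)[OF j(1) jN, of 2] node_members(6)[OF j(1) jN, of
            2] node_members(4)[OF sj, of 2],
        where G = "\<lambda>f b x. g f (x (left_half 1 j)) b * of_bool (\<not> x (data_qubit 1 j) \<and> \<not> x (right_half 1 j))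
            * of_bool (\<not> x (bridge_top j) \<and> \<not> x (bridge_bottom j)) * B x"])
      (use c1 j in \<open>simp_all add: Bi\<close>)
  have c3: "conv N (\<lambda>f x. inv_sqrt2 * (inv_sqrt2 * g f (x (data_qubit 1 j)) (x (data_qubit 2 j)) * of_bool
      (x (right_half 2 j) = x (left_half 2 j)) *
     of_bool (\<not> x (bridge_top j) \<and> \<not> x (bridge_bottom j)) * B x) * of_bool (x (right_half 1 j) = x
         (left_half 1 j))) (\<lambda>f. W (g f))"
  proof (rule teleport_step[OF finite_qubits node_members(1)[OF j(1) jN, of 1] node_members(1)[OF sj, of 1]
        node_members(2)[OF j(1) jN, of 1] node_members(5)[OF j(1) jN, of 1] node_members(6)[OF j(1) jN, of
            1] node_members(3)[OF sj, of 1],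
        where G = "\<lambda>f a x. inv_sqrt2 * g f a (x (data_qubit 2 j)) * of_bool (x (right_half 2 j) = x
            (left_half 2 j)) * of_bool (\<not> x (bridge_top j) \<and> \<not> x (bridge_bottom j)) * B x"])
    show "conv N (\<lambda>f x. inv_sqrt2 * g f (x (left_half 1 j)) (x (data_qubit 2 j)) * of_bool (x (right_half 2
        j) = x (left_half 2 j)) * of_bool (\<not> x (bridge_top j) \<and> \<not> x (bridge_bottom j)) * B x *
       of_bool (\<not> x (data_qubit 1 j) \<and> \<not> x (right_half 1 j))) (\<lambda>f. W (g f))"
      by (rule conv_cong[OF c2]) (simp add: mult_ac)
  qed (use j in \<open>simp_all add: Bi\<close>)
  have c4: "conv N (\<lambda>f x. inv_sqrt2 * f (x (data_qubit 1 j)) (x (data_qubit 2 j)) * (inv_sqrt2 * inv_sqrt2 *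
      of_bool (x (right_half 1 j) = x (left_half 1 j)) * of_bool (x (right_half 2 j) = x (left_half 2 j)) * B x)
      * of_bool (x (bridge_top j) = x (bridge_bottom j))) (\<lambda>f. W (g f))"
  proof (rule bridge_step[OF j(1) jN w, where t = t])
    show "conv N (\<lambda>f x. amp_action (canon_gate 0 0 t) (amp_action (kron2 w w') f) (x (data_qubit 1 j)) (x
        (data_qubit 2 j)) *
       (inv_sqrt2 * inv_sqrt2 * of_bool (x (right_half 1 j) = x (left_half 1 j)) * of_bool (x (right_half 2
           j) = x (left_half 2 j)) * B x) * of_bool (\<not> x (bridge_top j) \<and> \<not> x (bridge_bottom j))) (\<lambda>f. W (g f))"
      by (rule conv_cong[OF c3]) (simp add: g_def mult_ac)
  qed (unfold Bu, simp_all)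
  have pw: "inv_sqrt2 ^ (3 * (N - j)) = inv_sqrt2 * inv_sqrt2 * inv_sqrt2 * inv_sqrt2 ^ (3 * (N - Suc j))"
  proof -
    have "3 * (N - j) = 3 + 3 * (N - Suc j)" using j by simp
    then show ?thesis by (simp only: power_add power3_eq_cube)
  qed
  show ?thesis unfolding g_def[symmetric]
    by (rule conv_cong[OF c4]) (auto simp: column_state_def pairs_Suc[OF j(2)] B_def Z_def[symmetric] pw)
qed

text \<open>There is no next column to teleport to. After the last interaction a closing layer of
  local gates is applied, and the data is swapped into the output qubits.\<close>

lemma last_column:
  assumes N: "1 \<le> N" and w: "is_unitary 2 w" "is_unitary 2 w'" and u: "is_unitary 2 u" "is_unitary 2 u'"
  shows "conv N (column_state N N) (\<lambda>f. amp_action (kron2 u u') (amp_action (canon_gate 0 0 t) (amp_action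
      (kron2 w w') f)))"
proof -
  define g where "g f = amp_action (canon_gate 0 0 t) (amp_action (kron2 w w') f)" for f
  define h where "h f = amp_action (kron2 u u') (g f)" for f
  define Z where "Z = qubits 2 N - {Outp 1, Outp 2, data_qubit 1 N, data_qubit 2 N, bridge_top N, bridge_bottom N}"
  have mem: "{Outp 1, Outp 2, data_qubit 1 N, data_qubit 2 N, bridge_top N, bridge_bottom N} \<subseteq> qubits 2 N"
    using node_members(2-4,7)[OF N order_refl, of 1] node_members(2-4,7)[OF N order_refl, of 2] by (auto
        simp: node_qubits_def)
  have out: "out_qubits 2 = {Outp 1, Outp 2}"
  proof -
    have i12: "1 \<le> i \<and> i \<le> (2::nat) \<longleftrightarrow> i = 1 \<or> i = 2" for i by auto
    show ?thesis unfolding out_qubits_def i12 by auto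
  qed
  have ZO: "qubits 2 N - out_qubits 2 = insert (data_qubit 1 N) (insert (data_qubit 2 N) (insert (bridge_top
      N) (insert (bridge_bottom N) Z)))"
    using diff_split[of "{data_qubit 1 N, data_qubit 2 N, bridge_top N, bridge_bottom N}" "qubits 2 N"
        "{Outp 1, Outp 2}"] mem
    by (simp add: Z_def out insert_commute)
  have Zu: "zero_on Z (x(p := c)) = zero_on Z x" if "p \<in> {Outp 1, Outp 2, data_qubit 1 N, data_qubit 2 N,
      bridge_top N, bridge_bottom N}" for x p c
    by (rule zero_on_upd) (use that in \<open>auto simp: Z_def\<close>)
  have c1: "conv N (\<lambda>f x. h f (x (Outp 1)) (x (Outp 2)) * of_bool (\<not> x (data_qubit 1 N) \<and> \<not> x (bridge_top N)
      \<and> \<not> x (bridge_bottom N) \<and> zero_on Z x) * of_bool (\<not> x (data_qubit 2 N))) h"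
  proof (rule conv_final[OF finite_qubits])
    fix f x
    have "(\<forall>q\<in>qubits 2 N - out_qubits 2. \<not> x q) \<longleftrightarrow> \<not> x (data_qubit 1 N) \<and> \<not> x (data_qubit 2 N) \<and> \<not> x
        (bridge_top N) \<and> \<not> x (bridge_bottom N) \<and> zero_on Z x"
      unfolding ZO by (auto simp: zero_on_def)
    then show "h f (x (Outp 1)) (x (Outp 2)) * of_bool (\<not> x (data_qubit 1 N) \<and> \<not> x (bridge_top N) \<and> \<not> x
        (bridge_bottom N) \<and> zero_on Z x) * of_bool (\<not> x (data_qubit 2 N))
      = h f (x (Outp 1)) (x (Outp 2)) * of_bool (\<forall>q\<in>qubits 2 N - out_qubits 2. \<not> x q)"
      by auto
  qed
  have c2: "conv N (\<lambda>f x. h f (x (Outp 1)) (x (data_qubit 2 N)) * of_bool (\<not> x (data_qubit 1 N) \<and> \<not> x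
      (bridge_top N) \<and> \<not> x (bridge_bottom N) \<and> zero_on Z x) * of_bool (\<not> x (Outp 2))) h"
    by (rule swap_step[OF finite_qubits node_members(1)[OF N order_refl, of 2] node_members(2)[OF N
        order_refl, of 2] node_members(7)[OF N order_refl, of 2],
      where G = "\<lambda>f b x. h f (x (Outp 1)) b * of_bool (\<not> x (data_qubit 1 N) \<and> \<not> x (bridge_top N) \<and> \<not> x
          (bridge_bottom N) \<and> zero_on Z x)"])
      (use c1 in \<open>simp_all add: Zu\<close>)
  have c3: "conv N (\<lambda>f x. h f (x (data_qubit 1 N)) (x (data_qubit 2 N)) * of_bool (\<not> x (Outp 2) \<and> \<not> x
      (bridge_top N) \<and> \<not> x (bridge_bottom N) \<and> zero_on Z x) * of_bool (\<not> x (Outp 1))) h"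
  proof (rule swap_step[OF finite_qubits node_members(1)[OF N order_refl, of 1] node_members(2)[OF N
      order_refl, of 1] node_members(7)[OF N order_refl, of 1],
      where G = "\<lambda>f a x. h f a (x (data_qubit 2 N)) * of_bool (\<not> x (Outp 2) \<and> \<not> x (bridge_top N) \<and> \<not> x
          (bridge_bottom N) \<and> zero_on Z x)"])
    show "conv N (\<lambda>f x. h f (x (Outp 1)) (x (data_qubit 2 N)) * of_bool (\<not> x (Outp 2) \<and> \<not> x (bridge_top N) \<and>
        \<not> x (bridge_bottom N) \<and> zero_on Z x) * of_bool (\<not> x (data_qubit 1 N))) h"
      by (rule conv_cong[OF c2]) auto
  qed (simp_all add: Zu)
  define K where "K x = (of_bool (\<not> x (Outp 1) \<and> \<not> x (Outp 2) \<and> zero_on Z x) :: complex)" for x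
  have Ku: "K (x(data_qubit 1 N := c)) = K x" "K (x(data_qubit 2 N := c)) = K x" "K (x(bridge_top N := c)) =
      K x" "K (x(bridge_bottom N := c)) = K x" for x c
    by (simp_all add: K_def Zu)
  have c4: "conv N (\<lambda>f x. g f (x (data_qubit 1 N)) (x (data_qubit 2 N)) * (K x * of_bool (\<not> x (bridge_top N)
      \<and> \<not> x (bridge_bottom N)))) h"
  proof (rule local_step[OF N order_refl u])
    show "conv N (\<lambda>f x. amp_action (kron2 u u') (g f) (x (data_qubit 1 N)) (x (data_qubit 2 N)) * (K x *
        of_bool (\<not> x (bridge_top N) \<and> \<not> x (bridge_bottom N)))) h"
      by (rule conv_cong[OF c3]) (auto simp: h_def K_def)
  qed (unfold Ku, simp_all)
  have c5: "conv N (\<lambda>f x. inv_sqrt2 * f (x (data_qubit 1 N)) (x (data_qubit 2 N)) * K x * of_bool (x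
      (bridge_top N) = x (bridge_bottom N))) h"
    by (rule bridge_step[OF N order_refl w, where t = t]) (unfold Ku, use c4 in \<open>simp_all add: g_def mult.assoc\<close>)
  have live: "qubits 2 N - live N N = insert (Outp 1) (insert (Outp 2) Z)"
    using diff_split[of "{Outp 1, Outp 2}" "qubits 2 N" "{data_qubit 1 N, data_qubit 2 N, bridge_top N,
        bridge_bottom N}"] mem
    by (simp add: Z_def live_def pair_qubits_def insert_commute)
  have pr: "pairs N N x \<longleftrightarrow> x (bridge_top N) = x (bridge_bottom N)" for x by (auto simp: pairs_def)
  show ?thesis unfolding g_def[symmetric] h_def[symmetric]
    by (rule conv_cong[OF c5]) (auto simp: column_state_def live pr K_def zero_on_insert)
qed

section \<open>Circuits with one interaction per bridge\<close>

inductive bridge_circuit :: "nat \<Rightarrow> complex mat \<Rightarrow> bool" where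
  one: "is_unitary 2 u \<Longrightarrow> is_unitary 2 u' \<Longrightarrow> is_unitary 2 w \<Longrightarrow> is_unitary 2 w' \<Longrightarrow>
    bridge_circuit 1 (kron2 u u' * (canon_gate 0 0 t * kron2 w w'))"
| step: "bridge_circuit n V \<Longrightarrow> is_unitary 2 w \<Longrightarrow> is_unitary 2 w' \<Longrightarrow>
    bridge_circuit (Suc n) (V * (canon_gate 0 0 t * kron2 w w'))"

lemma bridge_circuit_carrier: "bridge_circuit n V \<Longrightarrow> V \<in> carrier_mat 4 4 \<and> 1 \<le> n"
  by (induction rule: bridge_circuit.induct) auto

text \<open>A circuit with \<open>n\<close> interactions runs on the last \<open>n\<close> columns.
  Factors are added on the right, that is, earlier in time, so the induction moves from column
  \<open>N\<close> to the left.\<close>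

lemma bridge_circuit_conv:
  assumes "bridge_circuit n V" "n \<le> N"
  shows "conv N (column_state N (Suc N - n)) (amp_action V)"
  using assms
proof (induction rule: bridge_circuit.induct)
  case (one u u' w w' t)
  have e: "amp_action (kron2 u u' * (canon_gate 0 0 t * kron2 w w')) = (\<lambda>f. amp_action (kron2 u u')
      (amp_action (canon_gate 0 0 t) (amp_action (kron2 w w') f)))"
    by (intro ext) (simp add: amp_action_mult)
  show ?case unfolding e using last_column[OF _ one(3,4) one(1,2), of N t] one(5) by simp
next
  case (step n V w w' t)
  have c: "V \<in> carrier_mat 4 4" "1 \<le> n" using bridge_circuit_carrier[OF step(1)] by auto
  have e: "amp_action (V * (canon_gate 0 0 t * kron2 w w')) = (\<lambda>f. amp_action V (amp_action (canon_gate 0 0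
      t) (amp_action (kron2 w w') f)))"
    using c by (intro ext) (simp add: amp_action_mult)
  have j: "1 \<le> N - n" "N - n < N" "Suc (N - n) = Suc N - n" using step(5) c(2) by auto
  show ?case unfolding e using column_step[OF j(1,2) step(2,3), of "amp_action V" t] step(4,5) j(3) by simp
qed

text \<open>\<open>N\<close> bridges and \<open>N - 1\<close> horizontal pairs in each row; this
  matches the exponent in \<open>column_state\<close> at \<open>j = 1\<close>.\<close>

lemma card_edges: "1 \<le> N \<Longrightarrow> card (cl_edges 2 N) = 3 * (N - 1) + 1"
proof -
  assume N: "1 \<le> N"
  define f1 where "f1 = (\<lambda>i::nat. {(1::nat,i),(2,i)})"
  define f2 where "f2 = (\<lambda>i::nat. {(1::nat,i),(1,Suc i)})"
  define f3 where "f3 = (\<lambda>i::nat. {(2::nat,i),(2,Suc i)})"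
  have e: "cl_edges 2 N = f1 ` {1..N} \<union> (f2 ` {1..<N} \<union> f3 ` {1..<N})" (is "?L = ?R")
  proof
    show "?L \<subseteq> ?R"
      unfolding cl_edges_def cl_adj_2 f1_def f2_def f3_def by (auto simp: insert_commute)
    have h: "{v, w} \<in> ?L" if "cl_adj 2 N v w" for v w using that unfolding cl_edges_def by blast
    have "f1 i \<in> ?L" if "i \<in> {1..N}" for i unfolding f1_def by (rule h) (use that in \<open>auto simp: cl_adj_2\<close>)
    moreover have "f2 i \<in> ?L" "f3 i \<in> ?L" if "i \<in> {1..<N}" for i
      unfolding f2_def f3_def by (rule h; use that in \<open>auto simp: cl_adj_2\<close>)+
    ultimately show "?R \<subseteq> ?L" by blast
  qed
  have i: "inj f1" "inj f2" "inj f3"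
    by (auto simp: inj_def f1_def f2_def f3_def doubleton_eq_iff)
  have "card (cl_edges 2 N) = card (f1 ` {1..N}) + card (f2 ` {1..<N} \<union> f3 ` {1..<N})"
    unfolding e by (rule card_Un_disjoint) (auto simp: f1_def f2_def f3_def doubleton_eq_iff)
  also have "card (f2 ` {1..<N} \<union> f3 ` {1..<N}) = card (f2 ` {1..<N}) + card (f3 ` {1..<N})"
    by (rule card_Un_disjoint) (auto simp: f2_def f3_def doubleton_eq_iff)
  finally show ?thesis using i N by (simp add: card_image inj_on_subset)
qed

lemma index_eq: "in_index 2 x = pair_index (x (Inp 1)) (x (Inp 2))" "out_index 2 x = pair_index (x (Outp 1))
    (x (Outp 2))"
proof -
  have "{1..2} = {1, 2::nat}" by auto
  then show "in_index 2 x = pair_index (x (Inp 1)) (x (Inp 2))" "out_index 2 x = pair_index (x (Outp 1)) (x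
      (Outp 2))"
    by (auto simp: in_index_def out_index_def pair_index_def bit_def)
qed

lemma epr_pairs: "(\<forall>v w. cl_adj 2 N v w \<longrightarrow> x (Half v w) = x (Half w v)) \<longleftrightarrow> pairs N 1 x" (is "?L \<longleftrightarrow> ?R")
proof
  assume h: ?L
  have "x (Half v w) = x (Half w v)" if "cl_adj 2 N v w" for v w using h that by blast
  note this[unfolded cl_adj_2]
  then show ?R unfolding pairs_def bridge_top_def bridge_bottom_def right_half_def left_half_def
    by (intro conjI ballI) (simp_all, metis+)
next
  assume ?R then show ?L unfolding cl_adj_2 pairs_def bridge_top_def bridge_bottom_def right_half_def
      left_half_def by auto
qed

lemma init_amp_column:
  assumes N: "1 \<le> N" and x: "x \<in> bst (qubits 2 N)"
  shows "init_amp 2 N \<psi> x = column_state N 1 (\<lambda>a b. \<psi> $ pair_index a b) x"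
proof -
  have "live N 1 = {Inp 1, Inp 2} \<union> pair_qubits N 1" by (simp add: live_def data_qubit_def)
  then have "qubits 2 N - live N 1 = {Outp 1, Outp 2}"
    unfolding qubits_2 pair_qubits_def by (auto simp: bridge_top_def bridge_bottom_def right_half_def
        left_half_def)
  then have "zero_on (qubits 2 N - live N 1) x \<longleftrightarrow> \<not> x (Outp 1) \<and> \<not> x (Outp 2)" by (simp add: zero_on_def)
  moreover have "x (Outp i) \<Longrightarrow> i = 1 \<or> i = 2" for i
    using x unfolding bst_def qubits_2 by (auto simp: bridge_top_def bridge_bottom_def right_half_def
        left_half_def)
  ultimately have z: "(\<forall>i. \<not> x (Outp i)) \<longleftrightarrow> zero_on (qubits 2 N - live N 1) x" by auto
  show ?thesis
    unfolding init_amp_def column_state_def epr_amp_def z epr_pairs card_edges[OF N] index_eq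
    by (auto simp: data_qubit_def inv_sqrt2_def)
qed

lemma mult_vec_act:
  assumes "U \<in> carrier_mat 4 4" "\<psi> \<in> carrier_vec 4"
  shows "(U *\<^sub>v \<psi>) $ pair_index a b = amp_action U (\<lambda>a b. \<psi> $ pair_index a b) a b"
proof -
  have "(U *\<^sub>v \<psi>) $ pair_index a b = (\<Sum>k = 0..<4. U $$ (pair_index a b, k) * \<psi> $ k)"
    using assms pair_index_less[of a b] by (auto simp: scalar_prod_def)
  then show ?thesis unfolding sum_upto_4 amp_action_expand by (simp add: pair_index_def bit_def)
qed

lemma bridge_circuit_implementable:
  assumes N: "1 \<le> N" and U: "bridge_circuit N U"
  shows "det_implementable 2 N U"
proof -
  have cU: "U \<in> carrier_mat 4 4" using bridge_circuit_carrier[OF U] by simp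
  have "conv N (column_state N (Suc N - N)) (amp_action U)" by (rule bridge_circuit_conv[OF U order_refl])
  then have "conv N (column_state N 1) (amp_action U)" by simp
  then have "conv N (\<lambda>\<psi>. init_amp 2 N \<psi>) (\<lambda>\<psi>. amp_action U (\<lambda>a b. \<psi> $ pair_index a b))"
    using conv_cong[OF conv_reindex[of N "column_state N 1" "amp_action U" "\<lambda>\<psi> a b. \<psi> $ pair_index a b"], of
        "\<lambda>\<psi>. init_amp 2 N \<psi>"]
      init_amp_column[OF N] by metis
  then obtain Ks where Ks: "locc 2 N Ks" "\<And>\<psi> a b. a\<in>bst (out_qubits 2) \<Longrightarrow> b\<in>bst (out_qubits 2) \<Longrightarrow>
     branch_sum 2 N Ks (init_amp 2 N \<psi>) a b = amp_action U (\<lambda>a b. \<psi> $ pair_index a b) (a (Outp 1)) (a (Outp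
         2)) * cnj (amp_action U (\<lambda>a b. \<psi> $ pair_index a b) (b (Outp 1)) (b (Outp 2)))"
    unfolding conv_def by blast
  show ?thesis unfolding det_implementable_def
    by (intro exI[of _ Ks] conjI Ks(1)) (auto simp: init_state_def ptrace_pure Ks(2) index_eq mult_vec_act[OF cU])
qed

section \<open>Kraus operators of a protocol as tensor networks\<close>

text \<open>Communication lets the choice of local factors depend on earlier outcomes, but once all
  outcomes are fixed the operator is a tensor product over the nodes. \<open>B v\<close> is the
  factor at node \<open>v\<close>.\<close>

definition product_form :: "nat \<Rightarrow> op \<Rightarrow> bool" where
  "product_form N L \<longleftrightarrow> (\<exists>B :: nat \<times> nat \<Rightarrow> op. \<forall>x\<in>bst (qubits 2 N). \<forall>y\<in>bst (qubits 2 N).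
     L x y = (\<Prod>v\<in>cl_nodes 2 N. B v (restr x (node_qubits 2 N v)) (restr y (node_qubits 2 N v))))"

lemma finite_nodes: "finite (cl_nodes k N)"
  by (rule finite_subset[of _ "{1..k} \<times> {1..N}"]) (auto simp: cl_nodes_def)

lemma qloc_node:
  assumes "1 \<le> N" "q \<in> qubits 2 N"
  shows "qloc N q \<in> cl_nodes 2 N"
  using assms by (auto simp: qubits_def cl_adj_def cl_nodes_def)

lemma product_form_id:
  assumes N: "1 \<le> N"
  shows "product_form N id_op"
  unfolding product_form_def
proof (intro exI[of _ "\<lambda>v x y. of_bool (x = y)"] ballI)
  fix x y assume xy: "x \<in> bst (qubits 2 N)" "y \<in> bst (qubits 2 N)"
  have "x = y \<longleftrightarrow> (\<forall>v\<in>cl_nodes 2 N. restr x (node_qubits 2 N v) = restr y (node_qubits 2 N v))"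
  proof (intro iffI ballI)
    assume h: "\<forall>v\<in>cl_nodes 2 N. restr x (node_qubits 2 N v) = restr y (node_qubits 2 N v)"
    show "x = y"
    proof
      fix q
      show "x q = y q"
      proof (cases "q \<in> qubits 2 N")
        case True
        then have "restr x (node_qubits 2 N (qloc N q)) q = restr y (node_qubits 2 N (qloc N q)) q"
          using h qloc_node[OF N True] by simp
        then show ?thesis using True by (simp add: restr_def node_qubits_def)
      next
        case False
        then show ?thesis using xy by (simp add: bst_def)
      qed
    qed
  qed simp
  moreover have "(\<Prod>v\<in>A. of_bool (P v)) = (of_bool (\<forall>v\<in>A. P v) :: complex)" if "finite A" for A :: "(nat \<times>
      nat) set" and P
    using that by (induction A) auto
  ultimately show "id_op x y = (\<Prod>v\<in>cl_nodes 2 N. of_bool (restr x (node_qubits 2 N v) = restr y (node_qubits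
      2 N v)))"
    using finite_nodes[of 2 N] by (simp add: id_op_def)
qed

text \<open>\<open>K\<close> leaves the bits of all other nodes alone, so the intermediate sum runs
  over the bits at \<open>v\<close> only. The factor at \<open>v\<close> becomes the composite
  \<open>D\<close>; the others stay.\<close>

lemma product_form_mmul:
  assumes L: "product_form N L" and v: "v \<in> cl_nodes 2 N"
    and K: "local_on (qubits 2 N) (node_qubits 2 N v) K"
  shows "product_form N (mmul (qubits 2 N) L K)"
proof -
  let ?S = "qubits 2 N" let ?Q = "node_qubits 2 N"
  obtain B where B: "\<And>x y. x \<in> bst ?S \<Longrightarrow> y \<in> bst ?S \<Longrightarrow> L x y = (\<Prod>v\<in>cl_nodes 2 N. B v (restr x (?Q v)) (restr y
      (?Q v)))"
    using L unfolding product_form_def by blast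
  obtain C where C: "\<And>x y. x \<in> bst ?S \<Longrightarrow> y \<in> bst ?S \<Longrightarrow>
      K x y = (if \<forall>q\<in>?S - ?Q v. x q = y q then C (restr x (?Q v)) (restr y (?Q v)) else 0)"
    using K unfolding local_on_def by blast
  define D where "D a b = (\<Sum>c\<in>bst (?Q v). B v a c * C c b)" for a b
  have QS: "?Q v \<subseteq> ?S" by (auto simp: node_qubits_def)
  have "mmul ?S L K x y = (\<Prod>w\<in>cl_nodes 2 N. (B(v := D)) w (restr x (?Q w)) (restr y (?Q w)))"
    if x: "x \<in> bst ?S" and y: "y \<in> bst ?S" for x y
  proof -
    define R where "R = (\<Prod>w\<in>cl_nodes 2 N - {v}. B w (restr x (?Q w)) (restr y (?Q w)))"
    have Rv: "(\<Prod>w\<in>cl_nodes 2 N - {v}. (B(v := D)) w (restr x (?Q w)) (restr y (?Q w))) = R"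
      unfolding R_def by (intro prod.cong) auto
    define Z where "Z = {z \<in> bst ?S. \<forall>q\<in>?S - ?Q v. z q = y q}"
    have "mmul ?S L K x y = (\<Sum>z\<in>Z. L x z * K z y)"
      unfolding mmul_def Z_def using finite_bst[OF finite_qubits[of 2 N]] C[OF _ y]
      by (intro sum.mono_neutral_right) auto
    also have "\<dots> = (\<Sum>z\<in>Z. R * (B v (restr x (?Q v)) (restr z (?Q v)) * C (restr z (?Q v)) (restr y (?Q v))))"
    proof (rule sum.cong[OF refl])
      fix z assume z: "z \<in> Z"
      then have zS: "z \<in> bst ?S" and zy: "\<forall>q\<in>?S - ?Q v. z q = y q" by (auto simp: Z_def)
      have "restr z (?Q w) = restr y (?Q w)" if "w \<noteq> v" for w
        using zy that by (auto simp: restr_def node_qubits_def fun_eq_iff)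
      then have "(\<Prod>w\<in>cl_nodes 2 N - {v}. B w (restr x (?Q w)) (restr z (?Q w))) = R"
        unfolding R_def by (intro prod.cong) auto
      then have "L x z = B v (restr x (?Q v)) (restr z (?Q v)) * R"
        unfolding B[OF x zS] using prod.remove[OF finite_nodes v, of "\<lambda>w. B w (restr x (?Q w)) (restr z (?Q
            w))"] by simp
      then show "L x z * K z y = R * (B v (restr x (?Q v)) (restr z (?Q v)) * C (restr z (?Q v)) (restr y (?Q v)))"
        using C[OF zS y] zy by simp
    qed
    also have "\<dots> = R * (\<Sum>z\<in>Z. B v (restr x (?Q v)) (restr z (?Q v)) * C (restr z (?Q v)) (restr y (?Q v)))"
      by (simp add: sum_distrib_left)
    also have "(\<Sum>z\<in>Z. B v (restr x (?Q v)) (restr z (?Q v)) * C (restr z (?Q v)) (restr y (?Q v))) = D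
        (restr x (?Q v)) (restr y (?Q v))"
      unfolding D_def
    proof (rule sum.reindex_bij_witness[of _ "\<lambda>c q. if q \<in> ?Q v then c q else y q" "\<lambda>z. restr z (?Q v)"])
      fix z assume z: "z \<in> Z"
      then show "(\<lambda>q. if q \<in> ?Q v then restr z (?Q v) q else y q) = z"
        using y by (auto simp: Z_def restr_def bst_def fun_eq_iff)
      show "restr z (?Q v) \<in> bst (?Q v)" by (simp add: restr_def bst_def)
    next
      fix c assume c: "c \<in> bst (?Q v)"
      then show "restr (\<lambda>q. if q \<in> ?Q v then c q else y q) (?Q v) = c"
        by (auto simp: restr_def bst_def fun_eq_iff)
      show "(\<lambda>q. if q \<in> ?Q v then c q else y q) \<in> Z"
        using c y QS by (auto simp: Z_def bst_def)
    qed simp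
    also have "R * D (restr x (?Q v)) (restr y (?Q v)) = (\<Prod>w\<in>cl_nodes 2 N. (B(v := D)) w (restr x (?Q w))
        (restr y (?Q w)))"
      unfolding prod.remove[OF finite_nodes v] Rv by simp
    finally show ?thesis .
  qed
  then show ?thesis unfolding product_form_def by blast
qed

lemma locc_product_form:
  assumes N: "1 \<le> N" and "locc 2 N Ks"
  shows "\<forall>L\<in>set Ks. product_form N L"
  using assms(2)
proof (induction rule: locc.induct)
  case locc_id
  then show ?case using product_form_id[OF N] by simp
next
  case (locc_step v Ks Ps)
  then show ?case by (auto intro!: product_form_mmul)
qed

text \<open>With \<open>G t = adjm U * M t\<close> the family acts as the identity on pure states.
  Basis vectors as inputs annihilate all off-diagonal entries, superpositions of two of them
  equalise the diagonal entries, and so each \<open>G t\<close> is a scalar. The squared moduli of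
  these scalars sum to 1, hence one of them is nonzero.\<close>

lemma proportional_branch:
  assumes U: "is_unitary 4 U" and I: "finite I" and M: "\<And>t. t \<in> I \<Longrightarrow> M t \<in> carrier_mat 4 4"
    and eq: "\<And>\<psi> i j. \<psi> \<in> carrier_vec 4 \<Longrightarrow> (\<Sum>j<4. (cmod (\<psi> $ j))\<^sup>2) = 1 \<Longrightarrow> i < 4 \<Longrightarrow> j < 4 \<Longrightarrow>
       (\<Sum>t\<in>I. (M t *\<^sub>v \<psi>) $ i * cnj ((M t *\<^sub>v \<psi>) $ j)) = (U *\<^sub>v \<psi>) $ i * cnj ((U *\<^sub>v \<psi>) $ j)"
  obtains t c where "t \<in> I" "c \<noteq> 0" "M t = c \<cdot>\<^sub>m U"
proof -
  have cU: "U \<in> carrier_mat 4 4" using U by (rule unitary_carrier)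
  define G where "G t = adjm U * M t" for t
  have cG: "G t \<in> carrier_mat 4 4" if "t \<in> I" for t using M[OF that] cU by (simp add: G_def)
  have geq: "(\<Sum>t\<in>I. (G t *\<^sub>v \<psi>) $ k * cnj ((G t *\<^sub>v \<psi>) $ l)) = \<psi> $ k * cnj (\<psi> $ l)"
    if \<psi>: "\<psi> \<in> carrier_vec 4" "(\<Sum>j<4. (cmod (\<psi> $ j))\<^sup>2) = 1" and kl: "k < 4" "l < 4" for \<psi> k l
  proof -
    have ex: "(adjm U *\<^sub>v w) $ k = (\<Sum>i = 0..<4. cnj (U $$ (i,k)) * w $ i)" if "w \<in> carrier_vec 4" "k < 4" for w k
      using that cU by (auto simp: scalar_prod_def intro!: sum.cong)
    have dbl: "(adjm U *\<^sub>v w) $ k * cnj ((adjm U *\<^sub>v w) $ l) =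
       (\<Sum>i = 0..<4. \<Sum>j = 0..<4. cnj (U $$ (i,k)) * U $$ (j,l) * (w $ i * cnj (w $ j)))" if "w \<in> carrier_vec
           4" for w
      unfolding ex[OF that kl(1)] ex[OF that kl(2)] cnj_sum sum_product by (intro sum.cong refl) simp
    have "(\<Sum>t\<in>I. (G t *\<^sub>v \<psi>) $ k * cnj ((G t *\<^sub>v \<psi>) $ l)) =
      (\<Sum>t\<in>I. \<Sum>i = 0..<4. \<Sum>j = 0..<4. cnj (U $$ (i,k)) * U $$ (j,l) * ((M t *\<^sub>v \<psi>) $ i * cnj ((M t *\<^sub>v \<psi>) $ j)))"
    proof (rule sum.cong[OF refl])
      fix t assume t: "t \<in> I"
      have "G t *\<^sub>v \<psi> = adjm U *\<^sub>v (M t *\<^sub>v \<psi>)"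
        unfolding G_def using cU M[OF t] \<psi> by (intro assoc_mult_mat_vec) auto
      then show "(G t *\<^sub>v \<psi>) $ k * cnj ((G t *\<^sub>v \<psi>) $ l) = (\<Sum>i = 0..<4. \<Sum>j = 0..<4. cnj (U $$ (i,k)) * U $$
          (j,l) * ((M t *\<^sub>v \<psi>) $ i * cnj ((M t *\<^sub>v \<psi>) $ j)))"
        using dbl[of "M t *\<^sub>v \<psi>"] M[OF t] \<psi> by simp
    qed
    also have "\<dots> = (\<Sum>i = 0..<4. \<Sum>t\<in>I. \<Sum>j = 0..<4. cnj (U $$ (i,k)) * U $$ (j,l) * ((M t *\<^sub>v \<psi>) $ i * cnj ((M
        t *\<^sub>v \<psi>) $ j)))"
      by (rule sum.swap)
    also have "\<dots> = (\<Sum>i = 0..<4. \<Sum>j = 0..<4. \<Sum>t\<in>I. cnj (U $$ (i,k)) * U $$ (j,l) * ((M t *\<^sub>v \<psi>) $ i * cnj ((M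
        t *\<^sub>v \<psi>) $ j)))"
      by (intro sum.cong refl sum.swap)
    also have "\<dots> = (\<Sum>i = 0..<4. \<Sum>j = 0..<4. cnj (U $$ (i,k)) * U $$ (j,l) * ((U *\<^sub>v \<psi>) $ i * cnj ((U *\<^sub>v \<psi>) $ j)))"
      using eq[OF \<psi>] by (intro sum.cong refl) (simp flip: sum_distrib_left)
    also have "\<dots> = (adjm U *\<^sub>v (U *\<^sub>v \<psi>)) $ k * cnj ((adjm U *\<^sub>v (U *\<^sub>v \<psi>)) $ l)"
      using dbl[of "U *\<^sub>v \<psi>"] cU \<psi> by simp
    also have "adjm U *\<^sub>v (U *\<^sub>v \<psi>) = (adjm U * U) *\<^sub>v \<psi>"
      using cU \<psi> by (intro assoc_mult_mat_vec[symmetric]) auto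
    also have "\<dots> = \<psi>" using unitary_left[OF U] \<psi> by simp
    finally show ?thesis .
  qed
  have sums4: "(\<Sum>j<4. f j) = f 0 + f 1 + f 2 + f (3::nat)" for f :: "nat \<Rightarrow> real"
    using sum_upto_4[of f] by (simp add: atLeast0LessThan)
  have unit: "(\<Sum>t\<in>I. G t $$ (k,j) * cnj (G t $$ (l,j))) = (if k = j \<and> l = j then 1 else 0)"
    if "k < 4" "l < 4" "j < 4" for k l j
  proof -
    have n: "(\<Sum>i<4. (cmod (unit_vec 4 j $ i :: complex))\<^sup>2) = 1"
      using that(3) unfolding less_4_cases sums4 by auto
    have "(G t *\<^sub>v unit_vec 4 j) $ k = G t $$ (k,j)" if "t \<in> I" "k < 4" for t k
      using cG[OF that(1)] that(2) \<open>j < 4\<close> by (auto simp: scalar_prod_right_unit)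
    then have "(\<Sum>t\<in>I. G t $$ (k,j) * cnj (G t $$ (l,j))) = (\<Sum>t\<in>I. (G t *\<^sub>v unit_vec 4 j) $ k * cnj ((G t *\<^sub>v
        unit_vec 4 j) $ l))"
      using that by (intro sum.cong) auto
    also have "\<dots> = unit_vec 4 j $ k * cnj (unit_vec 4 j $ l)" by (rule geq) (use n that in auto)
    finally show ?thesis using that by simp
  qed
  have nz: "f t = 0" if "(\<Sum>t\<in>I. f t * cnj (f t)) = (0::complex)" "t \<in> I" for f t
  proof -
    have "complex_of_real (\<Sum>t\<in>I. (cmod (f t))\<^sup>2) = 0" using that(1) by (simp only: of_real_sum complex_norm_square)
    then have "(\<Sum>t\<in>I. (cmod (f t))\<^sup>2) = 0" by (simp only: of_real_eq_0_iff)
    then have "\<forall>t\<in>I. (cmod (f t))\<^sup>2 = 0" using I by (subst (asm) sum_nonneg_eq_0_iff) auto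
    then show ?thesis using that(2) by auto
  qed
  have off: "G t $$ (k,j) = 0" if "t \<in> I" "k < 4" "j < 4" "k \<noteq> j" for t k j
    using nz[of "\<lambda>t. G t $$ (k,j)"] unit[of k k j] that by simp
  have diag: "G t $$ (k,k) = G t $$ (0,0)" if t: "t \<in> I" and k: "k < 4" "k \<noteq> 0" for t k
  proof -
    \<comment> \<open>The balanced superposition of basis vectors 0 and \<open>k\<close>: all four
      sums in \<open>cross\<close> equal 1, so the summed squared difference of the two diagonal
      entries is \<open>1 - 1 - 1 + 1 = 0\<close>.\<close>
    define \<psi> where "\<psi> = vec 4 (\<lambda>i. if i = 0 \<or> i = k then complex_of_real (1 / sqrt 2) else 0)"
    have c: "\<psi> \<in> carrier_vec 4" by (simp add: \<psi>_def)
    have h: "(1 / sqrt 2)\<^sup>2 = (1/2 :: real)" by (simp add: power_divide)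
    have n: "(\<Sum>i<4. (cmod (\<psi> $ i))\<^sup>2) = 1"
      using k unfolding less_4_cases sums4 \<psi>_def by (auto simp: h norm_divide power_divide)
    have g: "(G t *\<^sub>v \<psi>) $ l = complex_of_real (1 / sqrt 2) * G t $$ (l,l)" if "t \<in> I" "l = 0 \<or> l = k" for t l
    proof -
      have l: "l < 4" using that k by auto
      have "(G t *\<^sub>v \<psi>) $ l = (\<Sum>i = 0..<4. G t $$ (l,i) * \<psi> $ i)"
        using cG[OF that(1)] l c by (auto simp: scalar_prod_def intro!: sum.cong)
      also have "\<dots> = (\<Sum>i = 0..<4. if i = l then complex_of_real (1 / sqrt 2) * G t $$ (l,l) else 0)"
        using off[OF that(1) l] that(2) l by (intro sum.cong refl) (auto simp: \<psi>_def)
      finally show ?thesis using l by simp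
    qed
    have s: "complex_of_real (1 / sqrt 2) * cnj (complex_of_real (1 / sqrt 2)) = 1/2" by (simp flip: of_real_mult)
    have cross: "(\<Sum>t\<in>I. G t $$ (a,a) * cnj (G t $$ (b,b))) = 1" if ab: "a = 0 \<or> a = k" "b = 0 \<or> b = k" for a b
    proof -
      have ab4: "a < 4" "b < 4" using ab k by auto
      have "(1/2) * (\<Sum>t\<in>I. G t $$ (a,a) * cnj (G t $$ (b,b))) = (\<Sum>t\<in>I. (G t *\<^sub>v \<psi>) $ a * cnj ((G t *\<^sub>v \<psi>) $ b))"
        unfolding sum_distrib_left s[symmetric] by (intro sum.cong refl) (simp add: g ab)
      also have "\<dots> = \<psi> $ a * cnj (\<psi> $ b)" by (rule geq[OF c n ab4])
      also have "\<dots> = 1/2" unfolding s[symmetric] using ab ab4 by (auto simp: \<psi>_def)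
      finally show ?thesis by simp
    qed
    have "(\<Sum>t\<in>I. (G t $$ (k,k) - G t $$ (0,0)) * cnj (G t $$ (k,k) - G t $$ (0,0))) =
      (\<Sum>t\<in>I. G t $$ (k,k) * cnj (G t $$ (k,k))) - (\<Sum>t\<in>I. G t $$ (k,k) * cnj (G t $$ (0,0)))
      - (\<Sum>t\<in>I. G t $$ (0,0) * cnj (G t $$ (k,k))) + (\<Sum>t\<in>I. G t $$ (0,0) * cnj (G t $$ (0,0)))"
      by (simp add: algebra_simps sum.distrib sum_subtractf)
    also have "\<dots> = 0" by (simp add: cross)
    finally show ?thesis using nz[of "\<lambda>t. G t $$ (k,k) - G t $$ (0,0)" t] t by simp
  qed
  have s1: "(\<Sum>t\<in>I. G t $$ (0,0) * cnj (G t $$ (0,0))) = 1" using unit[of 0 0 0] by simp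
  have "\<exists>t\<in>I. G t $$ (0,0) \<noteq> 0"
  proof (rule ccontr)
    assume "\<not> ?thesis"
    then have "(\<Sum>t\<in>I. G t $$ (0,0) * cnj (G t $$ (0,0))) = 0" by (intro sum.neutral) auto
    with s1 show False by simp
  qed
  then obtain t where t: "t \<in> I" "G t $$ (0,0) \<noteq> 0" by blast
  have "G t = (G t $$ (0,0)) \<cdot>\<^sub>m 1\<^sub>m 4"
  proof (rule eq_mat4I)
    fix i j :: nat assume ij: "i < 4" "j < 4"
    show "G t $$ (i,j) = ((G t $$ (0,0)) \<cdot>\<^sub>m 1\<^sub>m 4) $$ (i,j)"
      using off[OF t(1) ij] diag[OF t(1) ij(1)] ij by (cases "i = j"; cases "i = 0") auto
  qed (use cG t in auto)
  then have "U * G t = (G t $$ (0,0)) \<cdot>\<^sub>m U"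
    using mult_smult_distrib[OF cU one_carrier_mat[of 4], of "G t $$ (0,0)"] right_mult_one_mat[OF cU] by simp
  moreover have "U * G t = M t"
  proof -
    have "U * G t = (U * adjm U) * M t" unfolding G_def using cU M[OF t(1)] by (simp add: assoc_mat4)
    then show ?thesis using unitary_right[OF U] M[OF t(1)] by simp
  qed
  ultimately show ?thesis using that[OF t] by simp
qed

definition output_bits :: "bool \<Rightarrow> bool \<Rightarrow> qlab \<Rightarrow> bool" where
  "output_bits a b = (\<lambda>q. q = Outp 1 \<and> a \<or> q = Outp 2 \<and> b)"

text \<open>The unnormalised map from input to output in one branch when the discarded qubits end in
  the basis state \<open>c\<close>. The row index splits into its high bit \<open>2 \<le> i\<close>
  and its low bit \<open>odd i\<close>.\<close>

definition branch_mat :: "nat \<Rightarrow> op \<Rightarrow> (qlab \<Rightarrow> bool) \<Rightarrow> complex mat" where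
  "branch_mat N K c = mat 4 4 (\<lambda>(i,j). op_apply (qubits 2 N) K (init_amp 2 N (unit_vec 4 j)) (merge 2
      (output_bits (2 \<le> i) (odd i)) c))"

lemma out_qubits_2: "out_qubits 2 = {Outp 1, Outp 2}"
proof -
  have i12: "1 \<le> i \<and> i \<le> (2::nat) \<longleftrightarrow> i = 1 \<or> i = 2" for i by auto
  show ?thesis unfolding out_qubits_def i12 by auto
qed

lemma branch_mat_vec:
  assumes "\<psi> \<in> carrier_vec 4" "i < 4"
  shows "(branch_mat N K c *\<^sub>v \<psi>) $ i = op_apply (qubits 2 N) K (init_amp 2 N \<psi>) (merge 2 (output_bits (2 \<le>
      i) (odd i)) c)"
proof -
  let ?x = "merge 2 (output_bits (2 \<le> i) (odd i)) c"
  have lin: "init_amp 2 N \<psi> y = (\<Sum>j = 0..<4. init_amp 2 N (unit_vec 4 j) y * \<psi> $ j)" for y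
  proof -
    have l: "in_index 2 y < 4" by (simp add: index_eq pair_index_less)
    have "(\<Sum>j = 0..<4. unit_vec 4 j $ in_index 2 y * \<psi> $ j) = (\<Sum>j = 0..<4. if j = in_index 2 y then \<psi> $ j else 0)"
      using l by (intro sum.cong refl) auto
    then have e: "\<psi> $ in_index 2 y = (\<Sum>j = 0..<4. unit_vec 4 j $ in_index 2 y * \<psi> $ j)" using l by simp
    show ?thesis unfolding init_amp_def e sum_distrib_right by (intro sum.cong refl) (simp add: mult_ac)
  qed
  have "(branch_mat N K c *\<^sub>v \<psi>) $ i = (\<Sum>j = 0..<4. op_apply (qubits 2 N) K (init_amp 2 N (unit_vec 4 j)) ?x
      * \<psi> $ j)"
    using assms by (simp add: branch_mat_def scalar_prod_def)
  also have "\<dots> = (\<Sum>j = 0..<4. \<Sum>y\<in>bst (qubits 2 N). K ?x y * (init_amp 2 N (unit_vec 4 j) y * \<psi> $ j))"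
    by (simp add: op_apply_def sum_distrib_right mult.assoc)
  also have "\<dots> = (\<Sum>y\<in>bst (qubits 2 N). \<Sum>j = 0..<4. K ?x y * (init_amp 2 N (unit_vec 4 j) y * \<psi> $ j))"
    by (rule sum.swap)
  also have "\<dots> = op_apply (qubits 2 N) K (init_amp 2 N \<psi>) ?x"
    unfolding op_apply_def lin sum_distrib_left ..
  finally show ?thesis .
qed

text \<open>The partial trace makes the output a sum over pairs of a Kraus operator and a basis
  state of the discarded qubits; these pairs are the index set for
  \<open>proportional_branch\<close>.\<close>

lemma implementable_branch:
  assumes N: "1 \<le> N" and U: "is_unitary 4 U" and d: "det_implementable 2 N U"
  obtains K c s where "product_form N K" "c \<in> bst (qubits 2 N - out_qubits 2)" "s \<noteq> 0" "branch_mat N K c = s \<cdot>\<^sub>m U"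
proof -
  obtain Ks where Ks: "locc 2 N Ks" and eq: "\<And>\<psi> a b. \<psi> \<in> carrier_vec 4 \<Longrightarrow> (\<Sum>j<4. (cmod (\<psi> $ j))\<^sup>2) = 1 \<Longrightarrow>
      a \<in> bst (out_qubits 2) \<Longrightarrow> b \<in> bst (out_qubits 2) \<Longrightarrow>
      ptrace_out 2 N (apply_kraus (qubits 2 N) Ks (init_state 2 N \<psi>)) a b = (U *\<^sub>v \<psi>) $ out_index 2 a * cnj
          ((U *\<^sub>v \<psi>) $ out_index 2 b)"
    using d unfolding det_implementable_def by auto
  define I where "I = bst (qubits 2 N - out_qubits 2) \<times> {..<length Ks}"
  define M where "M t = branch_mat N (Ks ! snd t) (fst t)" for t
  have fI: "finite I" unfolding I_def using finite_bst finite_qubits by (intro finite_cartesian_product) auto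
  have e: "(\<Sum>t\<in>I. (M t *\<^sub>v \<psi>) $ i * cnj ((M t *\<^sub>v \<psi>) $ j)) = (U *\<^sub>v \<psi>) $ i * cnj ((U *\<^sub>v \<psi>) $ j)"
    if \<psi>: "\<psi> \<in> carrier_vec 4" "(\<Sum>j<4. (cmod (\<psi> $ j))\<^sup>2) = 1" and ij: "i < 4" "j < 4" for \<psi> i j
  proof -
    define a where "a i = output_bits (2 \<le> i) (odd i)" for i :: nat
    have a: "a i \<in> bst (out_qubits 2)" "out_index 2 (a i) = i" if "i < 4" for i
      using that unfolding less_4_cases by (auto simp: a_def output_bits_def bst_def out_qubits_2 index_eq
          pair_index_def bit_def)
    have "(\<Sum>t\<in>I. (M t *\<^sub>v \<psi>) $ i * cnj ((M t *\<^sub>v \<psi>) $ j)) = (\<Sum>c\<in>bst (qubits 2 N - out_qubits 2). \<Sum>k<length Ks.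
       op_apply (qubits 2 N) (Ks ! k) (init_amp 2 N \<psi>) (merge 2 (a i) c) * cnj (op_apply (qubits 2 N) (Ks !
           k) (init_amp 2 N \<psi>) (merge 2 (a j) c)))"
      unfolding I_def sum.cartesian_product M_def a_def using branch_mat_vec[OF \<psi>(1)] ij
      by (intro sum.cong refl) auto
    also have "\<dots> = branch_sum 2 N Ks (init_amp 2 N \<psi>) (a i) (a j)"
      unfolding branch_sum_def by (simp add: sum_list_sum_nth atLeast0LessThan)
    also have "\<dots> = (U *\<^sub>v \<psi>) $ i * cnj ((U *\<^sub>v \<psi>) $ j)"
      using eq[OF \<psi> a(1)[OF ij(1)] a(1)[OF ij(2)]] a(2) ij by (simp add: init_state_def ptrace_pure)
    finally show ?thesis .
  qed
  have cM: "M t \<in> carrier_mat 4 4" for t by (simp add: M_def branch_mat_def)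
  obtain t s where t: "t \<in> I" "s \<noteq> 0" "M t = s \<cdot>\<^sub>m U"
    by (rule proportional_branch[OF U fI cM e])
  show ?thesis
    by (rule that[of "Ks ! snd t" "fst t" s]) (use t locc_product_form[OF N Ks] in \<open>auto simp: I_def M_def\<close>)
qed

section \<open>Contraction of the network with one and with two bridges\<close>

definition bool_mat :: "(bool \<Rightarrow> bool \<Rightarrow> complex) \<Rightarrow> complex mat" where
  "bool_mat f = mat 2 2 (\<lambda>(i,j). f (i = 1) (j = 1))"

lemma bool_mat_carrier [simp]: "bool_mat f \<in> carrier_mat 2 2" by (simp add: bool_mat_def)

text \<open>The basis states present in the initial state for inputs \<open>p\<close>,
  \<open>q\<close>: the halves of the EPR pair share the bit \<open>h\<close>, and the outputs are
  0.\<close>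

definition cfg1 :: "bool \<Rightarrow> bool \<Rightarrow> bool \<Rightarrow> qlab \<Rightarrow> bool" where
  "cfg1 p q h = (\<lambda>l. l = Inp 1 \<and> p \<or> l = Inp 2 \<and> q \<or> (l = bridge_top 1 \<or> l = bridge_bottom 1) \<and> h)"

text \<open>As \<open>cfg1\<close>, with \<open>h\<close>, \<open>k\<close> the bits on the two
  bridges and \<open>r\<close>, \<open>s\<close> those on the horizontal pairs of rows 1 and
  2.\<close>

definition cfg2 :: "bool \<Rightarrow> bool \<Rightarrow> bool \<Rightarrow> bool \<Rightarrow> bool \<Rightarrow> bool \<Rightarrow> qlab \<Rightarrow> bool" where
  "cfg2 p q h k r s = (\<lambda>l. l = Inp 1 \<and> p \<or> l = Inp 2 \<and> q \<or> (l = bridge_top 1 \<or> l = bridge_bottom 1) \<and> h \<or> (l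
      = bridge_top 2 \<or> l = bridge_bottom 2) \<and> k
     \<or> (l = right_half 1 1 \<or> l = left_half 1 1) \<and> r \<or> (l = right_half 2 1 \<or> l = left_half 2 1) \<and> s)"

lemma live_complement: "qubits 2 N - live N 1 = {Outp 1, Outp 2}"
  unfolding qubits_2 live_def pair_qubits_def by (auto simp: data_qubit_def bridge_top_def bridge_bottom_def
      right_half_def left_half_def)

lemma pair_index_inj: "pair_index a b = pair_index c d \<longleftrightarrow> a = c \<and> b = d" by (cases a; cases b; cases c; cases
    d) (simp_all add: pair_index_def bit_def)

lemma init_unit:
  assumes N: "1 \<le> N" and y: "y \<in> bst (qubits 2 N)"
  shows "init_amp 2 N (unit_vec 4 (pair_index p q)) y = inv_sqrt2 ^ (3 * (N - 1) + 1) *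
    of_bool (y (Inp 1) = p \<and> y (Inp 2) = q \<and> pairs N 1 y \<and> \<not> y (Outp 1) \<and> \<not> y (Outp 2))"
  unfolding init_amp_column[OF assms] column_state_def live_complement zero_on_def
  by (simp add: data_qubit_def pair_index_less pair_index_inj)


lemma index_pair_index: "i < 4 \<Longrightarrow> i = pair_index (2 \<le> i) (odd i)"
  unfolding less_4_cases by (auto simp: pair_index_def bit_def)

lemma pair_index_decode: "2 \<le> pair_index a b \<longleftrightarrow> a" "odd (pair_index a b) \<longleftrightarrow> b" "pair_index a b div 2 = bit a"
    "pair_index a b mod 2 = bit b"
  by (cases a; cases b; simp add: pair_index_def bit_def)+

lemma eq_mat_ixI:
  assumes "A \<in> carrier_mat 4 4" "B \<in> carrier_mat 4 4" "\<And>a b p q. A $$ (pair_index a b, pair_index p q) = B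
      $$ (pair_index a b, pair_index p q)"
  shows "A = B"
  by (rule eq_mat4I[OF assms(1,2)]) (metis assms(3) index_pair_index)

lemma kron2_bm: "kron2 (bool_mat f) (bool_mat g) $$ (pair_index a b, pair_index p q) = f a p * g b q"
proof -
  have "bool_mat f $$ (bit a, bit p) = f a p" for f a p by (cases a; cases p) (simp_all add: bool_mat_def bit_def)
  then show ?thesis by (simp add: kron2_index pair_index_less pair_index_decode)
qed

lemma branch_mat_index:
  assumes N: "1 \<le> N"
  shows "branch_mat N K c $$ (pair_index a b, pair_index p q) = inv_sqrt2 ^ (3 * (N - 1) + 1) *
    (\<Sum>y\<in>{y \<in> bst (qubits 2 N). y (Inp 1) = p \<and> y (Inp 2) = q \<and> pairs N 1 y \<and> \<not> y (Outp 1) \<and> \<not> y (Outp 2)}.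
      K (merge 2 (output_bits a b) c) y)"
proof -
  have fin: "finite (bst (qubits 2 N))" by (rule finite_bst[OF finite_qubits])
  have "branch_mat N K c $$ (pair_index a b, pair_index p q) = (\<Sum>y\<in>bst (qubits 2 N). K (merge 2 (output_bits
      a b) c) y * init_amp 2 N (unit_vec 4 (pair_index p q)) y)"
    by (simp add: branch_mat_def pair_index_less pair_index_decode op_apply_def)
  also have "\<dots> = (\<Sum>y\<in>bst (qubits 2 N). if y (Inp 1) = p \<and> y (Inp 2) = q \<and> pairs N 1 y \<and> \<not> y (Outp 1) \<and> \<not> y (Outp 2)
     then inv_sqrt2 ^ (3 * (N - 1) + 1) * K (merge 2 (output_bits a b) c) y else 0)"
    by (intro sum.cong refl) (simp add: init_unit[OF N])
  also have "\<dots> = (\<Sum>y\<in>{y \<in> bst (qubits 2 N). y (Inp 1) = p \<and> y (Inp 2) = q \<and> pairs N 1 y \<and> \<not> y (Outp 1) \<and> \<not> y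
      (Outp 2)}.
      inv_sqrt2 ^ (3 * (N - 1) + 1) * K (merge 2 (output_bits a b) c) y)"
    by (rule sum.inter_filter[OF fin, symmetric])
  finally show ?thesis by (simp add: sum_distrib_left)
qed

lemma merge_bst: "c \<in> bst (qubits 2 N - out_qubits 2) \<Longrightarrow> merge 2 (output_bits a b) c \<in> bst (qubits 2 N)"
  by (auto simp: merge_def bst_def output_bits_def out_qubits_2 qubits_2)

lemma qubits_1: "qubits 2 1 = {Inp 1, Inp 2, Outp 1, Outp 2, bridge_top 1, bridge_bottom 1}"
  unfolding qubits_2 by auto

lemma cfg1_set: "{y \<in> bst (qubits 2 1). y (Inp 1) = p \<and> y (Inp 2) = q \<and> pairs 1 1 y \<and> \<not> y (Outp 1) \<and> \<not> y (Outp 2)}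
   = cfg1 p q ` UNIV"
proof (intro equalityI subsetI)
  fix y assume y: "y \<in> {y \<in> bst (qubits 2 1). y (Inp 1) = p \<and> y (Inp 2) = q \<and> pairs 1 1 y \<and> \<not> y (Outp 1) \<and> \<not>
      y (Outp 2)}"
  then have "y (bridge_top 1) = y (bridge_bottom 1)" by (auto simp: pairs_def)
  have "y = cfg1 p q (y (bridge_top 1))"
  proof
    fix l
    consider "l = Inp 1" | "l = Inp 2" | "l = Outp 1" | "l = Outp 2" | "l = bridge_top 1" | "l =
        bridge_bottom 1" | "l \<notin> qubits 2 1"
      unfolding qubits_1 by blast
    then show "y l = cfg1 p q (y (bridge_top 1)) l"
    proof cases
      case 7
      then have "\<not> y l" using y by (auto simp: bst_def)
      then show ?thesis using 7 by (auto simp: cfg1_def qubits_1[unfolded One_nat_def])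
    qed (use y \<open>y (bridge_top 1) = y (bridge_bottom 1)\<close> in \<open>auto simp: cfg1_def bridge_top_def bridge_bottom_def\<close>)
  qed
  then show "y \<in> cfg1 p q ` UNIV" by blast
next
  fix y assume "y \<in> cfg1 p q ` UNIV"
  then show "y \<in> {y \<in> bst (qubits 2 1). y (Inp 1) = p \<and> y (Inp 2) = q \<and> pairs 1 1 y \<and> \<not> y (Outp 1) \<and> \<not> y (Outp 2)}"
    by (auto simp: cfg1_def bst_def qubits_1[unfolded One_nat_def] pairs_def bridge_top_def bridge_bottom_def)
qed

text \<open>The bridge bit \<open>h\<close> is the only index summed over, and for each of its two
  values the operator is a product of a factor of node \<open>(1,1)\<close> and a factor of node
  \<open>(2,1)\<close>.\<close>

lemma branch_one_bridge:
  assumes K: "product_form 1 K" and c: "c \<in> bst (qubits 2 1 - out_qubits 2)"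
  obtains B1 B2 D1 D2 where "B1 \<in> carrier_mat 2 2" "B2 \<in> carrier_mat 2 2" "D1 \<in> carrier_mat 2 2" "D2 \<in>
      carrier_mat 2 2"
    "branch_mat 1 K c = kron2 B1 D1 + kron2 B2 D2"
proof -
  let ?Q = "node_qubits 2 1" let ?S = "qubits 2 1"
  obtain B where B: "\<And>x y. x \<in> bst ?S \<Longrightarrow> y \<in> bst ?S \<Longrightarrow> K x y = (\<Prod>v\<in>cl_nodes 2 1. B v (restr x (?Q v)) (restr y
      (?Q v)))"
    using K unfolding product_form_def by blast
  \<comment> \<open>Bits held by the other node are set to \<open>False\<close>, which displays the
    factor as a function of the node's own bits. The EPR amplitude is absorbed into
    \<open>f\<close>.\<close>
  define f where "f h a p = inv_sqrt2 * B (1,1) (restr (merge 2 (output_bits a False) c) (?Q (1,1))) (restr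
      (cfg1 p False h) (?Q (1,1)))" for h a p
  define g where "g h b q = B (2,1) (restr (merge 2 (output_bits False b) c) (?Q (2,1))) (restr (cfg1 False
      q h) (?Q (2,1)))" for h b q
  have nodes: "cl_nodes 2 1 = {(1,1), (2,1)}" by (auto simp: cl_nodes_def)
  have r: "restr (merge 2 (output_bits a b) c) (?Q (1,1)) = restr (merge 2 (output_bits a False) c) (?Q (1,1))"
    "restr (merge 2 (output_bits a b) c) (?Q (2,1)) = restr (merge 2 (output_bits False b) c) (?Q (2,1))"
    "restr (cfg1 p q h) (?Q (1,1)) = restr (cfg1 p False h) (?Q (1,1))"
    "restr (cfg1 p q h) (?Q (2,1)) = restr (cfg1 False q h) (?Q (2,1))" for a b p q h
    by (auto simp: fun_eq_iff restr_def node_qubits_def merge_def output_bits_def cfg1_def bridge_top_def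
        bridge_bottom_def)
  have inj: "inj (cfg1 p q)" for p q
  proof (rule injI)
    fix h h' assume "cfg1 p q h = cfg1 p q h'"
    then have "cfg1 p q h (bridge_top 1) = cfg1 p q h' (bridge_top 1)" by simp
    then show "h = h'" by (simp add: cfg1_def bridge_top_def)
  qed
  have cb: "cfg1 p q h \<in> bst ?S" for p q h by (auto simp: cfg1_def bst_def qubits_1[unfolded One_nat_def])
  have Kv: "inv_sqrt2 * K (merge 2 (output_bits a b) c) (cfg1 p q h) = f h a p * g h b q" for a b p q h
  proof -
    have p2: "(\<Prod>v\<in>{(1,1), (2,1)}. g v) = g (1,1) * g (2,1)" for g :: "nat \<times> nat \<Rightarrow> complex" by simp
    show ?thesis
      unfolding B[OF merge_bst[OF c] cb] nodes p2 f_def g_def r(1,2)[of a b] r(3,4)[of p q h] by (simp only: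
          mult.assoc)
  qed
  have e: "branch_mat 1 K c $$ (pair_index a b, pair_index p q) = (\<Sum>h\<in>UNIV. f h a p * g h b q)" for a b p q
    unfolding branch_mat_index[OF order_refl] cfg1_set sum.reindex[OF inj] o_def sum_distrib_left using Kv by simp
  show ?thesis
  proof (rule that[of "bool_mat (f False)" "bool_mat (f True)" "bool_mat (g False)" "bool_mat (g True)"])
    show "branch_mat 1 K c = kron2 (bool_mat (f False)) (bool_mat (g False)) + kron2 (bool_mat (f True))
        (bool_mat (g True))"
      by (rule eq_mat_ixI) (simp_all add: e[unfolded One_nat_def] kron2_bm sum_bool pair_index_less, simp
          add: branch_mat_def)
  qed auto
qed

lemma qubits_two: "qubits 2 2 = {Inp 1, Inp 2, Outp 1, Outp 2, bridge_top 1, bridge_bottom 1, bridge_top 2,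
    bridge_bottom 2, right_half 1 1, right_half 2 1, left_half 1 1, left_half 2 1}"
proof -
  have "{1..2} = {1, 2::nat}" "{1..<2} = {1::nat}" by auto
  then show ?thesis unfolding qubits_2 by auto
qed

lemma node_qubits_two:
  "node_qubits 2 2 (1,1) = {Inp 1, bridge_top 1, right_half 1 1}" "node_qubits 2 2 (2,1) = {Inp 2,
      bridge_bottom 1, right_half 2 1}"
  "node_qubits 2 2 (1,2) = {Outp 1, bridge_top 2, left_half 1 1}" "node_qubits 2 2 (2,2) = {Outp 2,
      bridge_bottom 2, left_half 2 1}"
  unfolding node_qubits_def qubits_two by (auto simp: bridge_top_def bridge_bottom_def right_half_def
      left_half_def)

lemma restr_cong: "(\<And>l. l \<in> Q \<Longrightarrow> f l = g l) \<Longrightarrow> restr f Q = restr g Q"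
  by (auto simp: restr_def fun_eq_iff)

lemma pairs_two: "pairs 2 1 y \<longleftrightarrow> y (bridge_top 1) = y (bridge_bottom 1) \<and> y (bridge_top 2) = y (bridge_bottom
    2) \<and> y (right_half 1 1) = y (left_half 1 1) \<and> y (right_half 2 1) = y (left_half 2 1)"
proof -
  have "{1..2} = {1, 2::nat}" "{1..<2} = {1::nat}" by auto
  then show ?thesis unfolding pairs_def by auto
qed

lemma cfg2_set: "{y \<in> bst (qubits 2 2). y (Inp 1) = p \<and> y (Inp 2) = q \<and> pairs 2 1 y \<and> \<not> y (Outp 1) \<and> \<not> y (Outp 2)}
   = (\<lambda>(h, k, r, s). cfg2 p q h k r s) ` UNIV"
proof (intro equalityI subsetI)
  fix y assume y: "y \<in> {y \<in> bst (qubits 2 2). y (Inp 1) = p \<and> y (Inp 2) = q \<and> pairs 2 1 y \<and> \<not> y (Outp 1) \<and> \<not>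
      y (Outp 2)}"
  then have e: "y (bridge_bottom 1) = y (bridge_top 1)" "y (bridge_bottom 2) = y (bridge_top 2)" "y
      (left_half 1 1) = y (right_half 1 1)" "y (left_half 2 1) = y (right_half 2 1)"
    by (auto simp: pairs_two[unfolded One_nat_def])
  have "y = cfg2 p q (y (bridge_top 1)) (y (bridge_top 2)) (y (right_half 1 1)) (y (right_half 2 1))"
  proof
    fix l
    consider "l = Inp 1" | "l = Inp 2" | "l = Outp 1" | "l = Outp 2" | "l = bridge_top 1" | "l =
        bridge_bottom 1" | "l = bridge_top 2" | "l = bridge_bottom 2"
       | "l = right_half 1 1" | "l = right_half 2 1" | "l = left_half 1 1" | "l = left_half 2 1" | "l \<notin> qubits 2 2"
      unfolding qubits_two by blast
    then show "y l = cfg2 p q (y (bridge_top 1)) (y (bridge_top 2)) (y (right_half 1 1)) (y (right_half 2 1)) l"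
    proof cases
      case 13
      then have "\<not> y l" using y by (auto simp: bst_def)
      then show ?thesis using 13 by (auto simp: cfg2_def qubits_two)
    qed (use y e in \<open>simp_all add: cfg2_def bridge_top_def bridge_bottom_def right_half_def left_half_def\<close>)
  qed
  then show "y \<in> (\<lambda>(h, k, r, s). cfg2 p q h k r s) ` UNIV"
    by (intro image_eqI[of _ _ "(y (bridge_top 1), y (bridge_top 2), y (right_half 1 1), y (right_half 2
        1))"]) simp_all
next
  fix y assume "y \<in> (\<lambda>(h, k, r, s). cfg2 p q h k r s) ` UNIV"
  then obtain h k r s where y: "y = cfg2 p q h k r s" by auto
  have "cfg2 p q h k r s \<in> bst (qubits 2 2)" by (simp add: bst_def qubits_two cfg2_def)
  then show "y \<in> {y \<in> bst (qubits 2 2). y (Inp 1) = p \<and> y (Inp 2) = q \<and> pairs 2 1 y \<and> \<not> y (Outp 1) \<and> \<not> y (Outp 2)}"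
    unfolding y by (simp add: cfg2_def pairs_two[unfolded One_nat_def] bridge_top_def bridge_bottom_def
        right_half_def left_half_def)
qed

text \<open>Summation over the horizontal bits \<open>r\<close>, \<open>s\<close> is matrix
  multiplication of the second column, \<open>B\<close> and \<open>D\<close>, with the first,
  \<open>A\<close> and \<open>C\<close>. The bridge bit of a column, \<open>h\<close> or
  \<open>k\<close>, is shared only by the two nodes of that column, so each column is a sum of two
  tensor products.\<close>

lemma branch_two_bridges:
  assumes K: "product_form 2 K" and c: "c \<in> bst (qubits 2 2 - out_qubits 2)"
  obtains A1 A2 C1 C2 B1 B2 D1 D2 where
    "A1 \<in> carrier_mat 2 2" "A2 \<in> carrier_mat 2 2" "C1 \<in> carrier_mat 2 2" "C2 \<in> carrier_mat 2 2"
    "B1 \<in> carrier_mat 2 2" "B2 \<in> carrier_mat 2 2" "D1 \<in> carrier_mat 2 2" "D2 \<in> carrier_mat 2 2"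
    "branch_mat 2 K c = (kron2 B1 D1 + kron2 B2 D2) * (kron2 A1 C1 + kron2 A2 C2)"
proof -
  let ?Q = "node_qubits 2 2" let ?S = "qubits 2 2"
  obtain B where B: "\<And>x y. x \<in> bst ?S \<Longrightarrow> y \<in> bst ?S \<Longrightarrow> K x y = (\<Prod>v\<in>cl_nodes 2 2. B v (restr x (?Q v)) (restr y
      (?Q v)))"
    using K unfolding product_form_def by blast
  define x0 where "x0 a b = merge 2 (output_bits a b) c" for a b
  define fA where "fA h r p = B (1,1) (restr (x0 False False) (?Q (1,1))) (restr (cfg2 p False h False r
      False) (?Q (1,1)))" for h r p
  define fC where "fC h s q = B (2,1) (restr (x0 False False) (?Q (2,1))) (restr (cfg2 False q h False False
      s) (?Q (2,1)))" for h s q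
  \<comment> \<open>The amplitude of all four EPR pairs is absorbed into this factor.\<close>
  define fB where "fB k a r = inv_sqrt2 ^ 4 * B (1,2) (restr (x0 a False) (?Q (1,2))) (restr (cfg2 False
      False False k r False) (?Q (1,2)))" for k a r
  define fD where "fD k b s = B (2,2) (restr (x0 False b) (?Q (2,2))) (restr (cfg2 False False False k False
      s) (?Q (2,2)))" for k b s
  have nodes: "cl_nodes 2 2 = {(1,1), (2,1), (1,2), (2,2)}" by (auto simp: cl_nodes_def)
  have rx: "restr (x0 a b) (?Q (1,1)) = restr (x0 False False) (?Q (1,1))"
    "restr (x0 a b) (?Q (2,1)) = restr (x0 False False) (?Q (2,1))"
    "restr (x0 a b) (?Q (1,2)) = restr (x0 a False) (?Q (1,2))"
    "restr (x0 a b) (?Q (2,2)) = restr (x0 False b) (?Q (2,2))" for a b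
    by (rule restr_cong; auto simp: node_qubits_two[unfolded One_nat_def] merge_def output_bits_def
        out_qubits_2 x0_def bridge_top_def bridge_bottom_def right_half_def left_half_def)+
  have rc: "restr (cfg2 p q h k r s) (?Q (1,1)) = restr (cfg2 p False h False r False) (?Q (1,1))"
    "restr (cfg2 p q h k r s) (?Q (2,1)) = restr (cfg2 False q h False False s) (?Q (2,1))"
    "restr (cfg2 p q h k r s) (?Q (1,2)) = restr (cfg2 False False False k r False) (?Q (1,2))"
    "restr (cfg2 p q h k r s) (?Q (2,2)) = restr (cfg2 False False False k False s) (?Q (2,2))" for p q h k r s
    unfolding node_qubits_two
    by (rule restr_cong; elim insertE emptyE; simp add: cfg2_def bridge_top_def bridge_bottom_def
        right_half_def left_half_def)+
  have inj: "inj (\<lambda>(h, k, r, s). cfg2 p q h k r s)" for p q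
  proof (rule injI)
    fix u v assume e: "(\<lambda>(h, k, r, s). cfg2 p q h k r s) u = (\<lambda>(h, k, r, s). cfg2 p q h k r s) v"
    obtain h k r s h' k' r' s' where uv: "u = (h, k, r, s)" "v = (h', k', r', s')" by (cases u; cases v) auto
    have l: "cfg2 p q h k r s l = cfg2 p q h' k' r' s' l" for l using e by (simp add: uv)
    show "u = v" using l[of "bridge_top 1"] l[of "bridge_top 2"] l[of "right_half 1 1"] l[of "right_half 2 1"]
      by (simp add: uv cfg2_def bridge_top_def bridge_bottom_def right_half_def left_half_def)
  qed
  have cb: "cfg2 p q h k r s \<in> bst ?S" for p q h k r s by (simp add: bst_def qubits_two cfg2_def)
  have Kv: "inv_sqrt2 ^ 4 * K (x0 a b) (cfg2 p q h k r s) = (fB k a r * fD k b s) * (fA h r p * fC h s q)"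
      for a b p q h k r s
  proof -
    have p4: "(\<Prod>v\<in>{(1,1), (2,1), (1,2), (2,2)}. g v) = g (1,1) * (g (2,1) * (g (1,2) * g (2,2)))"
      for g :: "nat \<times> nat \<Rightarrow> complex" by simp
    have xb: "x0 a b \<in> bst ?S" unfolding x0_def by (rule merge_bst[OF c])
    show ?thesis
      unfolding B[OF xb cb] nodes p4 fA_def fB_def fC_def fD_def rx[of a b] rc[of p q h k r s]
      by (simp only: mult_ac)
  qed
  have e: "branch_mat 2 K c $$ (pair_index a b, pair_index p q) = (\<Sum>(h, k, r, s)\<in>UNIV. (fB k a r * fD k b s)
      * (fA h r p * fC h s q))" for a b p q
  proof -
    have "branch_mat 2 K c $$ (pair_index a b, pair_index p q) = inv_sqrt2 ^ 4 * (\<Sum>y\<in>(\<lambda>(h, k, r, s). cfg2 p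
        q h k r s) ` UNIV. K (x0 a b) y)"
      using branch_mat_index[of 2 K c a b p q] unfolding cfg2_set by (simp add: x0_def)
    also have "\<dots> = (\<Sum>(h, k, r, s)\<in>UNIV. inv_sqrt2 ^ 4 * K (x0 a b) (cfg2 p q h k r s))"
      unfolding sum.reindex[OF inj] sum_distrib_left by (intro sum.cong refl) auto
    also have "\<dots> = (\<Sum>(h, k, r, s)\<in>UNIV. (fB k a r * fD k b s) * (fA h r p * fC h s q))"
      unfolding Kv ..
    finally show ?thesis .
  qed
  have sum4: "(\<Sum>(h, k, r, s)\<in>UNIV. F h k r s) = (\<Sum>h\<in>UNIV. \<Sum>k\<in>UNIV. \<Sum>r\<in>UNIV. \<Sum>s\<in>UNIV. F h k r s)"
    for F :: "bool \<Rightarrow> bool \<Rightarrow> bool \<Rightarrow> bool \<Rightarrow> complex"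
    by (simp add: sum.cartesian_product UNIV_Times_UNIV[symmetric] case_prod_unfold del: UNIV_Times_UNIV)
  define V where "V = kron2 (bool_mat (fB False)) (bool_mat (fD False)) + kron2 (bool_mat (fB True))
      (bool_mat (fD True))"
  define W where "W = kron2 (bool_mat (fA False)) (bool_mat (fC False)) + kron2 (bool_mat (fA True))
      (bool_mat (fC True))"
  have VW: "V \<in> carrier_mat 4 4" "W \<in> carrier_mat 4 4" by (simp_all add: V_def W_def)
  have Vi: "V $$ (pair_index a b, pair_index r s) = fB False a r * fD False b s + fB True a r * fD True b s"
     "W $$ (pair_index a b, pair_index r s) = fA False a r * fC False b s + fA True a r * fC True b s" for a b r s
    by (simp_all add: V_def W_def kron2_bm pair_index_less)
  have "branch_mat 2 K c = V * W"
  proof (rule eq_mat_ixI)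
    fix a b p q
    have "(V * W) $$ (pair_index a b, pair_index p q) = (\<Sum>r\<in>UNIV. \<Sum>s\<in>UNIV. V $$ (pair_index a b, pair_index
        r s) * W $$ (pair_index r s, pair_index p q))"
      using mult_index4[OF VW pair_index_less[of a b] pair_index_less[of p q]] by (simp add: sum_bool
          pair_index_simps add.assoc)
    then show "branch_mat 2 K c $$ (pair_index a b, pair_index p q) = (V * W) $$ (pair_index a b, pair_index p q)"
      unfolding e sum4 Vi by (simp add: sum_bool algebra_simps)
  qed (use VW in \<open>auto simp: branch_mat_def\<close>)
  then show ?thesis unfolding V_def W_def by (intro that) auto
qed

section \<open>The characterisation\<close>

text \<open>Cartan decomposition: three columns are made diagonal in turn in the magic basis, and
  unitarity takes care of the fourth.\<close>

lemma kak:
  assumes "is_unitary 4 U"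
  shows "\<exists>x y z. local_equiv U (canon_gate x y z)"
proof -
  have 1: "\<exists>V. is_unitary 4 V \<and> local_equiv U V \<and> fixes_below k (adjm magic * V * magic)" if "k \<le> 3" for k
    using that
  proof (induction k)
    case 0
    show ?case using assms local_equiv_refl[OF unitary_carrier[OF assms]] by (auto simp: fixes_below_def)
  next
    case (Suc k)
    then obtain V where V: "is_unitary 4 V" "local_equiv U V" "fixes_below k (adjm magic * V * magic)" by auto
    have k3: "k < 3" using Suc(2) by simp
    obtain u u' w w' V' where V': "is_unitary 2 u" "is_unitary 2 u'" "is_unitary 2 w" "is_unitary 2 w'"
      "is_unitary 4 V'" "V = kron2 u u' * V' * kron2 w w'" "fixes_below (Suc k) (adjm magic * V' * magic)"
      by (rule diagonalize_step[OF V(1,3) k3])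
    have "local_equiv U V'"
      by (rule local_equiv_trans[OF V(2) local_equivI[OF V'(1-4,6)] unitary_carrier[OF V'(5)]])
    then show ?case using V'(5,7) by blast
  qed
  obtain V where V: "is_unitary 4 V" "local_equiv U V" "fixes_below 3 (adjm magic * V * magic)" using 1[of
      3] by auto
  obtain p x y z where p: "cmod p = 1" "V = p \<cdot>\<^sub>m canon_gate x y z"
    using diagonal_in_magic[OF V(1,3)] by blast
  \<comment> \<open>The global phase is itself a local gate and can be assigned to the first
    qubit.\<close>
  have "V = kron2 (p \<cdot>\<^sub>m 1\<^sub>m 2) (1\<^sub>m 2) * canon_gate x y z * kron2 (1\<^sub>m 2) (1\<^sub>m 2)"
    by (simp add: p(2) kron2_smult_left kron2_one smult_mat4 right_one_mat4 left_mult_one_mat[of _ 4 4])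
  then have "local_equiv V (canon_gate x y z)"
    by (rule local_equivI[OF unitary_smult[OF unitary_one p(1)] unitary_one unitary_one unitary_one])
  then show ?thesis using local_equiv_trans[OF V(2) _ canon_carrier] by blast
qed

text \<open>Existence comes from \<open>kak\<close> and the reduction to the chamber, uniqueness
  from the invariants; together they justify the definite description in
  \<open>weyl_coords\<close>.\<close>

lemma weyl_coords_props:
  assumes "is_unitary 4 U"
  obtains x y z where "weyl_coords U = (x, y, z)" "weyl_chamber (x, y, z)" "local_equiv U (canon_gate x y z)"
proof -
  obtain x0 y0 z0 where k: "local_equiv U (canon_gate x0 y0 z0)" using kak[OF assms] by blast
  obtain x y z where c: "weyl_chamber (x, y, z)" "canon_equiv (x0, y0, z0) (x, y, z)"
    using canon_reducible[of x0 y0 z0] unfolding reducible_def by auto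
  have e: "local_equiv U (canon_gate x y z)"
    using local_equiv_trans[OF k] c(2) by (simp add: canon_equiv_def)
  have "weyl_coords U = (x, y, z)" unfolding weyl_coords_def
  proof (rule the_equality)
    show "weyl_chamber (x, y, z) \<and> (\<exists>u u' w w'. is_unitary 2 u \<and> is_unitary 2 u' \<and> is_unitary 2 w \<and>
        is_unitary 2 w' \<and>
        U = kron2 u u' * (case (x, y, z) of (x, y, z) \<Rightarrow> canon_gate x y z) * kron2 w w')"
      using c(1) e by (simp add: local_equiv_def)
    fix d assume d: "weyl_chamber d \<and> (\<exists>u u' w w'. is_unitary 2 u \<and> is_unitary 2 u' \<and> is_unitary 2 w \<and>
        is_unitary 2 w' \<and>
        U = kron2 u u' * (case d of (x, y, z) \<Rightarrow> canon_gate x y z) * kron2 w w')"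
    obtain x' y' z' where d': "d = (x', y', z')" by (cases d)
    have "local_equiv U (canon_gate x' y' z')" using d unfolding d' local_equiv_def by simp
    moreover have "weyl_chamber (x', y', z')" using d d' by simp
    ultimately show "d = (x, y, z)" using weyl_coords_unique[OF c(1) e] d' by simp
  qed
  then show ?thesis using that c(1) e by blast
qed

section \<open>Circuits for canonical gates\<close>

lemma bridge_circuit_local:
  assumes "bridge_circuit n V" "is_unitary 2 a" "is_unitary 2 a'"
  shows "bridge_circuit n (V * kron2 a a')"
  using assms(1)
proof cases
  case (one u u' w w' t)
  have "V * kron2 a a' = kron2 u u' * (canon_gate 0 0 t * kron2 (w * a) (w' * a'))"
    using one(3-) assms(2,3) [THEN unitary_carrier] by (simp add: one(2) assoc_mat4 kron2_mult[symmetric]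
        unitary_carrier)
  then show ?thesis using bridge_circuit.one[OF one(3,4) unitary_mult[OF one(5) assms(2)] unitary_mult[OF
      one(6) assms(3)], of t] one(1) by simp
next
  case (step m W w w' t)
  have "V * kron2 a a' = W * (canon_gate 0 0 t * kron2 (w * a) (w' * a'))"
    using step(3-) bridge_circuit_carrier[OF step(3)] assms(2,3)[THEN unitary_carrier]
    by (simp add: step(2) assoc_mat4 kron2_mult[symmetric] unitary_carrier)
  then show ?thesis using bridge_circuit.step[OF step(3) unitary_mult[OF step(4) assms(2)] unitary_mult[OF
      step(5) assms(3)], of t] step(1) by simp
qed

lemma bridge_circuit_append:
  assumes V: "bridge_circuit n V" and L: "local_equiv G (canon_gate 0 0 t)"
  shows "bridge_circuit (Suc n) (V * G)"
proof -
  obtain u u' w w' where u: "is_unitary 2 u" "is_unitary 2 u'" "is_unitary 2 w" "is_unitary 2 w'"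
    and G: "G = kron2 u u' * canon_gate 0 0 t * kron2 w w'" using L unfolding local_equiv_def by blast
  have "V * G = (V * kron2 u u') * (canon_gate 0 0 t * kron2 w w')"
    using bridge_circuit_carrier[OF V] by (simp add: G assoc_mat4)
  then show ?thesis using bridge_circuit.step[OF bridge_circuit_local[OF V u(1,2)] u(3,4), of t] by simp
qed

lemma bridge_circuit_single: "local_equiv G (canon_gate 0 0 t) \<Longrightarrow> bridge_circuit 1 G"
  unfolding local_equiv_def using bridge_circuit.one
  by (auto simp: assoc_mat4)

text \<open>A surplus bridge performs the interaction with angle 0, which is the identity.\<close>

lemma bridge_circuit_pad:
  assumes "bridge_circuit n V" "n \<le> m"
  shows "bridge_circuit m V"
  using assms(2)
proof (induction m rule: dec_induct)
  case base show ?case by (rule assms(1))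
next
  case (step m)
  have "bridge_circuit (Suc m) (V * (canon_gate 0 0 0 * kron2 (1\<^sub>m 2) (1\<^sub>m 2)))"
    by (rule bridge_circuit.step[OF step(3)]) simp_all
  then show ?case using bridge_circuit_carrier[OF assms(1)] by (simp add: canon_zero kron2_one
      right_mult_one_mat[of V 4 4])
qed

lemma canon_split: "canon_gate x y z = canon_gate x 0 0 * canon_gate 0 y 0 * canon_gate 0 0 z"
  by (simp add: canon_mult)

lemma axis_equiv: "local_equiv (canon_gate x 0 0) (canon_gate 0 0 x)" "local_equiv (canon_gate 0 x 0)
    (canon_gate 0 0 x)"
  using canon_equiv_swap13[of x 0 0] canon_equiv_swap23[of 0 x 0] by (simp_all add: canon_equiv_def)

text \<open>The canonical gate is a product of three axis interactions, each locally equivalent to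
  one along ZZ. Each occupies one bridge, and the intervening local gates merge into adjacent
  layers; with one or two bridges the remaining interactions are trivial by hypothesis.\<close>

lemma bridge_circuit_canon:
  assumes "local_equiv U (canon_gate x y z)" "1 \<le> N"
    and "N < 3 \<Longrightarrow> z = 0" "N < 2 \<Longrightarrow> y = 0"
  shows "bridge_circuit N U"
proof -
  obtain u u' w w' where u: "is_unitary 2 u" "is_unitary 2 u'" "is_unitary 2 w" "is_unitary 2 w'"
    and U: "U = kron2 u u' * canon_gate x y z * kron2 w w'" using assms(1) unfolding local_equiv_def by blast
  have e: "local_equiv (kron2 u u' * canon_gate x 0 0) (canon_gate 0 0 x)"
  proof (rule local_equiv_trans[OF _ axis_equiv(1)])
    show "local_equiv (kron2 u u' * canon_gate x 0 0) (canon_gate x 0 0)"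
      by (rule local_equivI[OF u(1,2) unitary_one unitary_one]) (simp add: kron2_one right_one_mat4)
  qed simp
  have 1: "bridge_circuit 1 (kron2 u u' * canon_gate x 0 0)" by (rule bridge_circuit_single[OF e])
  have 2: "bridge_circuit (Suc 1) (kron2 u u' * canon_gate x 0 0 * canon_gate 0 y 0)"
    by (rule bridge_circuit_append[OF 1 axis_equiv(2)])
  have 3: "bridge_circuit (Suc (Suc 1)) (kron2 u u' * canon_gate x 0 0 * canon_gate 0 y 0 * canon_gate 0 0 z)"
    by (rule bridge_circuit_append[OF 2 local_equiv_refl]) simp
  have K: "kron2 u u' * canon_gate x y z = kron2 u u' * canon_gate x 0 0 * canon_gate 0 y 0 * canon_gate 0 0 z"
    unfolding canon_split[of x y z] by (simp add: assoc_mat4)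
  have "bridge_circuit N (kron2 u u' * canon_gate x y z)"
  proof -
    consider "N = 1" | "N = 2" | "3 \<le> N" using assms(2) by linarith
    then show ?thesis
    proof cases
      case 1 then show ?thesis using \<open>bridge_circuit 1 _\<close> assms(3,4) by simp
    next
      case 2
      then have "z = 0" using assms(3) by simp
      then have "kron2 u u' * canon_gate x y z = kron2 u u' * canon_gate x 0 0 * canon_gate 0 y 0"
        unfolding K by (simp add: canon_zero right_one_mat4)
      then show ?thesis using \<open>bridge_circuit (Suc 1) _\<close> 2 by (simp add: numeral_2_eq_2)
    next
      case 3 then show ?thesis using bridge_circuit_pad[OF \<open>bridge_circuit (Suc (Suc 1)) _\<close>, of N] K by simp
    qed
  qed
  then show ?thesis unfolding U by (rule bridge_circuit_local[OF _ u(3,4)])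
qed

lemma scaled_unitary_mult:
  assumes "s \<noteq> (0 :: complex)" "M = s \<cdot>\<^sub>m U"
  shows "U = inverse s \<cdot>\<^sub>m M"
  using assms by (simp add: smult_smult_mat smult_one_mat)

theorem theorem2:
  fixes N :: nat and U :: "complex mat"
  assumes "N \<ge> 1" and "is_unitary 4 U"
  shows "det_implementable 2 N U \<longleftrightarrow> KC_num U \<le> N"
proof -
  obtain x y z where w: "weyl_coords U = (x, y, z)" and ch: "weyl_chamber (x, y, z)"
    and le: "local_equiv U (canon_gate x y z)"
    using weyl_coords_props[OF assms(2)] by blast
  have order: "x = 0 \<Longrightarrow> y = 0" "y = 0 \<Longrightarrow> z = 0" using ch by (auto simp: weyl_chamber_def)
  \<comment> \<open>In the chamber zeros occur only at the end of the triple, so the count turns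
    into vanishing conditions on \<open>z\<close> and \<open>y\<close>; since
    \<open>N \<ge> 1\<close>, a nonzero \<open>x\<close> is always admissible.\<close>
  have KC: "KC_num U \<le> N \<longleftrightarrow> (N < 3 \<longrightarrow> z = 0) \<and> (N < 2 \<longrightarrow> y = 0)"
    using order assms(1) by (cases "x = 0"; cases "y = 0"; cases "z = 0") (auto simp: KC_num_def w)
  obtain u u' v v' where u: "is_unitary 2 u" "is_unitary 2 u'" "is_unitary 2 v" "is_unitary 2 v'"
    and U: "U = kron2 u u' * canon_gate x y z * kron2 v v'" using le unfolding local_equiv_def by blast
  show ?thesis
  proof
    assume "KC_num U \<le> N"
    then show "det_implementable 2 N U"
      using bridge_circuit_implementable[OF assms(1) bridge_circuit_canon[OF le assms(1)]] KC by blast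
  next
    assume d: "det_implementable 2 N U"
    obtain K c s where K: "product_form N K" "c \<in> bst (qubits 2 N - out_qubits 2)" "s \<noteq> 0" "branch_mat N K c
        = s \<cdot>\<^sub>m U"
      by (rule implementable_branch[OF assms d])
    \<comment> \<open>The inverse scalar is later moved into the first tensor factor of each term,
      so that \<open>U\<close> itself takes the form of the network.\<close>
    note Us = scaled_unitary_mult[OF K(3,4)]
    consider "N = 1" | "N = 2" | "3 \<le> N" using assms(1) by linarith
    then show "KC_num U \<le> N"
    proof cases
      case 1
      obtain B1 B2 D1 D2 where B: "B1 \<in> carrier_mat 2 2" "B2 \<in> carrier_mat 2 2" "D1 \<in> carrier_mat 2 2" "D2 \<in>
          carrier_mat 2 2"
        "branch_mat 1 K c = kron2 B1 D1 + kron2 B2 D2"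
        using branch_one_bridge K(1,2) unfolding 1 by blast
      have "U = kron2 (inverse s \<cdot>\<^sub>m B1) D1 + kron2 (inverse s \<cdot>\<^sub>m B2) D2"
        using Us B by (simp add: 1 kron2_smult_left add_smult_distrib_left_mat[of _ 4 4])
      note rank_two_imp_y_zero[OF _ _ B(3,4) assms(2) this u U ch]
      then have "z = 0" "y = 0" using B(1,2) by simp_all
      then show ?thesis using KC by simp
    next
      case 2
      obtain A1 A2 C1 C2 B1 B2 D1 D2 where B:
        "A1 \<in> carrier_mat 2 2" "A2 \<in> carrier_mat 2 2" "C1 \<in> carrier_mat 2 2" "C2 \<in> carrier_mat 2 2"
        "B1 \<in> carrier_mat 2 2" "B2 \<in> carrier_mat 2 2" "D1 \<in> carrier_mat 2 2" "D2 \<in> carrier_mat 2 2"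
        "branch_mat 2 K c = (kron2 B1 D1 + kron2 B2 D2) * (kron2 A1 C1 + kron2 A2 C2)"
        using branch_two_bridges K(1,2) unfolding 2 by blast
      have "U = (kron2 (inverse s \<cdot>\<^sub>m B1) D1 + kron2 (inverse s \<cdot>\<^sub>m B2) D2) * (kron2 A1 C1 + kron2 A2 C2)"
        using Us B by (simp add: 2 kron2_smult_left add_smult_distrib_left_mat[of _ 4 4, symmetric] smult_mat4)
      note rank_two_factors_imp_z_zero[OF B(1-4) _ _ B(7,8) assms(2) this u U ch]
      then have "z = 0" using B(5,6) by simp
      then show ?thesis using KC 2 by simp
    next
      case 3
      then show ?thesis using KC by simp
    qed
  qed
qed

end
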